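(* Let $K$ be an infinite field, $R=K[x,y,z]$, and let $I\subseteq R$ be the (radical, homogeneous) ideal of $r>1$ distinct points $p_1,\dots,p_r$ of $\mathbb{P}^2$ that lie on an irreducible conic. Let $P\subseteq\mathbb{R}^2_{\geq 0}$ be the limiting shape of the reverse lexicographic symbolic generic initial system $\{\mathrm{gin}(I^{(m)})\}_{m\geq 1}$. If $r\geq 4$, then $P$ is the set of points of $\mathbb{R}^2_{\geq 0}$ lying on or above the line through $(2,0)$ and $(0,\tfrac r2)$, i.e. its boundary is defined by this line. If $r=2$ or $r=3$, then $P$ is the set of points of $\mathbb{R}^2_{\geq 0}$ lying on or above the line through $(\tfrac r2,0)$ and $(0,2)$.
   Context: For the ideal $I$ of points $p_1,\dots,p_r$ with $I_{p_i}$ the ideal of $p_i$, the $m$-th symbolic power is $I^{(m)}=I_{p_1}^m\cap\cdots\cap I_{p_r}^m$. $\mathrm{gin}(J)$ denotes the generic initial ideal of a homogeneous ideal $J$ with respect to the reverse lexicographic order with $x>y>z$ (the initial ideal of $J$ after a general linear change of coordinates). Each $\mathrm{gin}(I^{(m)})$ is a monomial ideal minimally generated by monomials in $x$ and $y$ only, so its Newton polytope (the convex hull of the exponent vectors of monomials in the ideal) is regarded as a subset $P_{\mathrm{gin}(I^{(m)})}$ of $\mathbb{R}^2_{\geq 0}$, with first coordinate the exponent of $x$ and second the exponent of $y$. The limiting shape is $P=\lim_{m\to\infty}\frac1m P_{\mathrm{gin}(I^{(m)})}$. *)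

theory Defs
  imports "HOL-Analysis.Analysis" "HOL-Library.Poly_Mapping" "HOL-Library.Product_Plus"
    "HOL-Computational_Algebra.Factorial_Ring"
begin

text \<open>A polynomial in x,y,z is a finitely supported map from exponent triples (a,b,c)
  (standing for x^a y^b z^c) to coefficients; ring operations come from Poly_Mapping.\<close>

type_synonym 'a pol3 = "(nat \<times> nat \<times> nat) \<Rightarrow>\<^sub>0 'a"

definition peval :: "'a::comm_ring_1 pol3 \<Rightarrow> 'a \<times> 'a \<times> 'a \<Rightarrow> 'a" where
  "peval f v = (\<Sum>e\<in>Poly_Mapping.keys f. Poly_Mapping.lookup f e * fst v ^ fst e * fst (snd v) ^ fst (snd e)
                               * snd (snd v) ^ snd (snd e))"

definition tdeg :: "nat \<times> nat \<times> nat \<Rightarrow> nat" where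
  "tdeg e = fst e + fst (snd e) + snd (snd e)"

definition homogeneous :: "'a::zero pol3 \<Rightarrow> nat \<Rightarrow> bool" where
  "homogeneous f d \<longleftrightarrow> (\<forall>e\<in>Poly_Mapping.keys f. tdeg e = d)"

definition smult3 :: "'a::times \<Rightarrow> 'a \<times> 'a \<times> 'a \<Rightarrow> 'a \<times> 'a \<times> 'a" where
  "smult3 t v = (t * fst v, t * fst (snd v), t * snd (snd v))"

definition is_ideal :: "'a::comm_ring_1 pol3 set \<Rightarrow> bool" where
  "is_ideal I \<longleftrightarrow> 0 \<in> I \<and> (\<forall>p\<in>I. \<forall>q\<in>I. p + q \<in> I) \<and> (\<forall>f. \<forall>p\<in>I. f * p \<in> I)"

definition ideal_gen :: "'a::comm_ring_1 pol3 set \<Rightarrow> 'a pol3 set" where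
  "ideal_gen S = \<Inter>{J. is_ideal J \<and> S \<subseteq> J}"

definition ideal_pow :: "'a::comm_ring_1 pol3 set \<Rightarrow> nat \<Rightarrow> 'a pol3 set" where
  "ideal_pow I m = ideal_gen {prod_list ps | ps. length ps = m \<and> set ps \<subseteq> I}"

text \<open>Homogeneous ideal of the projective point [v]: polynomials vanishing on the
  affine cone over [v] (equivalently, generated by the homogeneous forms vanishing at [v]).\<close>
definition point_ideal :: "'a::comm_ring_1 \<times> 'a \<times> 'a \<Rightarrow> 'a pol3 set" where
  "point_ideal v = {f. \<forall>t. peval f (smult3 t v) = 0}"

definition points_ideal :: "nat \<Rightarrow> (nat \<Rightarrow> 'a::comm_ring_1 \<times> 'a \<times> 'a) \<Rightarrow> 'a pol3 set" where
  "points_ideal r p = (\<Inter>i\<in>{..<r}. point_ideal (p i))"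

definition symbolic_power :: "nat \<Rightarrow> (nat \<Rightarrow> 'a::comm_ring_1 \<times> 'a \<times> 'a) \<Rightarrow> nat \<Rightarrow> 'a pol3 set" where
  "symbolic_power r p m = (\<Inter>i\<in>{..<r}. ideal_pow (point_ideal (p i)) m)"

definition distinct_proj_points :: "nat \<Rightarrow> (nat \<Rightarrow> 'a::field \<times> 'a \<times> 'a) \<Rightarrow> bool" where
  "distinct_proj_points r p \<longleftrightarrow> (\<forall>i<r. p i \<noteq> (0,0,0)) \<and>
     (\<forall>i<r. \<forall>j<r. i \<noteq> j \<longrightarrow> (\<forall>t. p i \<noteq> smult3 t (p j)))"

definition on_irreducible_conic :: "nat \<Rightarrow> (nat \<Rightarrow> 'a::field \<times> 'a \<times> 'a) \<Rightarrow> bool" where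
  "on_irreducible_conic r p \<longleftrightarrow> (\<exists>Q::'a pol3. Q \<noteq> 0 \<and> homogeneous Q 2 \<and> irreducible Q \<and>
      (\<forall>i<r. peval Q (p i) = 0))"

definition revlex_less :: "nat \<times> nat \<times> nat \<Rightarrow> nat \<times> nat \<times> nat \<Rightarrow> bool" where
  "revlex_less e e' \<longleftrightarrow> tdeg e < tdeg e' \<or>
     (tdeg e = tdeg e' \<and> (snd (snd e) > snd (snd e') \<or>
        (snd (snd e) = snd (snd e') \<and> fst (snd e) > fst (snd e'))))"

definition lead_exp :: "'a::zero pol3 \<Rightarrow> nat \<times> nat \<times> nat" where
  "lead_exp f = (THE e. e \<in> Poly_Mapping.keys f \<and> (\<forall>e'\<in>Poly_Mapping.keys f. e' \<noteq> e \<longrightarrow> revlex_less e' e))"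

definition initial_ideal :: "'a::comm_ring_1 pol3 set \<Rightarrow> 'a pol3 set" where
  "initial_ideal J = ideal_gen {Poly_Mapping.single (lead_exp f) 1 | f. f \<in> J \<and> f \<noteq> 0}"

definition lin_form :: "(nat \<Rightarrow> nat \<Rightarrow> 'a::comm_ring_1) \<Rightarrow> nat \<Rightarrow> 'a pol3" where
  "lin_form g i = Poly_Mapping.single (1,0,0) (g i 0) + Poly_Mapping.single (0,1,0) (g i 1)
                  + Poly_Mapping.single (0,0,1) (g i 2)"

definition lin_subst :: "(nat \<Rightarrow> nat \<Rightarrow> 'a::comm_ring_1) \<Rightarrow> 'a pol3 \<Rightarrow> 'a pol3" where
  "lin_subst g f = (\<Sum>e\<in>Poly_Mapping.keys f. Poly_Mapping.single (0,0,0) (Poly_Mapping.lookup f e)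
       * lin_form g 0 ^ fst e * lin_form g 1 ^ fst (snd e) * lin_form g 2 ^ snd (snd e))"

definition det3 :: "(nat \<Rightarrow> nat \<Rightarrow> 'a::comm_ring_1) \<Rightarrow> 'a" where
  "det3 g = g 0 0 * (g 1 1 * g 2 2 - g 1 2 * g 2 1) - g 0 1 * (g 1 0 * g 2 2 - g 1 2 * g 2 0)
          + g 0 2 * (g 1 0 * g 2 1 - g 1 1 * g 2 0)"

text \<open>Polynomials in the 9 matrix entries (variable 3*i+j is entry g i j), used to
  describe nonempty Zariski open subsets of the space of 3x3 matrices.\<close>
definition eval9 :: "((nat \<Rightarrow>\<^sub>0 nat) \<Rightarrow>\<^sub>0 'a::comm_ring_1) \<Rightarrow> (nat \<Rightarrow> nat \<Rightarrow> 'a) \<Rightarrow> 'a" where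
  "eval9 F g = (\<Sum>e\<in>Poly_Mapping.keys F. Poly_Mapping.lookup F e * (\<Prod>k\<in>Poly_Mapping.keys e. g (k div 3) (k mod 3) ^ Poly_Mapping.lookup e k))"

text \<open>M is the generic initial ideal of J: there is a nonempty Zariski open set U of
  invertible matrices (U = complement of the zero set of a nonzero polynomial F) such that
  the initial ideal of J after the change of coordinates g equals M for all g in U.\<close>
definition is_gin :: "'a::comm_ring_1 pol3 set \<Rightarrow> 'a pol3 set \<Rightarrow> bool" where
  "is_gin J M \<longleftrightarrow> (\<exists>F. F \<noteq> 0 \<and> (\<forall>e\<in>Poly_Mapping.keys F. Poly_Mapping.keys e \<subseteq> {..<9}) \<and>
      (\<forall>g. eval9 F g \<noteq> 0 \<longrightarrow> det3 g \<noteq> 0 \<and> initial_ideal (lin_subst g ` J) = M))"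

definition gin :: "'a::comm_ring_1 pol3 set \<Rightarrow> 'a pol3 set" where
  "gin J = (THE M. is_gin J M)"

text \<open>Newton polytope of a monomial ideal generated by monomials in x,y,
  viewed in R^2 (x-exponent, y-exponent).\<close>
definition newton2 :: "'a::comm_ring_1 pol3 set \<Rightarrow> (real \<times> real) set" where
  "newton2 M = convex hull {(real a, real b) | a b. Poly_Mapping.single (a,b,0) 1 \<in> M}"

text \<open>Painleve-Kuratowski limit of a sequence of sets.\<close>
definition set_limit :: "(nat \<Rightarrow> (real \<times> real) set) \<Rightarrow> (real \<times> real) set \<Rightarrow> bool" where
  "set_limit S P \<longleftrightarrow>
     (\<forall>x. x \<in> P \<longleftrightarrow> (\<exists>u. (\<forall>\<^sub>F m in sequentially. u m \<in> S m) \<and> u \<longlonglongrightarrow> x)) \<and>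
     (\<forall>x r u. strict_mono r \<and> (\<forall>\<^sub>F n in sequentially. u n \<in> S (r n)) \<and> u \<longlonglongrightarrow> x \<longrightarrow> x \<in> P)"

definition limiting_shape :: "(nat \<Rightarrow> 'a::comm_ring_1 pol3 set) \<Rightarrow> (real \<times> real) set \<Rightarrow> bool" where
  "limiting_shape Js P \<longleftrightarrow>
     set_limit (\<lambda>m. (\<lambda>x. (1 / real m) *\<^sub>R x) ` newton2 (gin (Js m))) P"

end

(* Write J_m for the m-th symbolic power, G for the product of the lines p_i p_(i+1) taken cyclically and Q for
   the conic.  Then G (of degree r) and Q^2 (of degree 4) both have multiplicity 2 at every point, so after a generic
   change of coordinates the smaller degree gives the corner on the x-axis.  Modulo z the forms G and Q^2 are coprime,
   because Q vanishes on the line p_i p_(i+1) only at the two given points; hence every form of degree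
   max r 4 * n + 3 is congruent modulo z to an element of J_(2n), which gives the corner on the y-axis.

   Conversely, a form of J_m with leading monomial x^a y^b satisfies max r 4 * a + min r 4 * b >= 2 r m: for r >= 4,
   Bezout along the parametrised conic shows that Q divides every form of J_m of degree < r m / 2, and dividing by
   Q lowers a by 2 and m by 1; for r <= 3 the ideal J_m is monomial in coordinates based at the points.

   Every point lies off z = 0, so J_m is saturated with respect to z and contains the leading monomials x^a y^b
   of all high degrees.  Thus only finitely many degrees matter, and in these Gaussian elimination over the ring of
   polynomials in the matrix entries yields the generic initial ideal, over any infinite field. *)

theory Submission
  imports Defs
begin

section \<open>Finitely supported functions as polynomials\<close>

text \<open>The two corners match because \<open>min r 4 * max r 4 = 4 * r\<close>: by Bezout, G and
  the squared conic meet with total multiplicity 4 r, and multiplicity 2 of both at r points already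
  accounts for all of it. So the line through the corners is exactly the bound that leading
  monomials satisfy. The offset 3 is r + 4 - 1 minus r: coprime binary forms of degrees r and 4
  generate all binary forms of degree at least r + 4 - 1. Irreducibility of the conic enters through
  one consequence: its polar form is nonzero on any two of the points. This makes sense in every
  characteristic, is stable under coordinate changes, and also yields smoothness at the points and
  independence of any three of them. The obstacle is that \<open>gin\<close> is a definite
  description, so nothing can be said about it before one ideal is shown to be the initial ideal on
  a nonempty open set of matrices. Only finitely many open conditions can be intersected, hence the
  need for a degree, uniform in the matrix, beyond which all leading monomials are known.\<close>

abbreviation "keys \<equiv> Poly_Mapping.keys"
abbreviation "lookup \<equiv> Poly_Mapping.lookup"
abbreviation "mon \<equiv> Poly_Mapping.single"

lemma poly_mapping_eq_sum:
  fixes f :: "'k \<Rightarrow>\<^sub>0 'c::comm_monoid_add"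
  shows "f = (\<Sum>e\<in>keys f. mon e (lookup f e))"
proof (rule poly_mapping_eqI)
  fix k
  show "lookup f k = lookup (\<Sum>e\<in>keys f. mon e (lookup f e)) k"
    by (cases "k \<in> keys f")
       (simp_all add: lookup_sum lookup_single when_def in_keys_iff)
qed

lemma poly_mapping_sum_induct [case_names zero mon add]:
  fixes f :: "'k \<Rightarrow>\<^sub>0 'c::comm_monoid_add"
  assumes "P 0" "\<And>e c. P (mon e c)" "\<And>f g. P f \<Longrightarrow> P g \<Longrightarrow> P (f + g)"
  shows "P f"
proof -
  have "P (\<Sum>e\<in>A. mon e (lookup f e))" if "finite A" for A
    using that by (induction A) (auto intro: assms)
  thus ?thesis using poly_mapping_eq_sum[of f] by (metis finite_keys)
qed

lemma lookup_mult_keys: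
  fixes f g :: "'k::comm_monoid_add \<Rightarrow>\<^sub>0 'c::comm_ring_1"
  shows
  "lookup (f * g) k = (\<Sum>a\<in>keys f. \<Sum>b\<in>keys g. if a + b = k then lookup f a * lookup g b else 0)"
proof -
  have "f * g = (\<Sum>a\<in>keys f. \<Sum>b\<in>keys g. mon (a + b) (lookup f a * lookup g b))"
    using arg_cong2[OF poly_mapping_eq_sum[of f] poly_mapping_eq_sum[of g], of "(*)"]
    by (simp only: sum_product mult_single)
  thus ?thesis by (simp add: lookup_sum lookup_single when_def)
qed

section \<open>Ring homomorphisms given by evaluation\<close>

definition rhom :: "('a::comm_ring_1 \<Rightarrow> 'b::comm_ring_1) \<Rightarrow> bool" where
  "rhom h \<longleftrightarrow> h 1 = 1 \<and> (\<forall>x y. h (x + y) = h x + h y) \<and> (\<forall>x y. h (x * y) = h x * h y)"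

lemma rhom_one: "rhom h \<Longrightarrow> h 1 = 1"
  and rhom_add: "rhom h \<Longrightarrow> h (x + y) = h x + h y"
  and rhom_mult: "rhom h \<Longrightarrow> h (x * y) = h x * h y"
  by (auto simp: rhom_def)

lemma rhom_zero: "rhom h \<Longrightarrow> h 0 = 0"
  using rhom_add[of h 0 0] by simp

lemma rhom_minus: "rhom h \<Longrightarrow> h (- x) = - h x"
  using rhom_add[of h x "- x"] rhom_zero[of h] by (simp add: eq_neg_iff_add_eq_0 add.commute)

lemma rhom_diff: "rhom h \<Longrightarrow> h (x - y) = h x - h y"
  using rhom_add[of h x "- y"] rhom_minus[of h y] by simp

lemma rhom_power: "rhom h \<Longrightarrow> h (x ^ n) = h x ^ n"
  by (induction n) (auto simp: rhom_one rhom_mult)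

lemma rhom_sum: "rhom h \<Longrightarrow> h (sum f A) = (\<Sum>x\<in>A. h (f x))"
  by (induction A rule: infinite_finite_induct) (auto simp: rhom_zero rhom_add)

lemmas rhom_simps = rhom_zero rhom_one rhom_add rhom_mult rhom_minus rhom_diff rhom_power

text \<open>A common form for all evaluations: \<open>h\<close> acts on coefficients and
  \<open>\<mu>\<close> on monomials. Values at points, linear substitutions, restrictions to
  parametrised curves and \<open>eval9\<close> are all instances, so multiplicativity is proved
  once.\<close>

definition gev :: "('a::comm_ring_1 \<Rightarrow> 'b::comm_ring_1) \<Rightarrow> ('m \<Rightarrow> 'b) \<Rightarrow> ('m \<Rightarrow>\<^sub>0 'a) \<Rightarrow> 'b" where
  "gev h \<mu> f = (\<Sum>e\<in>keys f. h (lookup f e) * \<mu> e)"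

lemma gev_superset:
  assumes "rhom h" "finite S" "keys f \<subseteq> S"
  shows "gev h \<mu> f = (\<Sum>e\<in>S. h (lookup f e) * \<mu> e)"
  unfolding gev_def using assms
  by (intro sum.mono_neutral_left) (auto simp: in_keys_iff rhom_zero)

lemma gev_add:
  assumes "rhom h"
  shows "gev h \<mu> (f + g) = gev h \<mu> f + gev h \<mu> g"
proof -
  let ?S = "keys f \<union> keys g"
  have "gev h \<mu> (f + g) = (\<Sum>e\<in>?S. h (lookup (f + g) e) * \<mu> e)"
    using keys_add[of f g] by (intro gev_superset assms) auto
  also have "\<dots> = gev h \<mu> f + gev h \<mu> g"
    using gev_superset[OF assms, of ?S f \<mu>] gev_superset[OF assms, of ?S g \<mu>]
    by (simp add: lookup_add rhom_add[OF assms] algebra_simps sum.distrib)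
  finally show ?thesis .
qed

lemma gev_zero [simp]: "gev h \<mu> 0 = 0"
  by (simp add: gev_def)

lemma gev_monom: "rhom h \<Longrightarrow> gev h \<mu> (mon e c) = h c * \<mu> e"
  by (cases "c = 0") (auto simp: gev_def rhom_zero)

lemma rhom_gev:
  fixes \<mu> :: "'m::comm_monoid_add \<Rightarrow> 'b::comm_ring_1"
  assumes h: "rhom h" and \<mu>: "\<mu> 0 = 1" "\<And>a b. \<mu> (a + b) = \<mu> a * \<mu> b"
  shows "rhom (gev h \<mu>)"
proof -
  have 1: "gev h \<mu> (mon e c * g) = gev h \<mu> (mon e c) * gev h \<mu> g" for e c g
    by (induction g rule: poly_mapping_sum_induct)
       (simp_all add: mult_single gev_monom[OF h] gev_add[OF h] rhom_mult[OF h] \<mu> algebra_simps)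
  have 2: "gev h \<mu> (f * g) = gev h \<mu> f * gev h \<mu> g" for f g
    by (induction f rule: poly_mapping_sum_induct)
       (simp_all add: 1 gev_add[OF h] distrib_right)
  have 3: "gev h \<mu> 1 = 1"
    using gev_monom[OF h, of \<mu> 0 1] by (simp add: \<mu> rhom_one[OF h])
  show ?thesis unfolding rhom_def using 2 3 gev_add[OF h] by blast
qed

lemma rhom_gev_comp:
  assumes "rhom \<theta>"
  shows "\<theta> (gev h \<mu> f) = gev (\<lambda>c. \<theta> (h c)) (\<lambda>e. \<theta> (\<mu> e)) f"
  by (simp add: gev_def rhom_sum[OF assms] rhom_mult[OF assms])

definition tri :: "'b \<Rightarrow> 'b \<Rightarrow> 'b \<Rightarrow> nat \<times> nat \<times> nat \<Rightarrow> 'b::comm_ring_1" where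
  "tri X Y Z e = X ^ fst e * Y ^ fst (snd e) * Z ^ snd (snd e)"

definition ev :: "('a::comm_ring_1 \<Rightarrow> 'b::comm_ring_1) \<Rightarrow> 'b \<Rightarrow> 'b \<Rightarrow> 'b \<Rightarrow> 'a pol3 \<Rightarrow> 'b" where
  "ev h X Y Z = gev h (tri X Y Z)"

lemma rhom_ev: "rhom h \<Longrightarrow> rhom (ev h X Y Z)"
  unfolding ev_def by (rule rhom_gev) (auto simp: tri_def power_add algebra_simps)

lemma ev_monom: "rhom h \<Longrightarrow> ev h X Y Z (mon (a,b,c) k) = h k * X ^ a * Y ^ b * Z ^ c"
  by (simp add: ev_def gev_monom tri_def algebra_simps)

lemma rhom_ev_comp:
  assumes "rhom \<theta>"
  shows "\<theta> (ev h X Y Z f) = ev (\<lambda>c. \<theta> (h c)) (\<theta> X) (\<theta> Y) (\<theta> Z) f"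
  by (simp add: ev_def rhom_gev_comp[OF assms] tri_def[abs_def] rhom_mult[OF assms] rhom_power[OF assms])

lemma rhom_id: "rhom (\<lambda>x. x)"
  by (simp add: rhom_def)

lemma rhom_const: "rhom (\<lambda>c::'a::comm_ring_1. mon (0::'m::comm_monoid_add) c)"
  by (simp add: rhom_def single_add mult_single)

lemma peval_ev: "peval f v = ev (\<lambda>x. x) (fst v) (fst (snd v)) (snd (snd v)) f"
  by (simp add: peval_def ev_def gev_def tri_def algebra_simps)

lemma rhom_peval: "rhom (\<lambda>f. peval f v)"
  unfolding peval_ev by (rule rhom_ev[OF rhom_id])

lemmas peval_simps = rhom_simps[OF rhom_peval]

lemma peval_monom [simp]: "peval (mon (a,b,c) k) (x,y,z) = k * x ^ a * y ^ b * z ^ c"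
  by (simp add: peval_ev ev_monom[OF rhom_id])

subsection \<open>Linear changes of coordinates\<close>

lemma zero_triple: "(0,0,0) = (0 :: nat \<times> nat \<times> nat)"
  by (simp add: zero_prod_def)

lemma lin_subst_ev:
  "lin_subst g f = ev (mon 0) (lin_form g 0) (lin_form g 1) (lin_form g 2) f"
  by (simp add: lin_subst_def ev_def gev_def tri_def algebra_simps zero_triple)

lemma rhom_lin_subst: "rhom (lin_subst g)"
  unfolding lin_subst_ev[abs_def] by (rule rhom_ev[OF rhom_const])

lemmas lin_subst_simps = rhom_simps[OF rhom_lin_subst]

lemma lin_subst_monom:
  "lin_subst g (mon (a,b,c) k) = mon 0 k * lin_form g 0 ^ a * lin_form g 1 ^ b * lin_form g 2 ^ c"
  by (simp add: lin_subst_ev ev_monom[OF rhom_const])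

lemma lin_subst_const [simp]: "lin_subst g (mon 0 k) = mon 0 k"
  using lin_subst_monom[of g 0 0 0 k] by (simp add: zero_triple)

definition linf :: "'a::comm_ring_1 \<times> 'a \<times> 'a \<Rightarrow> 'a pol3" where
  "linf v = mon (1,0,0) (fst v) + mon (0,1,0) (fst (snd v)) + mon (0,0,1) (snd (snd v))"

lemma lin_form_linf: "lin_form g i = linf (g i 0, g i 1, g i 2)"
  by (simp add: lin_form_def linf_def)

definition mv :: "(nat \<Rightarrow> nat \<Rightarrow> 'a::comm_ring_1) \<Rightarrow> 'a \<times> 'a \<times> 'a \<Rightarrow> 'a \<times> 'a \<times> 'a" where
  "mv g v = (case v of (x,y,z) \<Rightarrow> (g 0 0 * x + g 0 1 * y + g 0 2 * z,
     g 1 0 * x + g 1 1 * y + g 1 2 * z, g 2 0 * x + g 2 1 * y + g 2 2 * z))"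

definition mm :: "(nat \<Rightarrow> nat \<Rightarrow> 'a::comm_ring_1) \<Rightarrow> (nat \<Rightarrow> nat \<Rightarrow> 'a) \<Rightarrow> nat \<Rightarrow> nat \<Rightarrow> 'a" where
  "mm g h i j = g i 0 * h 0 j + g i 1 * h 1 j + g i 2 * h 2 j"

definition dot :: "'a::comm_ring_1 \<times> 'a \<times> 'a \<Rightarrow> 'a \<times> 'a \<times> 'a \<Rightarrow> 'a" where
  "dot u v = fst u * fst v + fst (snd u) * fst (snd v) + snd (snd u) * snd (snd v)"

lemma peval_linf: "peval (linf u) v = dot u v"
  by (cases v; cases u) (simp add: linf_def dot_def peval_simps)

lemma peval_lin_subst: "peval (lin_subst g f) v = peval f (mv g v)"
proof -
  have "peval (lin_subst g f) v = ev (\<lambda>c. peval (mon 0 c) v) (peval (lin_form g 0) v) (peval (lin_form g 1) v) (peval (lin_form g 2) v) f"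
    unfolding lin_subst_ev by (rule rhom_ev_comp[OF rhom_peval])
  also have "(\<lambda>c. peval (mon 0 c) v) = (\<lambda>c. c)"
    by (cases v) (simp add: zero_triple[symmetric])
  finally show ?thesis
    by (cases v) (simp add: lin_form_linf peval_linf peval_ev[of f] mv_def dot_def)
qed

lemma linf_add: "linf (a,b,c) + linf (a',b',c') = linf (a+a', b+b', c+c')"
  by (simp add: linf_def single_add)

lemma linf_smult: "mon 0 k * linf (a,b,c) = linf (k*a, k*b, k*c)"
  by (simp add: linf_def distrib_left mult_single)

lemma lin_subst_linf:
  "lin_subst g (linf (a,b,c)) = linf (a * g 0 0 + b * g 1 0 + c * g 2 0,
     a * g 0 1 + b * g 1 1 + c * g 2 1, a * g 0 2 + b * g 1 2 + c * g 2 2)"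
proof -
  have "lin_subst g (linf (a,b,c)) = mon 0 a * lin_form g 0 + mon 0 b * lin_form g 1 + mon 0 c * lin_form g 2"
    by (simp add: linf_def lin_subst_simps lin_subst_monom)
  thus ?thesis by (simp add: lin_form_linf linf_smult linf_add)
qed

text \<open>Substitution acts on functions and is therefore contravariant: the order of the matrices
  is reversed.\<close>

lemma lin_subst_mm: "lin_subst g (lin_subst h f) = lin_subst (mm h g) f"
proof -
  have "lin_subst g (lin_subst h f) = ev (\<lambda>c. lin_subst g (mon 0 c)) (lin_subst g (lin_form h 0)) (lin_subst g (lin_form h 1)) (lin_subst g (lin_form h 2)) f"
    unfolding lin_subst_ev[of h] by (rule rhom_ev_comp[OF rhom_lin_subst])
  thus ?thesis
    by (simp add: lin_subst_ev[of _ f] lin_form_linf lin_subst_linf mm_def)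
qed

definition idm :: "nat \<Rightarrow> nat \<Rightarrow> 'a::comm_ring_1" where
  "idm i j = (if i = j then 1 else 0)"

text \<open>Matrices are functions on all pairs of naturals, so identities such as g times its
  inverse being \<open>idm\<close> can only be expected on the 3x3 block.\<close>

definition eq3 :: "(nat \<Rightarrow> nat \<Rightarrow> 'a) \<Rightarrow> (nat \<Rightarrow> nat \<Rightarrow> 'a) \<Rightarrow> bool" where
  "eq3 g h \<longleftrightarrow> (\<forall>i<3. \<forall>j<3. g i j = h i j)"

lemma lin_subst_cong: "eq3 g h \<Longrightarrow> lin_subst g f = lin_subst h f"
  by (simp add: eq3_def lin_subst_ev lin_form_def)

lemma lin_subst_idm: "lin_subst idm f = f"
proof (induction f rule: poly_mapping_sum_induct)
  case (mon e c)
  obtain x y z where e: "e = (x,y,z)" by (cases e) auto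
  have *: "mon u (1::'a) ^ n = mon (fst u * n, fst (snd u) * n, snd (snd u) * n) 1" for u :: "nat \<times> nat \<times> nat" and n
    by (induction n) (simp_all add: mult_single zero_triple plus_prod_def)
  show ?case
    by (simp add: e lin_subst_monom lin_form_def idm_def * mult_single)
qed (simp_all add: lin_subst_simps)

text \<open>The adjugate. With cyclically shifted indices each 2x2 minor already carries the sign of
  its cofactor.\<close>

definition adj :: "(nat \<Rightarrow> nat \<Rightarrow> 'a::comm_ring_1) \<Rightarrow> nat \<Rightarrow> nat \<Rightarrow> 'a" where
  "adj g i j = (let i1 = (i + 1) mod 3; i2 = (i + 2) mod 3; j1 = (j + 1) mod 3; j2 = (j + 2) mod 3
     in g j1 i1 * g j2 i2 - g j1 i2 * g j2 i1)"

lemma less3: "i < (3::nat) \<longleftrightarrow> i = 0 \<or> i = 1 \<or> i = 2"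
  by auto

lemma adj_entries:
  "adj g 0 0 = g 1 1 * g 2 2 - g 1 2 * g 2 1" "adj g 0 1 = g 2 1 * g 0 2 - g 2 2 * g 0 1"
  "adj g 0 2 = g 0 1 * g 1 2 - g 0 2 * g 1 1" "adj g 1 0 = g 1 2 * g 2 0 - g 1 0 * g 2 2"
  "adj g 1 1 = g 2 2 * g 0 0 - g 2 0 * g 0 2" "adj g 1 2 = g 0 2 * g 1 0 - g 0 0 * g 1 2"
  "adj g 2 0 = g 1 0 * g 2 1 - g 1 1 * g 2 0" "adj g 2 1 = g 2 0 * g 0 1 - g 2 1 * g 0 0"
  "adj g 2 2 = g 0 0 * g 1 1 - g 0 1 * g 1 0"
  by (simp_all add: adj_def Let_def numeral_2_eq_2)

lemmas adj_simps = adj_entries[unfolded One_nat_def]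

definition inv3 :: "(nat \<Rightarrow> nat \<Rightarrow> 'a::field) \<Rightarrow> nat \<Rightarrow> nat \<Rightarrow> 'a" where
  "inv3 g i j = adj g i j / det3 g"

lemma inv3:
  assumes "det3 g \<noteq> 0"
  shows "eq3 (mm g (inv3 g)) idm" "eq3 (mm (inv3 g) g) idm"
proof -
  have *: "mm g (inv3 g) i j = mm g (adj g) i j / det3 g" "mm (inv3 g) g i j = mm (adj g) g i j / det3 g" for i j
    by (simp_all add: mm_def inv3_def add_divide_distrib)
  have "mm g (adj g) i j = det3 g * idm i j" "mm (adj g) g i j = det3 g * idm i j" if "i < 3" "j < 3" for i j
    using that unfolding less3 by (auto simp: mm_def det3_def adj_simps idm_def algebra_simps)
  thus "eq3 (mm g (inv3 g)) idm" "eq3 (mm (inv3 g) g) idm"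
    using assms by (auto simp: eq3_def *)
qed

lemma lin_subst_inv3:
  assumes "det3 g \<noteq> 0"
  shows "lin_subst (inv3 g) (lin_subst g f) = f" "lin_subst g (lin_subst (inv3 g) f) = f"
  using lin_subst_cong[OF inv3(1)[OF assms]] lin_subst_cong[OF inv3(2)[OF assms]]
  by (simp_all add: lin_subst_mm lin_subst_idm)

lemma mv_mm: "mv g (mv h v) = mv (mm g h) v"
  by (cases v) (simp add: mv_def mm_def algebra_simps)

lemma mv_cong: "eq3 g h \<Longrightarrow> mv g v = mv h v"
  by (cases v) (simp add: mv_def eq3_def)

lemma mv_idm: "mv idm v = v"
  by (cases v) (simp add: mv_def idm_def)

lemma mv_inv3:
  assumes "det3 g \<noteq> 0"
  shows "mv (inv3 g) (mv g v) = v" "mv g (mv (inv3 g) v) = v"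
  using inv3[OF assms] by (simp_all add: mv_mm mv_cong mv_idm)

lemma mv_adj: "mv g (mv (adj g) v) = smult3 (det3 g) v"
  by (cases v) (simp add: mv_def adj_simps det3_def smult3_def algebra_simps)

lemma mv_smult3: "mv g (smult3 t v) = smult3 t (mv g v)"
  by (cases v) (simp add: mv_def smult3_def algebra_simps)

lemma smult3_smult3: "smult3 s (smult3 t v) = smult3 (s * t) (v :: 'a::comm_ring_1 \<times> 'a \<times> 'a)"
  by (simp add: smult3_def mult.assoc)

lemma smult3_1 [simp]: "smult3 1 v = v" "smult3 0 v = (0,0,0)" for v :: "'a::comm_ring_1 \<times> 'a \<times> 'a"
  by (simp_all add: smult3_def)

lemma mv_0 [simp]: "mv g (0,0,0) = (0,0,0)"
  by (simp add: mv_def)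

section \<open>Leading exponents\<close>

text \<open>Maxima are taken over finite supports only, so the locale also covers
  \<open>weight_less\<close>, which has infinite descending chains.\<close>

locale additive_order =
  fixes R :: "'m::cancel_comm_monoid_add \<Rightarrow> 'm \<Rightarrow> bool"
  assumes irrefl: "\<not> R a a"
    and trans: "R a b \<Longrightarrow> R b c \<Longrightarrow> R a c"
    and total: "a \<noteq> b \<Longrightarrow> R a b \<or> R b a"
    and add_right: "R a b \<Longrightarrow> R (a + c) (b + c)"
begin

definition is_lead :: "('m \<Rightarrow>\<^sub>0 'a::zero) \<Rightarrow> 'm \<Rightarrow> bool" where
  "is_lead f e \<longleftrightarrow> e \<in> keys f \<and> (\<forall>e'\<in>keys f. e' \<noteq> e \<longrightarrow> R e' e)"

lemma ex_max: "finite A \<Longrightarrow> A \<noteq> {} \<Longrightarrow> \<exists>e\<in>A. \<forall>e'\<in>A. e' \<noteq> e \<longrightarrow> R e' e"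
proof (induction A rule: finite_ne_induct)
  case (insert x A)
  then obtain e where e: "e \<in> A" "\<forall>e'\<in>A. e' \<noteq> e \<longrightarrow> R e' e" by auto
  show ?case
  proof (cases "R e x")
    case True
    hence "\<forall>e'\<in>insert x A. e' \<noteq> x \<longrightarrow> R e' x" using e trans by (metis insert_iff)
    thus ?thesis by blast
  next
    case False
    thus ?thesis using e total[of e x] by (intro bexI[of _ e]) auto
  qed
qed auto

lemma ex_lead: "f \<noteq> 0 \<Longrightarrow> \<exists>e. is_lead f e"
  using ex_max[of "keys f"] unfolding is_lead_def by (auto simp: keys_eq_empty)

lemma is_lead_unique: "is_lead f e \<Longrightarrow> is_lead f e' \<Longrightarrow> e = e'"
  unfolding is_lead_def by (metis trans irrefl)

text \<open>Every other pair of exponents has a strictly smaller sum, so the coefficient at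
  \<open>a + b\<close> is the product of two nonzero leading coefficients and cannot cancel.\<close>

lemma is_lead_mult:
  fixes f g :: "'m \<Rightarrow>\<^sub>0 'a::idom"
  assumes f: "is_lead f a" and g: "is_lead g b"
  shows "is_lead (f * g) (a + b)"
proof -
  have le: "R (x + y) (a + b)" if "x \<in> keys f" "y \<in> keys g" "x \<noteq> a \<or> y \<noteq> b" for x y
  proof -
    have "x = a \<or> R x a" "y = b \<or> R y b" using f g that by (auto simp: is_lead_def)
    thus ?thesis using that(3) trans add_right[of x a y] add_right[of y b a]
      by (metis add.commute)
  qed
  have "lookup (f * g) (a + b) = (\<Sum>x\<in>keys f. \<Sum>y\<in>keys g. if x = a \<and> y = b then lookup f a * lookup g b else 0)"
    unfolding lookup_mult_keys
    by (intro sum.cong refl) (use le irrefl in fastforce)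
  also have "\<dots> = (\<Sum>x\<in>keys f. if x = a then lookup f a * lookup g b else 0)"
    using g by (intro sum.cong refl) (auto simp: is_lead_def)
  also have "\<dots> = lookup f a * lookup g b" using f by (auto simp: is_lead_def)
  finally have "a + b \<in> keys (f * g)"
    using f g by (auto simp: is_lead_def in_keys_iff)
  moreover have "R e (a + b)" if "e \<in> keys (f * g)" "e \<noteq> a + b" for e
    using keys_mult[of f g] that le by auto
  ultimately show ?thesis by (auto simp: is_lead_def)
qed

lemma is_lead_mult_cancel:
  fixes f g :: "'m \<Rightarrow>\<^sub>0 'a::idom"
  assumes "is_lead (f * g) c" "is_lead f a"
  obtains b where "is_lead g b" "c = a + b"
proof -
  have "g \<noteq> 0" using assms by (auto simp: is_lead_def)
  then obtain b where "is_lead g b" using ex_lead by blast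
  thus ?thesis using is_lead_unique[OF assms(1) is_lead_mult[OF assms(2)]] that by blast
qed

text \<open>The constant sum is the n-fold multiple of \<open>a\<close>, written so that it makes
  sense in any additive monoid; \<open>sum_triple\<close> evaluates it for exponent triples.\<close>

lemma is_lead_power:
  fixes f :: "'m \<Rightarrow>\<^sub>0 'a::idom"
  assumes "is_lead f a"
  shows "is_lead (f ^ n) ((\<Sum>i<n. a))"
proof (induction n)
  case 0
  show ?case by (simp add: is_lead_def)
next
  case (Suc n)
  show ?case using is_lead_mult[OF Suc assms] by (simp only: power_Suc2 sum.lessThan_Suc)
qed

lemma is_lead_prod:
  fixes f :: "'i \<Rightarrow> 'm \<Rightarrow>\<^sub>0 'a::idom"
  assumes "finite I" "\<And>i. i \<in> I \<Longrightarrow> is_lead (f i) (a i)"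
  shows "is_lead (\<Prod>i\<in>I. f i) (\<Sum>i\<in>I. a i)"
  using assms
proof (induction I)
  case empty
  show ?case by (simp add: is_lead_def)
next
  case (insert i I)
  thus ?case using is_lead_mult[of "f i" "a i" "prod f I" "sum a I"] by simp
qed

end

lemma tdeg_add: "tdeg (a + b) = tdeg a + tdeg b"
  by (simp add: tdeg_def)

interpretation revlex: additive_order revlex_less
proof
  fix a b c :: "nat \<times> nat \<times> nat"
  show "\<not> revlex_less a a" by (simp add: revlex_less_def)
  show "revlex_less a b \<Longrightarrow> revlex_less b c \<Longrightarrow> revlex_less a c" by (auto simp: revlex_less_def)
  show "a \<noteq> b \<Longrightarrow> revlex_less a b \<or> revlex_less b a"
    by (cases a; cases b) (auto simp: revlex_less_def tdeg_def)
  show "revlex_less a b \<Longrightarrow> revlex_less (a + c) (b + c)" by (auto simp: revlex_less_def tdeg_add)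
qed

abbreviation "is_lead \<equiv> revlex.is_lead"

lemma is_lead_lead_exp: "f \<noteq> 0 \<Longrightarrow> is_lead f (lead_exp f)"
proof -
  assume "f \<noteq> 0"
  then obtain e where e: "is_lead f e" using revlex.ex_lead by blast
  have "lead_exp f = e" unfolding lead_exp_def revlex.is_lead_def[symmetric]
    using e revlex.is_lead_unique by (intro the_equality) blast+
  thus ?thesis using e by simp
qed

lemma is_lead_iff: "is_lead f e \<longleftrightarrow> f \<noteq> 0 \<and> lead_exp f = e"
  using is_lead_lead_exp revlex.is_lead_unique by (metis keys_zero empty_iff revlex.is_lead_def)

lemma is_lead_mon: "c \<noteq> 0 \<Longrightarrow> is_lead (mon e c) e"
  by (simp add: revlex.is_lead_def)

subsection \<open>Homogeneous components\<close>

definition hc :: "nat \<Rightarrow> 'a::comm_ring_1 pol3 \<Rightarrow> 'a pol3" where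
  "hc d f = (\<Sum>e\<in>keys f. if tdeg e = d then mon e (lookup f e) else 0)"

lemma lookup_hc: "lookup (hc d f) e = (if tdeg e = d then lookup f e else 0)"
proof -
  have "lookup (hc d f) e = (\<Sum>e'\<in>keys f. if e' = e then (if tdeg e = d then lookup f e else 0) else 0)"
    unfolding hc_def lookup_sum by (intro sum.cong) (auto simp: lookup_single when_def)
  thus ?thesis by (simp add: in_keys_iff)
qed

lemma hc_add: "hc d (f + g) = hc d f + hc d g"
  by (rule poly_mapping_eqI) (simp add: lookup_hc lookup_add)

lemma hc_zero [simp]: "hc d 0 = 0"
  by (simp add: hc_def)

lemma keys_hc: "keys (hc d f) = {e \<in> keys f. tdeg e = d}"
  by (auto simp: in_keys_iff lookup_hc split: if_splits)

lemma homogeneous_hc: "homogeneous (hc d f) d"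
  by (auto simp: homogeneous_def keys_hc)

lemma hc_homogeneous: "homogeneous f n \<Longrightarrow> hc d f = (if d = n then f else 0)"
  by (rule poly_mapping_eqI) (auto simp: lookup_hc homogeneous_def in_keys_iff)

lemma homogeneous_add: "homogeneous f d \<Longrightarrow> homogeneous g d \<Longrightarrow> homogeneous (f + g) d"
  using keys_add[of f g] by (fastforce simp: homogeneous_def)

lemma homogeneous_zero [simp]: "homogeneous 0 d"
  by (simp add: homogeneous_def)

lemma homogeneous_minus: "homogeneous f d \<Longrightarrow> homogeneous (- f) d" for f :: "'a::ab_group_add pol3"
  by (simp add: homogeneous_def in_keys_iff)

lemma homogeneous_diff: "homogeneous f d \<Longrightarrow> homogeneous g d \<Longrightarrow> homogeneous (f - g) d" for f :: "'a::ab_group_add pol3"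
  using homogeneous_add[of f d "-g"] homogeneous_minus[of g d] by simp

lemma homogeneous_mult: "homogeneous f a \<Longrightarrow> homogeneous g b \<Longrightarrow> homogeneous (f * g) (a + b)"
  for f g :: "'a::comm_ring_1 pol3"
  using keys_mult[of f g] by (fastforce simp: homogeneous_def tdeg_def)

lemma homogeneous_one: "homogeneous 1 0"
  by (simp add: homogeneous_def tdeg_def)

lemma homogeneous_mon: "homogeneous (mon e c) (tdeg e)"
  by (simp add: homogeneous_def)

lemma homogeneous_const: "homogeneous (mon 0 c) 0"
  using homogeneous_mon[of 0 c] by (simp add: tdeg_def)

lemma homogeneous_power: "homogeneous f d \<Longrightarrow> homogeneous (f ^ n) (n * d)"
  for f :: "'a::comm_ring_1 pol3"
  by (induction n) (auto simp: homogeneous_one homogeneous_mult)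

lemma homogeneous_prod:
  "finite A \<Longrightarrow> (\<And>i. i \<in> A \<Longrightarrow> homogeneous (f i) (d i)) \<Longrightarrow> homogeneous (\<Prod>i\<in>A. f i) (\<Sum>i\<in>A. d i)"
  for f :: "'i \<Rightarrow> 'a::comm_ring_1 pol3"
  by (induction A rule: finite_induct) (auto simp: homogeneous_one homogeneous_mult)

lemma homogeneous_sum:
  "(\<And>i. i \<in> A \<Longrightarrow> homogeneous (f i) d) \<Longrightarrow> homogeneous (\<Sum>i\<in>A. f i) d"
  by (induction A rule: infinite_finite_induct) (auto simp: homogeneous_add)

lemma homogeneous_linf: "homogeneous (linf v) 1"
  unfolding linf_def
  using homogeneous_mon[of "(1,0,0)" "fst v"] homogeneous_mon[of "(0,1,0)" "fst (snd v)"] homogeneous_mon[of "(0,0,1)" "snd (snd v)"]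
  by (intro homogeneous_add) (auto simp: tdeg_def)

lemma homogeneous_lin_subst:
  assumes "homogeneous f d"
  shows "homogeneous (lin_subst g f) d"
  unfolding lin_subst_def
proof (rule homogeneous_sum)
  fix e assume e: "e \<in> keys f"
  have L: "homogeneous (lin_form g i) 1" for i unfolding lin_form_linf by (rule homogeneous_linf)
  have "homogeneous (mon (0,0,0) (lookup f e) * lin_form g 0 ^ fst e * lin_form g 1 ^ fst (snd e)
       * lin_form g 2 ^ snd (snd e)) (0 + fst e * 1 + fst (snd e) * 1 + snd (snd e) * 1)"
    unfolding zero_triple by (intro homogeneous_mult homogeneous_power L homogeneous_const)
  thus "homogeneous (mon (0,0,0) (lookup f e) * lin_form g 0 ^ fst e * lin_form g 1 ^ fst (snd e)
       * lin_form g 2 ^ snd (snd e)) d"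
    using assms e by (simp add: homogeneous_def tdeg_def)
qed

lemma sum_hc: "(\<Sum>d\<in>tdeg ` keys f. hc d f) = f"
proof (rule poly_mapping_eqI)
  fix e
  show "lookup (\<Sum>d\<in>tdeg ` keys f. hc d f) e = lookup f e"
    by (cases "e \<in> keys f") (auto simp: lookup_sum lookup_hc in_keys_iff intro!: sum.neutral)
qed

lemma hc_sum: "hc d (\<Sum>i\<in>A. f i) = (\<Sum>i\<in>A. hc d (f i))"
  by (induction A rule: infinite_finite_induct) (auto simp: hc_add)

lemma hc_lin_subst: "hc d (lin_subst g f) = lin_subst g (hc d f)"
proof -
  have "hc d (lin_subst g f) = hc d (\<Sum>k\<in>tdeg ` keys f. lin_subst g (hc k f))"
    by (subst sum_hc[of f, symmetric]) (simp add: rhom_sum[OF rhom_lin_subst])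
  also have "\<dots> = (\<Sum>k\<in>tdeg ` keys f. if d = k then lin_subst g (hc k f) else 0)"
    unfolding hc_sum using homogeneous_lin_subst[OF homogeneous_hc]
    by (intro sum.cong refl hc_homogeneous)
  also have "\<dots> = lin_subst g (hc d f)"
  proof (cases "d \<in> tdeg ` keys f")
    case False
    hence "keys (hc d f) = {}" by (auto simp: keys_hc)
    hence "hc d f = 0" by (simp add: keys_eq_empty)
    thus ?thesis using False by (simp add: lin_subst_simps)
  qed auto
  finally show ?thesis .
qed

lemma hc_mult_homogeneous:
  assumes "homogeneous f k"
  shows "hc (k + d) (f * g) = f * hc d g"
proof -
  have "hc (k + d) (f * g) = hc (k + d) (\<Sum>j\<in>tdeg ` keys g. f * hc j g)"
    by (subst sum_hc[of g, symmetric]) (simp add: sum_distrib_left)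
  also have "\<dots> = (\<Sum>j\<in>tdeg ` keys g. if k + d = k + j then f * hc j g else 0)"
    unfolding hc_sum by (intro sum.cong refl hc_homogeneous homogeneous_mult assms homogeneous_hc)
  also have "\<dots> = f * hc d g"
  proof (cases "d \<in> tdeg ` keys g")
    case False
    hence "keys (hc d g) = {}" by (auto simp: keys_hc)
    hence "hc d g = 0" by (simp add: keys_eq_empty)
    thus ?thesis using False by simp
  qed auto
  finally show ?thesis .
qed

text \<open>Lets a cofactor be replaced by its component of the right degree, which avoids proving
  that factors of homogeneous polynomials are homogeneous.\<close>

lemma homogeneous_factor:
  assumes "homogeneous f k" "homogeneous (f * h) (k + d)"
  shows "f * h = f * hc d h"
  using hc_mult_homogeneous[OF assms(1), of d h] hc_homogeneous[OF assms(2), of "k + d"] by simp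

lemma peval_smult3:
  assumes "homogeneous f d"
  shows "peval f (smult3 t v) = t ^ d * peval f v"
  unfolding peval_def sum_distrib_left
proof (rule sum.cong)
  fix e assume "e \<in> keys f"
  hence "d = fst e + fst (snd e) + snd (snd e)" using assms by (auto simp: homogeneous_def tdeg_def)
  thus "lookup f e * fst (smult3 t v) ^ fst e * fst (snd (smult3 t v)) ^ fst (snd e) * snd (snd (smult3 t v)) ^ snd (snd e)
     = t ^ d * (lookup f e * fst v ^ fst e * fst (snd v) ^ fst (snd e) * snd (snd v) ^ snd (snd e))"
    by (simp add: smult3_def power_mult_distrib power_add)
qed simp

lemma mon_factor:
  fixes f :: "'a::comm_ring_1 pol3"
  assumes "\<forall>e\<in>keys f. u1 \<le> fst e \<and> u2 \<le> fst (snd e) \<and> u3 \<le> snd (snd e)"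
  shows "\<exists>h. f = mon (u1,u2,u3) 1 * h"
proof -
  have "f = (\<Sum>e\<in>keys f. mon (u1,u2,u3) 1 * mon (fst e - u1, fst (snd e) - u2, snd (snd e) - u3) (lookup f e))"
    by (subst poly_mapping_eq_sum) (use assms in \<open>auto simp: mult_single intro!: sum.cong\<close>)
  thus ?thesis unfolding sum_distrib_left[symmetric] by blast
qed

section \<open>Ideals of points and their powers\<close>

lemma is_ideal_ideal_gen: "is_ideal (ideal_gen S)"
  unfolding ideal_gen_def is_ideal_def by blast

lemma ideal_gen_superset: "S \<subseteq> ideal_gen S"
  unfolding ideal_gen_def by blast

lemma ideal_gen_least: "is_ideal J \<Longrightarrow> S \<subseteq> J \<Longrightarrow> ideal_gen S \<subseteq> J"
  unfolding ideal_gen_def by blast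

lemma is_ideal_ideal_pow: "is_ideal (ideal_pow I m)"
  unfolding ideal_pow_def by (rule is_ideal_ideal_gen)

lemma
  assumes "is_ideal J"
  shows ideal_0: "0 \<in> J"
    and ideal_add: "f \<in> J \<Longrightarrow> g \<in> J \<Longrightarrow> f + g \<in> J"
    and ideal_mult: "g \<in> J \<Longrightarrow> f * g \<in> J"
    and ideal_mult': "g \<in> J \<Longrightarrow> g * f \<in> J"
  using assms unfolding is_ideal_def by (auto simp: mult.commute)

lemma ideal_sum: "is_ideal J \<Longrightarrow> (\<And>i. i \<in> A \<Longrightarrow> f i \<in> J) \<Longrightarrow> sum f A \<in> J"
  by (induction A rule: infinite_finite_induct) (auto intro: ideal_0 ideal_add)

lemma prod_list_in_ideal_pow: "length ps = m \<Longrightarrow> set ps \<subseteq> I \<Longrightarrow> prod_list ps \<in> ideal_pow I m"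
  unfolding ideal_pow_def by (rule subsetD[OF ideal_gen_superset]) blast

lemma ideal_pow_least:
  assumes "is_ideal J" "\<And>ps. length ps = m \<Longrightarrow> set ps \<subseteq> I \<Longrightarrow> prod_list ps \<in> J" "f \<in> ideal_pow I m"
  shows "f \<in> J"
  using ideal_gen_least[OF assms(1), of "{prod_list ps | ps. length ps = m \<and> set ps \<subseteq> I}"] assms(2,3)
  unfolding ideal_pow_def by blast

lemma is_ideal_vimage_mult: "is_ideal J \<Longrightarrow> is_ideal {f. f * g \<in> J}"
  unfolding is_ideal_def by (auto simp: distrib_right mult.assoc)

text \<open>For a fixed factor, the polynomials whose product with it lies in the power form an
  ideal; hence it suffices to check generators, one factor at a time.\<close>

lemma ideal_pow_mult:
  assumes "f \<in> ideal_pow I a" "g \<in> ideal_pow I b"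
  shows "f * g \<in> ideal_pow I (a + b)"
proof -
  have 1: "f * prod_list qs \<in> ideal_pow I (a + b)" if "length qs = b" "set qs \<subseteq> I" for qs
    using ideal_pow_least[OF is_ideal_vimage_mult[OF is_ideal_ideal_pow, of "prod_list qs" I "a+b"] _ assms(1)]
      prod_list_in_ideal_pow[of "_ @ qs" "a + b" I] that by auto
  show ?thesis
    using ideal_pow_least[OF is_ideal_vimage_mult[OF is_ideal_ideal_pow, of f I "a+b"] _ assms(2)] 1
    by (auto simp: mult.commute)
qed

lemma ideal_pow_mem: "f \<in> I \<Longrightarrow> f \<in> ideal_pow I 1"
  using prod_list_in_ideal_pow[of "[f]" 1 I] by simp

lemma ideal_pow_0: "f \<in> ideal_pow I 0"
  using ideal_mult[OF is_ideal_ideal_pow prod_list_in_ideal_pow[of "[]" 0 I], of f] by simp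

lemma ideal_pow_power:
  assumes "f \<in> ideal_pow I k"
  shows "f ^ n \<in> ideal_pow I (n * k)"
  using ideal_pow_mult[OF assms] by (induction n) (auto simp: ideal_pow_0)

lemma ideal_pow_antimono:
  assumes "n \<le> m" "f \<in> ideal_pow I m"
  shows "f \<in> ideal_pow I n"
proof (rule ideal_pow_least[OF is_ideal_ideal_pow _ assms(2)])
  fix ps assume "length ps = m" "set ps \<subseteq> I"
  hence "prod_list (take n ps) \<in> ideal_pow I n"
    using assms(1) by (intro prod_list_in_ideal_pow) (auto dest: in_set_takeD)
  from ideal_mult'[OF is_ideal_ideal_pow this, of "prod_list (drop n ps)"]
  show "prod_list ps \<in> ideal_pow I n"
    by (metis append_take_drop_id prod_list.append)
qed

text \<open>Pulls the principal ideal of \<open>l ^ m\<close> back along a homomorphism. With a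
  restriction to a curve as \<open>\<theta>\<close> it turns multiplicity at a point into a multiple
  root of a univariate polynomial.\<close>

lemma ideal_pow_dvd:
  assumes \<theta>: "rhom \<theta>" and I: "\<And>f. f \<in> I \<Longrightarrow> l dvd \<theta> f" and f: "f \<in> ideal_pow I m"
  shows "l ^ m dvd \<theta> f"
proof -
  have "is_ideal {f. l ^ m dvd \<theta> f}"
    by (auto simp: is_ideal_def rhom_simps[OF \<theta>])
  moreover have "l ^ length ps dvd \<theta> (prod_list ps)" if "set ps \<subseteq> I" for ps
    using that by (induction ps) (auto simp: rhom_simps[OF \<theta>] intro: mult_dvd_mono I)
  ultimately show ?thesis using ideal_pow_least[of "{f. l ^ m dvd \<theta> f}" m I f] f by auto
qed

text \<open>For an additive weight, the polynomials supported in weight at least m form an ideal,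
  and weights add up along a product of m generators.\<close>

lemma ideal_pow_weight:
  fixes w :: "nat \<times> nat \<times> nat \<Rightarrow> nat" and I :: "'a::comm_ring_1 pol3 set"
  assumes w: "\<And>a b. w (a + b) = w a + w b"
    and I: "\<And>f e. f \<in> I \<Longrightarrow> e \<in> keys f \<Longrightarrow> w e \<ge> 1"
    and f: "f \<in> ideal_pow I m" "e \<in> keys f"
  shows "w e \<ge> m"
proof -
  let ?J = "\<lambda>m. {f :: 'a pol3. \<forall>e\<in>keys f. m \<le> w e}"
  have "is_ideal (?J m)"
    unfolding is_ideal_def
  proof (intro conjI ballI allI)
    fix p q assume "p \<in> ?J m" "q \<in> ?J m"
    thus "p + q \<in> ?J m" using keys_add[of p q] by blast
  next
    fix g p assume p: "p \<in> ?J m"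
    have "m \<le> w e" if e: "e \<in> keys (g * p)" for e
    proof -
      obtain a b where "e = a + b" "b \<in> keys p" using e keys_mult[of g p] by blast
      thus ?thesis using p by (simp add: w trans_le_add2)
    qed
    thus "g * p \<in> ?J m" by blast
  qed auto
  moreover have "prod_list ps \<in> ?J (length ps)" if "set ps \<subseteq> I" for ps
    using that
  proof (induction ps)
    case (Cons p ps)
    have "Suc (length ps) \<le> w e" if e: "e \<in> keys (p * prod_list ps)" for e
    proof -
      obtain a b where "e = a + b" "a \<in> keys p" "b \<in> keys (prod_list ps)"
        using e keys_mult[of p "prod_list ps"] by blast
      moreover have "1 \<le> w a" "length ps \<le> w b"
        using Cons calculation I[of p a] by auto
      ultimately show ?thesis by (simp add: w)
    qed
    thus ?case by simp
  qed auto
  ultimately show ?thesis using ideal_pow_least[of "?J m" m I f] f by auto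
qed

subsection \<open>Coordinate points\<close>

lemma infinite_poly_eq_0:
  fixes q :: "'a::field poly"
  assumes "infinite (UNIV :: 'a set)" "\<And>t. poly q t = 0"
  shows "q = 0"
  using assms poly_roots_finite[of q] by auto

lemma rhom_pconst: "rhom (\<lambda>c::'a::comm_ring_1. [:c:])"
  by (simp add: rhom_def)

lemma rhom_poly: "rhom (\<lambda>p. poly p (t::'a::comm_ring_1))"
  by (simp add: rhom_def)

lemma poly_ev: "poly (ev (\<lambda>c. [:c:]) X Y Z f) t = peval f (poly X t, poly Y t, poly Z t)"
  using rhom_ev_comp[OF rhom_poly[of t], of "\<lambda>c. [:c:]" X Y Z f] by (simp add: peval_ev)

lemma pX_power: "[:0, 1::'a::comm_ring_1:] ^ n = Polynomial.monom 1 n"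
  by (simp add: monom_altdef)

lemma coeff_ev_axis:
  "coeff (ev (\<lambda>c. [:c:]) [:0,1:] 0 0 f) n = lookup f (n,0,0)"
  "coeff (ev (\<lambda>c. [:c:]) 0 [:0,1:] 0 f) n = lookup f (0,n,0)"
  "coeff (ev (\<lambda>c. [:c:]) 0 0 [:0,1:] f) n = lookup f (0,0,n)"
proof -
  note r = rhom_simps[OF rhom_ev[OF rhom_pconst]]
  note m = ev_monom[OF rhom_pconst] lookup_single when_def pX_power power_0_left smult_monom
  have 1: "coeff (ev (\<lambda>c. [:c:]) [:0,1:] 0 0 (mon e c)) n = lookup (mon e c) (n,0,0)"
    "coeff (ev (\<lambda>c. [:c:]) 0 [:0,1:] 0 (mon e c)) n = lookup (mon e c) (0,n,0)"
    "coeff (ev (\<lambda>c. [:c:]) 0 0 [:0,1:] (mon e c)) n = lookup (mon e c) (0,0,n)" for e c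
    by (cases e; simp add: m)+
  show "coeff (ev (\<lambda>c. [:c:]) [:0,1:] 0 0 f) n = lookup f (n,0,0)"
    by (induction f rule: poly_mapping_sum_induct) (simp_all only: 1 r lookup_add coeff_add lookup_zero coeff_0)
  show "coeff (ev (\<lambda>c. [:c:]) 0 [:0,1:] 0 f) n = lookup f (0,n,0)"
    by (induction f rule: poly_mapping_sum_induct) (simp_all only: 1 r lookup_add coeff_add lookup_zero coeff_0)
  show "coeff (ev (\<lambda>c. [:c:]) 0 0 [:0,1:] f) n = lookup f (0,0,n)"
    by (induction f rule: poly_mapping_sum_induct) (simp_all only: 1 r lookup_add coeff_add lookup_zero coeff_0)
qed

text \<open>Over an infinite field, vanishing on a coordinate axis kills the restricted polynomial
  coefficient by coefficient, so neither a pure power of that variable nor a constant term can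
  occur.\<close>

lemma point_ideal_axis:
  fixes f :: "'a::field pol3"
  assumes inf: "infinite (UNIV :: 'a set)"
  shows "f \<in> point_ideal (1,0,0) \<Longrightarrow> e \<in> keys f \<Longrightarrow> 1 \<le> fst (snd e) + snd (snd e)"
    and "f \<in> point_ideal (0,1,0) \<Longrightarrow> e \<in> keys f \<Longrightarrow> 1 \<le> fst e + snd (snd e)"
    and "f \<in> point_ideal (0,0,1) \<Longrightarrow> e \<in> keys f \<Longrightarrow> 1 \<le> fst e + fst (snd e)"
proof -
  have *: "ev (\<lambda>c. [:c:]) X Y Z f = 0" if "\<And>t. peval f (poly X t, poly Y t, poly Z t) = 0" for X Y Z
    by (rule infinite_poly_eq_0[OF inf]) (simp add: poly_ev that)
  show "1 \<le> fst (snd e) + snd (snd e)" if "f \<in> point_ideal (1,0,0)" "e \<in> keys f"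
    using *[of "[:0,1:]" 0 0] coeff_ev_axis(1)[of f "fst e"] that
    by (cases e) (auto simp: point_ideal_def smult3_def in_keys_iff Suc_le_eq intro!: gr0I)
  show "1 \<le> fst e + snd (snd e)" if "f \<in> point_ideal (0,1,0)" "e \<in> keys f"
    using *[of 0 "[:0,1:]" 0] coeff_ev_axis(2)[of f "fst (snd e)"] that
    by (cases e) (auto simp: point_ideal_def smult3_def in_keys_iff Suc_le_eq intro!: gr0I)
  show "1 \<le> fst e + fst (snd e)" if "f \<in> point_ideal (0,0,1)" "e \<in> keys f"
    using *[of 0 0 "[:0,1:]"] coeff_ev_axis(3)[of f "snd (snd e)"] that
    by (cases e) (auto simp: point_ideal_def smult3_def in_keys_iff Suc_le_eq intro!: gr0I)
qed

lemma ideal_pow_axis: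
  fixes f :: "'a::field pol3"
  assumes inf: "infinite (UNIV :: 'a set)"
  shows "f \<in> ideal_pow (point_ideal (1,0,0)) m \<Longrightarrow> e \<in> keys f \<Longrightarrow> m \<le> fst (snd e) + snd (snd e)"
    and "f \<in> ideal_pow (point_ideal (0,1,0)) m \<Longrightarrow> e \<in> keys f \<Longrightarrow> m \<le> fst e + snd (snd e)"
    and "f \<in> ideal_pow (point_ideal (0,0,1)) m \<Longrightarrow> e \<in> keys f \<Longrightarrow> m \<le> fst e + fst (snd e)"
  by (rule ideal_pow_weight[of _ "point_ideal (1,0,0)" f m e] ideal_pow_weight[of _ "point_ideal (0,1,0)" f m e]
      ideal_pow_weight[of _ "point_ideal (0,0,1)" f m e]; simp add: point_ideal_axis[OF inf, unfolded One_nat_def])+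

lemma mon_power: "mon (a,b,c) k ^ n = mon (n * a, n * b, n * c) (k ^ n)" for k :: "'a::comm_ring_1" and a b c :: nat
proof (induction n)
  case 0
  show ?case by (simp add: zero_triple)
qed (simp add: mult_single)

lemma mon_mult_split: "mon (a,b,c) k = mon (a,0,0) k * mon (0,1,0) 1 ^ b * mon (0,0,1) 1 ^ c" for k :: "'a::comm_ring_1" and a b c :: nat
  by (simp only: mon_power) (simp add: mult_single)

text \<open>Both y and z vanish at (1,0,0), so a monomial with enough factors y and z lies in the
  power; the converse is the weight count of \<open>ideal_pow_axis\<close>.\<close>

lemma ideal_pow_e1_iff:
  fixes f :: "'a::field pol3"
  assumes inf: "infinite (UNIV :: 'a set)"
  shows "f \<in> ideal_pow (point_ideal (1,0,0)) m \<longleftrightarrow> (\<forall>e\<in>keys f. m \<le> fst (snd e) + snd (snd e))"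
proof
  assume *: "\<forall>e\<in>keys f. m \<le> fst (snd e) + snd (snd e)"
  let ?I = "point_ideal (1,0,0::'a)"
  have y: "mon (0,1,0) 1 \<in> ideal_pow ?I 1" and z: "mon (0,0,1) 1 \<in> ideal_pow ?I 1"
    by (rule ideal_pow_mem; simp add: point_ideal_def smult3_def)+
  have "mon e (lookup f e) \<in> ideal_pow ?I m" if "e \<in> keys f" for e
  proof -
    obtain a b c where e: "e = (a,b,c)" by (cases e)
    have "mon (a,0,0) (lookup f e) * mon (0,1,0) 1 ^ b * mon (0,0,1) 1 ^ c \<in> ideal_pow ?I (0 + b * 1 + c * 1)"
      by (intro ideal_pow_mult ideal_pow_0 ideal_pow_power y z)
    thus ?thesis using that * ideal_pow_antimono[of m "b + c" _ ?I]
      by (auto simp: e mon_mult_split[of a b c])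
  qed
  thus "f \<in> ideal_pow ?I m"
    by (subst poly_mapping_eq_sum) (rule ideal_sum[OF is_ideal_ideal_pow])
qed (use ideal_pow_axis(1)[OF inf] in blast)

subsection \<open>Bases of the plane\<close>

definition cross :: "'a::comm_ring_1 \<times> 'a \<times> 'a \<Rightarrow> 'a \<times> 'a \<times> 'a \<Rightarrow> 'a \<times> 'a \<times> 'a" where
  "cross u v = (fst (snd u) * snd (snd v) - snd (snd u) * fst (snd v),
     snd (snd u) * fst v - fst u * snd (snd v), fst u * fst (snd v) - fst (snd u) * fst v)"

definition vadd :: "'a::comm_ring_1 \<times> 'a \<times> 'a \<Rightarrow> 'a \<times> 'a \<times> 'a \<Rightarrow> 'a \<times> 'a \<times> 'a" where
  "vadd u v = (fst u + fst v, fst (snd u) + fst (snd v), snd (snd u) + snd (snd v))"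

definition comp3 :: "'a \<times> 'a \<times> 'a \<Rightarrow> nat \<Rightarrow> 'a" where
  "comp3 v i = (if i = 0 then fst v else if i = 1 then fst (snd v) else snd (snd v))"

definition cols :: "'a \<times> 'a \<times> 'a \<Rightarrow> 'a \<times> 'a \<times> 'a \<Rightarrow> 'a \<times> 'a \<times> 'a \<Rightarrow> nat \<Rightarrow> nat \<Rightarrow> 'a" where
  "cols u v w i j = comp3 (if j = 0 then u else if j = 1 then v else w) i"

lemma det3_cols: "det3 (cols u v w) = dot (cross u v) w"
  by (cases u; cases v; cases w) (simp add: det3_def cols_def comp3_def dot_def cross_def algebra_simps)

lemma mv_cols: "mv (cols u v w) (x,y,z) = vadd (smult3 x u) (vadd (smult3 y v) (smult3 z w))"
  by (cases u; cases v; cases w) (simp add: mv_def cols_def comp3_def vadd_def smult3_def algebra_simps)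

lemma dot_cross [simp]: "dot (cross u v) u = 0" "dot (cross u v) v = 0"
  by (cases u; cases v; simp add: dot_def cross_def algebra_simps)+

lemma vadd_0 [simp]: "vadd u (0,0,0) = u" "vadd (0,0,0) u = u"
  by (simp_all add: vadd_def)

lemma dot_vadd: "dot u (vadd v w) = dot u v + dot u w"
  by (simp add: dot_def vadd_def algebra_simps)

lemma dot_smult3: "dot u (smult3 t v) = t * dot u v"
  by (simp add: dot_def smult3_def algebra_simps)

lemma ex_dot_nonzero:
  assumes "u \<noteq> (0,0,0)"
  shows "\<exists>w. dot u w \<noteq> (0::'a::field)"
proof -
  have "dot u (1,0,0) \<noteq> 0 \<or> dot u (0,1,0) \<noteq> 0 \<or> dot u (0,0,1) \<noteq> 0"
    using assms by (cases u) (auto simp: dot_def)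
  thus ?thesis by blast
qed

lemma ex_basis1:
  assumes "(p :: 'a::field \<times> 'a \<times> 'a) \<noteq> (0,0,0)"
  shows "\<exists>v w. det3 (cols p v w) \<noteq> 0"
proof -
  have "cross p (1,0,0) \<noteq> (0,0,0) \<or> cross p (0,1,0) \<noteq> (0,0,0)"
    using assms by (cases p) (auto simp: cross_def)
  thus ?thesis using ex_dot_nonzero unfolding det3_cols by blast
qed

lemma cross_eq_0:
  assumes "cross u v = (0,0,0)" "v \<noteq> (0,0,0 :: 'a::field)"
  shows "\<exists>t. u = smult3 t v"
proof -
  obtain a b c x y z where e: "u = (a,b,c)" "v = (x,y,z)" by (cases u; cases v) auto
  have *: "b * z = c * y" "c * x = a * z" "a * y = b * x" using assms(1) by (auto simp: e cross_def)
  consider "x \<noteq> 0" | "y \<noteq> 0" | "z \<noteq> 0" using assms(2) e by auto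
  thus ?thesis
  proof cases
    case 1
    thus ?thesis using * by (intro exI[of _ "a / x"]) (simp add: e smult3_def field_simps)
  next
    case 2
    thus ?thesis using * by (intro exI[of _ "b / y"]) (simp add: e smult3_def field_simps)
  next
    case 3
    thus ?thesis using * by (intro exI[of _ "c / z"]) (simp add: e smult3_def field_simps)
  qed
qed

text \<open>Cramer's rule: the coordinates of \<open>cross u v\<close> are the 2x2 minors of u and
  v, and any nonzero one can be used to solve for the two coefficients.\<close>

lemma plane_span:
  fixes u v w :: "'a::field \<times> 'a \<times> 'a"
  assumes "dot (cross u v) w = 0" "cross u v \<noteq> (0,0,0)"
  shows "\<exists>s t. w = vadd (smult3 s u) (smult3 t v)"
proof -
  obtain a b c x y z p q r where e: "u = (a,b,c)" "v = (x,y,z)" "w = (p,q,r)"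
    by (cases u; cases v; cases w) auto
  have *: "(b*z-c*y)*p + (c*x-a*z)*q + (a*y-b*x)*r = 0"
    using assms(1) by (simp add: e dot_def cross_def)
  consider "b*z-c*y \<noteq> 0" | "c*x-a*z \<noteq> 0" | "a*y-b*x \<noteq> 0" using assms(2) by (auto simp: e cross_def)
  thus ?thesis
  proof cases
    case 1
    have "p * (b*z-c*y) = (q*z-r*y)*a + (b*r-c*q)*x" using * by (simp add: algebra_simps)
    thus ?thesis using 1
      by (intro exI[of _ "(q*z-r*y)/(b*z-c*y)"] exI[of _ "(b*r-c*q)/(b*z-c*y)"])
         (simp add: e smult3_def vadd_def divide_simps, simp add: algebra_simps)
  next
    case 2
    have "q * (c*x-a*z) = (r*x-p*z)*b + (c*p-a*r)*y" using * by (simp add: algebra_simps)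
    thus ?thesis using 2
      by (intro exI[of _ "(r*x-p*z)/(c*x-a*z)"] exI[of _ "(c*p-a*r)/(c*x-a*z)"])
         (simp add: e smult3_def vadd_def divide_simps, simp add: algebra_simps)
  next
    case 3
    have "r * (a*y-b*x) = (p*y-q*x)*c + (a*q-b*p)*z" using * by (simp add: algebra_simps)
    thus ?thesis using 3
      by (intro exI[of _ "(p*y-q*x)/(a*y-b*x)"] exI[of _ "(a*q-b*p)/(a*y-b*x)"])
         (simp add: e smult3_def vadd_def divide_simps, simp add: algebra_simps)
  qed
qed

subsection \<open>Change of coordinates for powers of point ideals\<close>

lemma lin_subst_point_ideal:
  assumes "mv g v = smult3 c p" "f \<in> point_ideal p"
  shows "lin_subst g f \<in> point_ideal v"
  using assms by (auto simp: point_ideal_def peval_lin_subst mv_smult3 smult3_smult3)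

lemma lin_subst_prod_list: "lin_subst g (prod_list ps) = prod_list (map (lin_subst g) ps)"
  by (induction ps) (auto simp: lin_subst_simps)

lemma lin_subst_ideal_pow:
  assumes "mv g v = smult3 c p" "f \<in> ideal_pow (point_ideal p) m"
  shows "lin_subst g f \<in> ideal_pow (point_ideal v) m"
proof -
  have "is_ideal {f. lin_subst g f \<in> ideal_pow (point_ideal v) m}"
    using is_ideal_ideal_pow[of "point_ideal v" m] unfolding is_ideal_def by (auto simp: lin_subst_simps)
  moreover have "lin_subst g (prod_list ps) \<in> ideal_pow (point_ideal v) m"
    if "length ps = m" "set ps \<subseteq> point_ideal p" for ps
    unfolding lin_subst_prod_list using that lin_subst_point_ideal[OF assms(1)]
    by (intro prod_list_in_ideal_pow) auto
  ultimately show ?thesis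
    using ideal_pow_least[of "{f. lin_subst g f \<in> ideal_pow (point_ideal v) m}" m "point_ideal p" f] assms(2)
    by blast
qed

text \<open>The scalar c is kept because points are later moved by the adjugate, which inverts the
  matrix only up to its determinant.\<close>

lemma lin_subst_ideal_pow_iff:
  fixes f :: "'a::field pol3"
  assumes "det3 g \<noteq> 0" "mv g v = smult3 c p" "c \<noteq> 0"
  shows "lin_subst g f \<in> ideal_pow (point_ideal v) m \<longleftrightarrow> f \<in> ideal_pow (point_ideal p) m"
proof
  assume *: "lin_subst g f \<in> ideal_pow (point_ideal v) m"
  have "smult3 c (mv (inv3 g) p) = v" using mv_inv3(1)[OF assms(1), of v] by (simp add: assms(2) mv_smult3)
  hence "smult3 (1/c) v = mv (inv3 g) p" using assms(3) by (auto simp: smult3_smult3)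
  from lin_subst_ideal_pow[OF this[symmetric] *]
  show "f \<in> ideal_pow (point_ideal p) m" by (simp add: lin_subst_inv3[OF assms(1)])
qed (use lin_subst_ideal_pow[OF assms(2)] in blast)

text \<open>Moving p to (1,0,0) makes membership in powers of its ideal a condition on single
  exponents. One chart serves all f and m, so multiplicities of different polynomials can be
  compared in it.\<close>

lemma point_chart:
  fixes p :: "'a::field \<times> 'a \<times> 'a"
  assumes inf: "infinite (UNIV :: 'a set)" and p: "p \<noteq> (0,0,0)"
  shows "\<exists>g. det3 g \<noteq> 0 \<and> (\<forall>f m. f \<in> ideal_pow (point_ideal p) m \<longleftrightarrow>
           (\<forall>e\<in>keys (lin_subst g f). m \<le> fst (snd e) + snd (snd e)))"
proof -
  obtain v w where d: "det3 (cols p v w) \<noteq> 0" using ex_basis1[OF p] by blast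
  have m: "mv (cols p v w) (1,0,0) = smult3 1 p" by (simp add: mv_cols)
  show ?thesis
    using d lin_subst_ideal_pow_iff[OF d m] ideal_pow_e1_iff[OF inf] by (intro exI[of _ "cols p v w"]) auto
qed

lemma hc_ideal_pow:
  fixes p :: "'a::field \<times> 'a \<times> 'a"
  assumes inf: "infinite (UNIV :: 'a set)" and p: "p \<noteq> (0,0,0)" and f: "f \<in> ideal_pow (point_ideal p) m"
  shows "hc d f \<in> ideal_pow (point_ideal p) m"
proof -
  from point_chart[OF inf p] obtain g where
    g: "\<And>f m. f \<in> ideal_pow (point_ideal p) m \<longleftrightarrow> (\<forall>e\<in>keys (lin_subst g f). m \<le> fst (snd e) + snd (snd e))"
    by blast
  show ?thesis using f unfolding g hc_lin_subst[symmetric] keys_hc by blast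
qed

text \<open>Orders monomials so that the lowest order of vanishing at (1,0,0) leads; reverse
  lexicographic order only breaks ties.\<close>

definition weight_less :: "nat \<times> nat \<times> nat \<Rightarrow> nat \<times> nat \<times> nat \<Rightarrow> bool" where
  "weight_less e e' \<longleftrightarrow> fst (snd e) + snd (snd e) > fst (snd e') + snd (snd e') \<or>
     (fst (snd e) + snd (snd e) = fst (snd e') + snd (snd e') \<and> revlex_less e e')"

interpretation wgt: additive_order weight_less
proof
  fix a b c :: "nat \<times> nat \<times> nat"
  show "\<not> weight_less a a" using revlex.irrefl by (simp add: weight_less_def)
  show "weight_less a b \<Longrightarrow> weight_less b c \<Longrightarrow> weight_less a c"
    using revlex.trans[of a b c] by (auto simp: weight_less_def)
  show "a \<noteq> b \<Longrightarrow> weight_less a b \<or> weight_less b a" using revlex.total[of a b] by (auto simp: weight_less_def)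
  show "weight_less a b \<Longrightarrow> weight_less (a + c) (b + c)"
    using revlex.add_right[of a b c] by (auto simp: weight_less_def)
qed

text \<open>Multiplicity at p is a valuation: in the chart the \<open>weight_less\<close>-leading
  terms of h and f multiply to a term that survives in the product, so a factor h of multiplicity at
  most k accounts for at most k. It is used with k = 1 for the conic and with k = 0 for powers of
  z.\<close>

lemma ideal_pow_saturated:
  fixes p :: "'a::field \<times> 'a \<times> 'a"
  assumes inf: "infinite (UNIV :: 'a set)" and p: "p \<noteq> (0,0,0)"
    and fh: "h * f \<in> ideal_pow (point_ideal p) m" and h: "h \<notin> ideal_pow (point_ideal p) (Suc k)"
  shows "f \<in> ideal_pow (point_ideal p) (m - k)"
proof (rule ccontr)
  let ?w = "\<lambda>e :: nat \<times> nat \<times> nat. fst (snd e) + snd (snd e)"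
  assume nf: "f \<notin> ideal_pow (point_ideal p) (m - k)"
  from point_chart[OF inf p] obtain g where
    g: "\<And>f m. f \<in> ideal_pow (point_ideal p) m \<longleftrightarrow> (\<forall>e\<in>keys (lin_subst g f). m \<le> ?w e)"
    by blast
  obtain a where a: "a \<in> keys (lin_subst g h)" "?w a < Suc k" using h unfolding g by (meson not_le)
  obtain b where b: "b \<in> keys (lin_subst g f)" "?w b < m - k" using nf unfolding g by (meson not_le)
  have "lin_subst g h \<noteq> 0" "lin_subst g f \<noteq> 0" using a b by auto
  then obtain a' b' where a': "wgt.is_lead (lin_subst g h) a'" and b': "wgt.is_lead (lin_subst g f) b'"
    using wgt.ex_lead by blast
  have "?w a' \<le> ?w a" "?w b' \<le> ?w b"
    using a a' b b' unfolding wgt.is_lead_def weight_less_def by (metis less_or_eq_imp_le)+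
  hence "?w (a' + b') < m" using a b by simp
  moreover have "a' + b' \<in> keys (lin_subst g (h * f))"
    using wgt.is_lead_mult[OF a' b'] by (simp add: lin_subst_simps wgt.is_lead_def)
  ultimately show False using fh unfolding g by force
qed

lemma linf_mem_point_ideal: "dot u p = 0 \<Longrightarrow> linf u \<in> point_ideal p"
  by (simp add: point_ideal_def peval_linf dot_smult3)

lemma homogeneous_mem_point_ideal: "homogeneous f d \<Longrightarrow> peval f p = 0 \<Longrightarrow> f \<in> point_ideal p"
  by (simp add: point_ideal_def peval_smult3)

lemma peval_zero_of_ideal_pow:
  assumes "f \<in> ideal_pow (point_ideal p) (Suc m)"
  shows "peval f p = 0"
proof -
  \<comment> \<open>Divisibility by a positive power of 0 means being 0, so
    \<open>ideal_pow_dvd\<close> applies with l = 0.\<close>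
  have "(0::'a::comm_ring_1) ^ Suc m dvd peval f p"
  proof (rule ideal_pow_dvd[OF rhom_peval _ assms])
    show "0 dvd peval f p" if "f \<in> point_ideal p" for f
      using that unfolding point_ideal_def by (auto dest!: spec[of _ 1])
  qed
  thus ?thesis by simp
qed

section \<open>Conics\<close>

lemma quadratic_form:
  fixes Q :: "'a::comm_ring_1 pol3"
  assumes "homogeneous Q 2"
  shows "Q = mon (2,0,0) (lookup Q (2,0,0)) + mon (0,2,0) (lookup Q (0,2,0)) + mon (0,0,2) (lookup Q (0,0,2))
    + mon (1,1,0) (lookup Q (1,1,0)) + mon (1,0,1) (lookup Q (1,0,1)) + mon (0,1,1) (lookup Q (0,1,1))"
    (is "Q = ?R")
proof (rule poly_mapping_eqI)
  fix e :: "nat \<times> nat \<times> nat"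
  obtain a b c where e: "e = (a,b,c)" by (cases e)
  show "lookup Q e = lookup ?R e"
  proof (cases "a + b + c = 2")
    case True
    hence "c = 0 \<and> b = 0 \<and> a = 2 \<or> c = 0 \<and> b = 1 \<and> a = 1 \<or> c = 0 \<and> b = 2 \<and> a = 0
       \<or> c = 1 \<and> b = 0 \<and> a = 1 \<or> c = 1 \<and> b = 1 \<and> a = 0 \<or> c = 2 \<and> b = 0 \<and> a = 0" by presburger
    thus ?thesis by (elim disjE) (simp_all add: e lookup_add lookup_single when_def)
  next
    case False
    hence "e \<notin> keys Q" using assms by (auto simp: homogeneous_def e tdeg_def dest: bspec)
    hence "lookup Q e = 0" by (simp add: in_keys_iff)
    thus ?thesis using False by (auto simp: e lookup_add lookup_single when_def)
  qed
qed

lemma peval_quadratic: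
  fixes Q :: "'a::comm_ring_1 pol3"
  assumes "homogeneous Q 2"
  shows "peval Q (x,y,z) = lookup Q (2,0,0) * x^2 + lookup Q (0,2,0) * y^2 + lookup Q (0,0,2) * z^2
    + lookup Q (1,1,0) * x * y + lookup Q (1,0,1) * x * z + lookup Q (0,1,1) * y * z"
  by (subst quadratic_form[OF assms]) (simp add: peval_simps)

text \<open>The polar form of Q without a factor 1/2, so that it remains meaningful in
  characteristic 2.\<close>

definition bil :: "'a::comm_ring_1 pol3 \<Rightarrow> 'a \<times> 'a \<times> 'a \<Rightarrow> 'a \<times> 'a \<times> 'a \<Rightarrow> 'a" where
  "bil Q v w = peval Q (vadd v w) - peval Q v - peval Q w"

lemma bil_explicit:
  fixes Q :: "'a::comm_ring_1 pol3"
  assumes "homogeneous Q 2"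
  shows "bil Q (x,y,z) (u,v,w) = 2 * lookup Q (2,0,0) * x * u + 2 * lookup Q (0,2,0) * y * v + 2 * lookup Q (0,0,2) * z * w
    + lookup Q (1,1,0) * (x * v + y * u) + lookup Q (1,0,1) * (x * w + z * u) + lookup Q (0,1,1) * (y * w + z * v)"
  by (simp add: bil_def vadd_def peval_quadratic[OF assms] power2_eq_square algebra_simps)

lemma peval_combination:
  fixes Q :: "'a::comm_ring_1 pol3"
  assumes "homogeneous Q 2"
  shows "peval Q (vadd (smult3 s v) (smult3 t w)) = s^2 * peval Q v + s * t * bil Q v w + t^2 * peval Q w"
  by (cases v; cases w)
     (simp add: vadd_def smult3_def peval_quadratic[OF assms] bil_explicit[OF assms] power2_eq_square algebra_simps)

lemma bil_commute: "bil Q v w = bil Q w v"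
  by (simp add: bil_def vadd_def add.commute)

lemma bil_smult: "homogeneous Q 2 \<Longrightarrow> bil Q (smult3 s v) (smult3 t w) = s * t * bil Q v w"
  for Q :: "'a::comm_ring_1 pol3"
  by (cases v; cases w) (simp add: smult3_def bil_explicit algebra_simps)

lemma bil_vadd: "homogeneous Q 2 \<Longrightarrow> bil Q v (vadd u w) = bil Q v u + bil Q v w"
  for Q :: "'a::comm_ring_1 pol3"
  by (cases v; cases w; cases u) (simp add: vadd_def bil_explicit algebra_simps)

lemma bil_smult_right: "homogeneous Q 2 \<Longrightarrow> bil Q v (smult3 t w) = t * bil Q v w"
  for Q :: "'a::comm_ring_1 pol3"
  using bil_smult[of Q 1 v t w] by simp

lemma bil_self: "homogeneous Q 2 \<Longrightarrow> bil Q v v = 2 * peval Q v"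
  for Q :: "'a::comm_ring_1 pol3"
  by (cases v) (simp add: bil_explicit peval_quadratic power2_eq_square algebra_simps)

lemma not_unit_if_vanishing:
  assumes "peval (f :: 'a::comm_ring_1 pol3) v = 0"
  shows "\<not> f dvd 1"
proof
  assume "f dvd 1"
  then obtain g where "1 = f * g" by (auto elim: dvdE)
  hence "peval 1 v = peval (f * g) v" by simp
  thus False using assms by (simp add: peval_simps)
qed

text \<open>If the polar form vanishes at two points of the conic, the line joining them is a component.\<close>
lemma bil_nonzero_if_irreducible:
  fixes Q :: "'a::field pol3"
  assumes Q: "homogeneous Q 2" "irreducible Q" and v: "peval Q u = 0" "peval Q v = 0" and uv: "cross u v \<noteq> (0,0,0)"
  shows "bil Q u v \<noteq> 0"
proof
  assume B: "bil Q u v = 0"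
  obtain w where w: "det3 (cols u v w) \<noteq> 0" using ex_dot_nonzero[OF uv] unfolding det3_cols by blast
  define N where "N = cols u v w"
  define Q' where "Q' = lin_subst N Q"
  have hQ': "homogeneous Q' 2" unfolding Q'_def by (rule homogeneous_lin_subst[OF Q(1)])
  have ev: "peval Q' (1,0,0) = 0" "peval Q' (0,1,0) = 0" "peval Q' (1,1,0) = 0"
    using v B by (simp_all add: Q'_def N_def peval_lin_subst mv_cols bil_def)
  define M where "M = linf (lookup Q' (1,0,1), lookup Q' (0,1,1), lookup Q' (0,0,2))"
  have "lookup Q' (2,0,0) = 0" "lookup Q' (0,2,0) = 0" "lookup Q' (1,1,0) = 0"
    using ev by (simp_all add: peval_quadratic[OF hQ'])
  \<comment> \<open>In the basis u, v, w the coefficients of x^2, y^2 and xy all vanish, so z can be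
    split off.\<close>
  hence "Q' = mon (0,0,1) 1 * M"
    by (subst quadratic_form[OF hQ']) (simp add: M_def linf_def distrib_left mult_single numeral_2_eq_2 add.assoc)
  hence "Q = lin_subst (inv3 N) (mon (0,0,1) 1) * lin_subst (inv3 N) M"
    using lin_subst_inv3(1)[of N Q] w by (simp add: Q'_def N_def lin_subst_simps)
  hence "lin_subst (inv3 N) (mon (0,0,1) 1) dvd 1 \<or> lin_subst (inv3 N) M dvd 1"
    using Q(2) by (auto dest: irreducibleD)
  \<comment> \<open>Linear forms vanish at the origin, hence neither factor is a unit.\<close>
  moreover have "peval (lin_subst (inv3 N) (mon (0,0,1) 1)) (0,0,0) = 0" "peval (lin_subst (inv3 N) M) (0,0,0) = 0"
    by (simp_all add: peval_lin_subst M_def peval_linf dot_def)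
  ultimately show False using not_unit_if_vanishing by blast
qed

section \<open>The rational parametrisation of a conic\<close>

lemma multiple_roots_degree:
  fixes q :: "'a::field poly"
  assumes "q \<noteq> 0" "finite S" "\<And>s. s \<in> S \<Longrightarrow> [:- s, 1:] ^ m dvd q"
  shows "card S * m \<le> degree q"
  using assms(2,1,3)
proof (induction S arbitrary: q)
  case (insert s S)
  obtain q' where q': "q = [:- s, 1:] ^ m * q'" using insert.prems(2)[of s] by (auto elim: dvdE)
  have q0: "q' \<noteq> 0" using insert.prems q' by auto
  have "[:- t, 1:] ^ m dvd q'" if "t \<in> S" for t
  proof -
    have "t \<noteq> s" using insert that by auto
    hence "order t ([:- s, 1:] ^ m) = 0" by (intro order_0I) simp
    hence "order t q = order t q'" using insert.prems(1) by (simp add: q' order_mult)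
    moreover have "m \<le> order t q" using insert.prems that order_divides[of t m q] by auto
    ultimately show ?thesis using order_divides[of t m q'] by auto
  qed
  from insert.IH[OF q0 this] have "card S * m \<le> degree q'" .
  moreover have "degree q = m + degree q'"
    unfolding q' using q0 by (subst degree_mult_eq) (auto simp: degree_linear_power)
  ultimately show ?case using insert by simp
qed simp

text \<open>The curve (k t^2, 1, t) runs through the conic c xy + q z^2 = 0 when k = - q / c; only
  (1,0,0) is missed and sits at t = infinity.\<close>

lemma coeff_conic_parametrization:
  "ev (\<lambda>c. [:c:]) (Polynomial.monom k 2) 1 [:0,1:] f =
     (\<Sum>e\<in>keys f. Polynomial.monom (lookup f e * k ^ fst e) (2 * fst e + snd (snd e)))"
  unfolding ev_def gev_def
  by (intro sum.cong refl) (simp add: tri_def monom_power pX_power mult_monom smult_monom mult.commute add.commute)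

text \<open>The condition on \<open>bil\<close> stands in for irreducibility and distinctness.
  Unlike irreducibility it is immediate to carry through a change of coordinates.\<close>

locale conic =
  fixes Q :: "'a::field pol3" and r :: nat and p :: "nat \<Rightarrow> 'a \<times> 'a \<times> 'a"
  assumes inf: "infinite (UNIV :: 'a set)" and hQ: "homogeneous Q 2" and r: "2 \<le> r"
    and on: "\<And>i. i < r \<Longrightarrow> peval Q (p i) = 0"
    and bil: "\<And>i j. i < r \<Longrightarrow> j < r \<Longrightarrow> i \<noteq> j \<Longrightarrow> bil Q (p i) (p j) \<noteq> 0"
begin

abbreviation "J \<equiv> symbolic_power r p"

lemma J_iff: "f \<in> J m \<longleftrightarrow> (\<forall>i<r. f \<in> ideal_pow (point_ideal (p i)) m)"
  by (auto simp: symbolic_power_def)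

text \<open>On the conic \<open>bil Q v v = 2 * peval Q v = 0\<close>, so proportional points would
  violate the condition on the polar form.\<close>

lemma not_proportional: "i < r \<Longrightarrow> j < r \<Longrightarrow> i \<noteq> j \<Longrightarrow> p i \<noteq> smult3 t (p j)"
  using bil[of i j] bil_smult[OF hQ, of t "p j" 1 "p j"] bil_self[OF hQ] on[of j] by auto

lemma p_nonzero: "i < r \<Longrightarrow> p i \<noteq> (0,0,0)"
proof -
  assume i: "i < r"
  have "\<exists>j<r. j \<noteq> i" using r by (intro exI[of _ "if i = 0 then 1 else 0"]) auto
  thus ?thesis using not_proportional[OF i, of _ 0] by auto
qed

lemma cross_nonzero: "i < r \<Longrightarrow> j < r \<Longrightarrow> i \<noteq> j \<Longrightarrow> cross (p i) (p j) \<noteq> (0,0,0)"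
  using cross_eq_0 p_nonzero not_proportional by metis

lemma is_ideal_J: "is_ideal (J m)"
  by (auto simp: is_ideal_def[of "J m"] J_iff intro: ideal_0 ideal_add ideal_mult is_ideal_ideal_pow)

lemma J_mult: "f \<in> J a \<Longrightarrow> g \<in> J b \<Longrightarrow> f * g \<in> J (a + b)"
  by (simp add: J_iff ideal_pow_mult)

lemma J_power: "f \<in> J a \<Longrightarrow> f ^ n \<in> J (n * a)"
  by (simp add: J_iff ideal_pow_power)

lemma J_antimono: "a \<le> b \<Longrightarrow> f \<in> J b \<Longrightarrow> f \<in> J a"
  unfolding J_iff using ideal_pow_antimono by blast

lemma J_0: "f \<in> J 0"
  by (simp add: J_iff ideal_pow_0)

lemma J_hc: "f \<in> J m \<Longrightarrow> hc d f \<in> J m"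
  unfolding J_iff using hc_ideal_pow[OF inf p_nonzero] by blast

lemma Q_in_J: "Q \<in> J 1"
  unfolding J_iff using homogeneous_mem_point_ideal[OF hQ] on ideal_pow_mem by blast

text \<open>The conic is smooth at p_i: on the line p_i + t p_j the form Q becomes t times the
  nonzero value \<open>bil Q (p i) (p j)\<close>, which has only a simple zero at t = 0.\<close>

lemma Q_not_in_square:
  assumes i: "i < r"
  shows "Q \<notin> ideal_pow (point_ideal (p i)) (Suc 1)"
proof
  assume *: "Q \<in> ideal_pow (point_ideal (p i)) (Suc 1)"
  obtain j where j: "j < r" "j \<noteq> i"
    using r by (metis Suc_1 Suc_le_lessD less_trans zero_less_one_class.zero_less_one lessI less_one nat_neq_iff)
  let ?X = "\<lambda>k. [:comp3 (p i) k, comp3 (p j) k:]"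
  define \<theta> where "\<theta> = ev (\<lambda>c. [:c:]) (?X 0) (?X 1) (?X 2)"
  have pv: "poly (\<theta> f) t = peval f (vadd (smult3 1 (p i)) (smult3 t (p j)))" for f t
    by (simp add: \<theta>_def poly_ev comp3_def vadd_def smult3_def)
  have "[:0,1:] ^ Suc 1 dvd \<theta> Q"
  proof (rule ideal_pow_dvd[OF _ _ *])
    show "rhom \<theta>" unfolding \<theta>_def by (rule rhom_ev[OF rhom_pconst])
    show "[:0,1:] dvd \<theta> f" if "f \<in> point_ideal (p i)" for f
      using that pv[of f 0] by (auto simp: point_ideal_def poly_eq_0_iff_dvd dest!: spec[of _ 1])
  qed
  moreover have "\<theta> Q = [:0, bil Q (p i) (p j):]"
  proof -
    have "\<theta> Q - [:0, bil Q (p i) (p j):] = 0"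
      by (rule infinite_poly_eq_0[OF inf])
         (simp add: pv peval_combination[OF hQ, of 1, unfolded smult3_1] on i j)
    thus ?thesis by simp
  qed
  ultimately have "degree ([:0,1::'a:] ^ Suc 1) \<le> 1"
    using dvd_imp_degree_le[of "[:0,1:] ^ Suc 1" "[:0, bil Q (p i) (p j):]"] bil[OF i j(1)] j by auto
  thus False by (simp only: pX_power) (simp add: degree_monom_eq)
qed

lemma J_div_Q: "Q * f \<in> J m \<Longrightarrow> f \<in> J (m - 1)"
  unfolding J_iff using ideal_pow_saturated[OF inf p_nonzero _ Q_not_in_square] by blast

subsection \<open>Curves of low degree contain the conic\<close>

text \<open>With n orthogonal to p_0 and p_1 for the polar form, Q becomes c xy + q z^2 in the basis
  p_0, p_1, n. A third point of the conic supplies such an n without dividing by 2.\<close>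

lemma normal_basis:
  assumes "3 \<le> r"
  shows "\<exists>n. det3 (cols (p 0) (p 1) n) \<noteq> 0 \<and> bil Q (p 0) n = 0 \<and> bil Q (p 1) n = 0 \<and> peval Q n \<noteq> 0"
proof -
  let ?c = "bil Q (p 0) (p 1)" and ?a = "bil Q (p 0) (p 2)" and ?b = "bil Q (p 1) (p 2)"
  have nz: "?c \<noteq> 0" "?a \<noteq> 0" "?b \<noteq> 0" using bil assms by auto
  \<comment> \<open>Subtracting the projection of p_2 to the hyperbolic plane of p_0 and p_1; the
    result satisfies Q(n) = - a b / c.\<close>
  define n0 where "n0 = vadd (smult3 (- ?b / ?c) (p 0)) (smult3 (- ?a / ?c) (p 1))"
  define n where "n = vadd (p 2) n0"
  have Q0: "peval Q (p 0) = 0" "peval Q (p 1) = 0" "peval Q (p 2) = 0" using on assms by auto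
  have B0: "bil Q (p 0) n = 0" "bil Q (p 1) n = 0"
    using nz Q0 by (simp_all add: n_def n0_def bil_vadd[OF hQ] bil_smult_right[OF hQ] bil_self[OF hQ] bil_commute[of Q "p (Suc 0)" "p 0"])
  define X where "X = ?a * ?b / ?c"
  have "bil Q (p 2) n0 = - 2 * X"
    unfolding X_def
    by (simp add: n0_def bil_vadd[OF hQ] bil_smult_right[OF hQ] bil_commute[of Q "p 2"] field_simps)
  moreover have "peval Q n0 = X"
    unfolding X_def using nz Q0 by (simp add: n0_def peval_combination[OF hQ])
  ultimately have "peval Q n = - X"
    using peval_combination[OF hQ, of 1 "p 2" 1 n0] by (simp add: n_def Q0)
  hence Qn: "peval Q n \<noteq> 0" using nz by (simp add: X_def)
  have "det3 (cols (p 0) (p 1) n) \<noteq> 0"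
  proof
    assume "det3 (cols (p 0) (p 1) n) = 0"
    then obtain s t where st: "n = vadd (smult3 s (p 0)) (smult3 t (p 1))"
      using plane_span[of "p 0" "p 1" n] cross_nonzero[of 0 1] assms by (auto simp: det3_cols)
    \<comment> \<open>A vector of that plane orthogonal to both p_0 and p_1 is zero, whereas Q(n) is
      nonzero.\<close>
    have "t * ?c = 0" "s * ?c = 0"
      using B0 Q0 by (simp_all add: st bil_vadd[OF hQ] bil_smult_right[OF hQ] bil_self[OF hQ] bil_commute[of Q "p (Suc 0)" "p 0"])
    hence "n = (0,0,0)" using nz by (simp add: st)
    thus False using Qn peval_smult3[OF hQ, of 0 "(0,0,0)"] by simp
  qed
  thus ?thesis using B0 Qn by blast
qed

end

text \<open>On forms without monomials divisible by XY the parametrisation of the conic is injective.\<close>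
lemma conic_normal_form:
  fixes f :: "'a::field pol3" and c q :: 'a
  assumes c: "c \<noteq> 0"
  defines "Q \<equiv> mon (1,1,0) c + mon (0,0,2) q"
  shows "\<exists>h f0. f = Q * h + f0 \<and> (\<forall>e\<in>keys f0. fst e = 0 \<or> fst (snd e) = 0)"
proof (induction f rule: poly_mapping_sum_induct)
  case zero
  show ?case by (intro exI[of _ 0]) auto
next
  case (mon e k)
  obtain x y z where e: "e = (x,y,z)" by (cases e)
  show ?case unfolding e
  proof (induction x arbitrary: y z k)
    case 0
    show ?case by (intro exI[of _ 0] exI[of _ "mon (0,y,z) k"]) auto
  next
    case (Suc x)
    show ?case
    proof (cases y)
      case 0
      show ?thesis unfolding 0 by (intro exI[of _ 0] exI[of _ "mon (Suc x,0,z) k"]) auto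
    next
      case (Suc y')
      obtain h f0 where h: "mon (x,y',z+2) (- q * k / c) = Q * h + f0" "\<forall>e\<in>keys f0. fst e = 0 \<or> fst (snd e) = 0"
        using Suc.IH by blast
      \<comment> \<open>Modulo Q, xy is - (q / c) z^2; each replacement lowers the exponent of
        x.\<close>
      have "mon (Suc x,y,z) k = Q * mon (x,y',z) (k / c) + mon (x,y',z+2) (- q * k / c)"
        using c by (simp add: Q_def Suc distrib_right mult_single single_uminus[symmetric] add.assoc single_add[symmetric])
      also have "\<dots> = Q * (mon (x,y',z) (k / c) + h) + f0" unfolding h(1) by (simp add: distrib_left)
      finally show ?thesis using h(2) by blast
    qed
  qed
next
  case (add f g)
  then obtain h f0 h' g0 where *: "f = Q * h + f0" "g = Q * h' + g0"
    "\<forall>e\<in>keys f0. fst e = 0 \<or> fst (snd e) = 0" "\<forall>e\<in>keys g0. fst e = 0 \<or> fst (snd e) = 0" by blast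
  have "f + g = Q * (h + h') + (f0 + g0)" by (simp add: * distrib_left)
  moreover have "\<forall>e\<in>keys (f0 + g0). fst e = 0 \<or> fst (snd e) = 0" using *(3,4) keys_add[of f0 g0] by (meson UnE subsetD)
  ultimately show ?case by blast
qed

text \<open>Reduce f modulo the conic to a form without multiples of xy; on these the
  parametrisation sends distinct monomials of one degree to distinct powers of t, so the remainder
  vanishes.\<close>

lemma conic_kernel:
  fixes f :: "'a::field pol3"
  assumes c: "c \<noteq> 0" and q: "q \<noteq> 0" and f: "homogeneous f d"
    and 0: "ev (\<lambda>c. [:c:]) (Polynomial.monom (- q / c) 2) 1 [:0,1:] f = 0"
  shows "\<exists>h. f = (mon (1,1,0) c + mon (0,0,2) q) * h"
proof -
  define Q :: "'a pol3" where "Q = mon (1,1,0) c + mon (0,0,2) q"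
  define \<psi> where "\<psi> = ev (\<lambda>c. [:c:]) (Polynomial.monom (- q / c) 2) 1 [:0,1:]"
  have rh: "rhom \<psi>" unfolding \<psi>_def by (rule rhom_ev[OF rhom_pconst])
  have "\<psi> Q = \<psi> (mon (1,1,0) c) + \<psi> (mon (0,0,2) q)" by (simp only: Q_def rhom_add[OF rh])
  hence \<psi>Q: "\<psi> Q = 0"
    using c by (simp add: \<psi>_def ev_monom[OF rhom_pconst] pX_power smult_monom add_monom)
  have hQ: "homogeneous Q 2" unfolding Q_def
    by (intro homogeneous_add) (auto simp: homogeneous_def tdeg_def)
  obtain h f0 where h: "f = Q * h + f0" "homogeneous f0 d" "\<forall>e\<in>keys f0. fst e = 0 \<or> fst (snd e) = 0"
  \<comment> \<open>In degree below 2 the form is already reduced; otherwise the cofactor is cut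
    down to its component of degree d - 2.\<close>
  proof (cases "d < 2")
    case True
    have "fst e = 0 \<or> fst (snd e) = 0" if "e \<in> keys f" for e
      using that f True by (auto simp: homogeneous_def tdeg_def)
    thus ?thesis using that[of 0 f] f by auto
  next
    case False
    then obtain d' where d: "d = 2 + d'" by (metis le_Suc_ex not_le)
    obtain h f0 where h: "f = Q * h + f0" "\<forall>e\<in>keys f0. fst e = 0 \<or> fst (snd e) = 0"
      using conic_normal_form[OF c, of f q] unfolding Q_def by blast
    have "f = Q * hc d' h + hc d f0"
      using hc_homogeneous[OF f, of d] hc_mult_homogeneous[OF hQ, of d' h] h(1) by (simp add: hc_add d)
    thus ?thesis using that[of "hc d' h" "hc d f0"] h(2) homogeneous_hc by (auto simp: keys_hc)
  qed
  \<comment> \<open>In degree d, x^a z^(d-a) yields t^(d+a) and y^b z^(d-b) yields t^(d-b), so the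
    power of t determines the monomial.\<close>
  have inj: "e = e'" if e: "e \<in> keys f0" "e' \<in> keys f0" "2 * fst e + snd (snd e) = 2 * fst e' + snd (snd e')" for e e'
  proof -
    have "tdeg e = d" "tdeg e' = d" "fst e = 0 \<or> fst (snd e) = 0" "fst e' = 0 \<or> fst (snd e') = 0"
      using e h by (auto simp: homogeneous_def)
    thus ?thesis using e(3) by (cases e; cases e') (auto simp: tdeg_def)
  qed
  have "f0 = 0"
  proof (rule ccontr)
    assume "f0 \<noteq> 0"
    then obtain e where e: "e \<in> keys f0" by (metis keys_eq_empty ex_in_conv)
    have "\<psi> (Q * h + f0) = 0" using 0 unfolding h(1) \<psi>_def .
    hence "\<psi> f0 = 0" by (simp add: rhom_simps[OF rh] \<psi>Q)
    hence "0 = coeff (\<psi> f0) (2 * fst e + snd (snd e))" by simp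
    also have "\<dots> = (\<Sum>e'\<in>keys f0. if e' = e then lookup f0 e * (- q / c) ^ fst e else 0)"
      unfolding \<psi>_def coeff_conic_parametrization coeff_sum coeff_monom
      using inj[OF _ e] by (intro sum.cong refl) auto
    also have "\<dots> = lookup f0 e * (- q / c) ^ fst e" using e by simp
    finally show False using e c q by (simp add: in_keys_iff)
  qed
  thus ?thesis using h(1) by (auto simp: Q_def)
qed

text \<open>Multiplicity m at (1,0,0), the point at t = infinity, appears as a drop of the degree by
  m below the generic value 2 d.\<close>

lemma degree_conic_parametrization:
  fixes f :: "'a::field pol3"
  assumes "homogeneous f d" "\<And>e. e \<in> keys f \<Longrightarrow> m \<le> fst (snd e) + snd (snd e)"
  shows "degree (ev (\<lambda>c. [:c:]) (Polynomial.monom k 2) 1 [:0,1:] f) \<le> 2 * d - m"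
  unfolding coeff_conic_parametrization
proof (rule degree_sum_le)
  fix e assume e: "e \<in> keys f"
  hence "tdeg e = d" using assms(1) by (auto simp: homogeneous_def)
  hence "2 * fst e + snd (snd e) \<le> 2 * d - m" using assms(2)[OF e] by (simp add: tdeg_def)
  thus "degree (Polynomial.monom (lookup f e * k ^ fst e) (2 * fst e + snd (snd e))) \<le> 2 * d - m"
    using degree_monom_le order_trans by blast
qed simp

context conic
begin

text \<open>Bezout on the parametrised conic: p_0 lowers the degree by m and the other r - 1 points
  give roots of order m, so a nonzero restriction would need 2 d >= r m. The restriction is
  therefore zero and \<open>conic_kernel\<close> applies.\<close>

lemma conic_dvd:
  assumes r3: "3 \<le> r" and f: "f \<in> J m" "homogeneous f d" and d: "2 * d < r * m"
  shows "\<exists>h. f = Q * h"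
proof -
  let ?c = "bil Q (p 0) (p 1)"
  obtain n where n: "det3 (cols (p 0) (p 1) n) \<noteq> 0" "bil Q (p 0) n = 0" "bil Q (p 1) n = 0" "peval Q n \<noteq> 0"
    using normal_basis[OF r3] by blast
  define N where "N = cols (p 0) (p 1) n"
  have det: "det3 N \<noteq> 0" using n by (simp add: N_def)
  have c: "?c \<noteq> 0" using bil[of 0 1] r3 by simp
  have Q0: "peval Q (p 0) = 0" "peval Q (p 1) = 0" using on r3 by auto
  define q where "q = peval Q n"
  define k where "k = - q / ?c"
  have k: "k \<noteq> 0" using n c by (simp add: k_def q_def)
  define f' where "f' = lin_subst N f"
  define Q' where "Q' = lin_subst N Q"
  have hQ': "homogeneous Q' 2" and hf': "homogeneous f' d"
    unfolding Q'_def f'_def by (intro homogeneous_lin_subst hQ f)+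
  have pQ': "peval Q' (x,y,z) = ?c * x * y + q * z^2" for x y z
  proof -
    define u where "u = vadd (smult3 y (p 1)) (smult3 z n)"
    have "peval Q u = q * z^2" "bil Q (p 0) u = y * ?c"
      using n Q0 unfolding u_def peval_combination[OF hQ] bil_vadd[OF hQ] bil_smult_right[OF hQ]
      by (simp_all add: q_def)
    thus ?thesis
      using peval_combination[OF hQ, of x "p 0" 1 u] Q0 by (simp add: Q'_def N_def peval_lin_subst mv_cols u_def)
  qed
  have "lookup Q' (2,0,0) = 0" "lookup Q' (0,2,0) = 0" "lookup Q' (0,0,2) = q" 
    using pQ'[of 1 0 0] pQ'[of 0 1 0] pQ'[of 0 0 1] by (simp_all add: peval_quadratic[OF hQ'])
  moreover from this have "lookup Q' (1,1,0) = ?c" "lookup Q' (1,0,1) = 0" "lookup Q' (0,1,1) = 0"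
    using pQ'[of 1 1 0] pQ'[of 1 0 1] pQ'[of 0 1 1] by (simp_all add: peval_quadratic[OF hQ'])
  ultimately have Q': "Q' = mon (1,1,0) ?c + mon (0,0,2) q"
    by (subst quadratic_form[OF hQ']) simp
  define \<psi> where "\<psi> = ev (\<lambda>c. [:c:]) (Polynomial.monom k 2) 1 [:0,1:]"
  have rh: "rhom \<psi>" unfolding \<psi>_def by (rule rhom_ev[OF rhom_pconst])
  have p\<psi>: "poly (\<psi> g) s = peval g (k * s^2, 1, s)" for g s
    by (simp add: \<psi>_def poly_ev poly_monom)
  define v where "v i = mv (inv3 N) (p i)" for i
  have v: "mv N (v i) = smult3 1 (p i)" for i by (simp add: v_def mv_inv3[OF det])
  have Iv: "f' \<in> ideal_pow (point_ideal (v i)) m" if "i < r" for i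
    using f(1) that lin_subst_ideal_pow_iff[OF det v] unfolding f'_def J_iff by auto
  have "v 0 = (1,0,0)"
    using mv_inv3(1)[OF det, of "(1,0,0)"] by (simp add: v_def N_def mv_cols)
  hence deg: "degree (\<psi> f') \<le> 2 * d - m"
    unfolding \<psi>_def using Iv[of 0] r by (intro degree_conic_parametrization[OF hf']) (auto simp: ideal_pow_e1_iff[OF inf])
  \<comment> \<open>The parameter of p_i. Its y-coordinate is nonzero because it equals
    \<open>bil Q (p 0) (p i)\<close> divided by c.\<close>
  define s where "s i = snd (snd (v i)) / fst (snd (v i))" for i
  have vs: "fst (snd (v i)) \<noteq> 0 \<and> v i = smult3 (fst (snd (v i))) (k * s i ^ 2, 1, s i)" if i: "i \<in> {1..<r}" for i
  proof -
    obtain x y z where xyz: "v i = (x,y,z)" by (cases "v i")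
    have pi: "p i = vadd (smult3 x (p 0)) (vadd (smult3 y (p 1)) (smult3 z n))"
      using v[of i] by (simp add: xyz N_def mv_cols)
    have "bil Q (p 0) (p i) = y * ?c" unfolding pi
      using n Q0 by (simp add: bil_vadd[OF hQ] bil_smult_right[OF hQ] bil_self[OF hQ])
    hence y: "y \<noteq> 0" using bil[of 0 i] i by auto
    have "peval Q' (x,y,z) = 0" using on[of i] i v[of i] by (simp add: Q'_def peval_lin_subst xyz)
    hence "x * y = k * z^2" using c by (simp add: pQ' k_def field_simps eq_neg_iff_add_eq_0)
    thus ?thesis using y by (simp add: xyz s_def smult3_def field_simps power2_eq_square)
  qed
  have inj: "inj_on s {1..<r}"
  proof (rule inj_onI, rule ccontr)
    fix i j assume ij: "i \<in> {1..<r}" "j \<in> {1..<r}" "s i = s j" "i \<noteq> j"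
    let ?y = "\<lambda>i. fst (snd (v i))"
    have "v i = smult3 (?y i / ?y j) (v j)"
      using vs[OF ij(1)] vs[OF ij(2)] ij(3) by (metis (no_types) smult3_smult3 nonzero_eq_divide_eq)
    hence "p i = smult3 (?y i / ?y j) (p j)" using v[of i] v[of j] by (metis mv_smult3 smult3_1(1))
    thus False using not_proportional ij by auto
  qed
  have "[:- s i, 1:] ^ m dvd \<psi> f'" if i: "i \<in> {1..<r}" for i
  proof (rule ideal_pow_dvd[OF rh _ Iv])
    fix g assume g: "g \<in> point_ideal (v i)"
    obtain y where y: "y \<noteq> 0" "v i = smult3 y (k * s i ^ 2, 1, s i)" using vs[OF i] by blast
    have "smult3 (1 / y) (v i) = (k * s i ^ 2, 1, s i)" unfolding y(2) smult3_smult3 using y(1) by simp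
    moreover have "peval g (smult3 (1 / y) (v i)) = 0" using g by (simp add: point_ideal_def)
    ultimately have "poly (\<psi> g) (s i) = 0" by (simp add: p\<psi>)
    thus "[:- s i, 1:] dvd \<psi> g" by (simp add: poly_eq_0_iff_dvd)
  qed (use i in auto)
  note dvd = this
  have *: "(r - 1) * m \<le> 2 * d - m" if nz: "\<psi> f' \<noteq> 0"
  proof -
    have "card (s ` {1..<r}) * m \<le> degree (\<psi> f')"
      by (rule multiple_roots_degree[OF nz]) (use dvd in blast)+
    thus ?thesis using deg card_image[OF inj] by simp
  qed
  have "\<psi> f' = 0"
  proof (rule ccontr)
    assume "\<psi> f' \<noteq> 0"
    from *[OF this] have "(r - 1) * m \<le> 2 * d - m" .
    moreover have "r * m = (r - 1) * m + m" using r by (cases r) auto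
    \<comment> \<open>Rules out that the truncated difference \<open>2 * d - m\<close> is 0, so that
      m can be moved to the other side.\<close>
    moreover have "0 < (r - 1) * m" using d r by (cases m) auto
    ultimately show False using d by linarith
  qed
  then obtain h where "f' = Q' * h"
    using conic_kernel[OF c _ hf', of q] n(4) unfolding \<psi>_def Q' k_def q_def by auto
  hence "lin_subst (inv3 N) f' = lin_subst (inv3 N) Q' * lin_subst (inv3 N) h" by (simp add: lin_subst_simps)
  thus ?thesis unfolding f'_def Q'_def lin_subst_inv3[OF det] by blast
qed

end

section \<open>Lower bounds for leading monomials in x and y\<close>

lemma is_lead_x_power:
  fixes f :: "'a::comm_ring_1 pol3"
  assumes "homogeneous f d" "lookup f (d,0,0) \<noteq> 0"
  shows "is_lead f (d,0,0)"
  unfolding revlex.is_lead_def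
proof (intro conjI ballI impI)
  fix e assume e: "e \<in> keys f" "e \<noteq> (d,0,0)"
  have "tdeg e = d" using e assms(1) by (auto simp: homogeneous_def)
  thus "revlex_less e (d,0,0)" using e(2) by (cases e) (auto simp: revlex_less_def tdeg_def)
qed (use assms in \<open>simp add: in_keys_iff\<close>)

lemma is_lead_linf: "fst u \<noteq> 0 \<Longrightarrow> is_lead (linf u) (1,0,0)"
  by (rule is_lead_x_power[OF homogeneous_linf]) (simp add: linf_def lookup_add lookup_single)

lemma lin_subst_cols_linf: "lin_subst (cols u v w) (linf l) = linf (dot l u, dot l v, dot l w)"
  by (cases l; cases u; cases v; cases w) (simp add: lin_subst_linf cols_def comp3_def dot_def)

text \<open>General position with respect to the flag formed by (1,0,0) and the line z = 0. With
  (1,0,0) off the conic and off the secants, these have powers of x as leading monomials; with the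
  points off z = 0, the variable z has multiplicity 0 at each of them.\<close>

locale flagged_conic = conic +
  assumes e1_off_conic: "lookup Q (2,0,0) \<noteq> 0"
    and off_line: "\<And>i. i < r \<Longrightarrow> snd (snd (p i)) \<noteq> 0"
    and e1_off_secants: "\<And>i j. i < r \<Longrightarrow> j < r \<Longrightarrow> i \<noteq> j \<Longrightarrow> fst (cross (p i) (p j)) \<noteq> 0"
begin

text \<open>In degree at least r m / 2 the inequality follows from r >= 4. In smaller degree,
  removing Q lowers both sides by exactly 2 r.\<close>

lemma lead_bound_ge4:
  assumes r4: "4 \<le> r"
  shows "f \<in> J m \<Longrightarrow> homogeneous f (a + b) \<Longrightarrow> is_lead f (a,b,0) \<Longrightarrow> 2 * r * m \<le> r * a + 4 * b"
proof (induction m arbitrary: f a)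
  case (Suc m)
  show ?case
  proof (cases "r * Suc m \<le> 2 * (a + b)")
    case True
    have "4 * a \<le> r * a" using r4 by simp
    have "2 * r * Suc m = 2 * (r * Suc m)" by simp
    also have "\<dots> \<le> 2 * (2 * (a + b))" using True by (rule mult_le_mono2)
    also have "\<dots> \<le> r * a + 4 * b" using \<open>4 * a \<le> r * a\<close> by simp
    finally show ?thesis .
  next
    case False
    then obtain h where h: "f = Q * h" using conic_dvd[OF _ Suc.prems(1,2)] r4 by auto
    obtain e where e: "is_lead h e" "(a,b,0) = (2,0,0) + e"
      using revlex.is_lead_mult_cancel[OF Suc.prems(3)[unfolded h] is_lead_x_power[OF hQ e1_off_conic]] .
    then obtain a' where a': "e = (a',b,0)" "a = 2 + a'" by (cases e) auto
    \<comment> \<open>The induction hypothesis needs a homogeneous cofactor, so h is replaced by its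
      component.\<close>
    have "homogeneous (Q * h) (2 + (a' + b))" using Suc.prems(2) by (simp add: h a' add.assoc)
    from homogeneous_factor[OF hQ this]
    have f: "f = Q * hc (a' + b) h" by (simp add: h)
    obtain e' where e': "is_lead (hc (a' + b) h) e'" "(a,b,0) = (2,0,0) + e'"
      using revlex.is_lead_mult_cancel[OF Suc.prems(3)[unfolded f] is_lead_x_power[OF hQ e1_off_conic]] .
    have "e' = (a',b,0)" using e'(2) a' by (cases e') auto
    moreover have "hc (a' + b) h \<in> J m" using J_div_Q[of "hc (a' + b) h" "Suc m"] Suc.prems(1) f by simp
    ultimately have "2 * r * m \<le> r * a' + 4 * b" using Suc.IH e' homogeneous_hc by blast
    thus ?thesis by (simp add: a' algebra_simps)
  qed
qed simp

text \<open>On the line s p_0 + t p_1 the conic restricts to s t times a nonzero constant, so it has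
  no third point there.\<close>

lemma independent_points:
  assumes "3 \<le> r"
  shows "det3 (cols (p 0) (p 1) (p 2)) \<noteq> 0"
proof
  assume "det3 (cols (p 0) (p 1) (p 2)) = 0"
  then obtain s t where st: "p 2 = vadd (smult3 s (p 0)) (smult3 t (p 1))"
    using plane_span[of "p 0" "p 1" "p 2"] cross_nonzero[of 0 1] assms by (auto simp: det3_cols)
  have "s * t * bil Q (p 0) (p 1) = 0"
    using peval_combination[OF hQ, of s "p 0" t "p 1"] on[of 0] on[of 1] on[of 2] assms by (simp add: st)
  hence "s = 0 \<or> t = 0" using bil[of 0 1] assms by auto
  thus False using st not_proportional[of 2 1 t] not_proportional[of 2 0 s] assms by auto
qed

lemma lead_bound_3:
  assumes r3: "r = 3" and f: "f \<in> J m" "homogeneous f (a + b)" "is_lead f (a,b,0)"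
  shows "6 * m \<le> 4 * a + 3 * b"
proof (cases "2 * m \<le> a + b")
  case False
  define N where "N = cols (p 0) (p 1) (p 2)"
  define D where "D = det3 N"
  have D: "D \<noteq> 0" using independent_points r3 by (simp add: D_def N_def)
  \<comment> \<open>The multiplicity with which the triangle of secants must split off: in
    coordinates at the points any two exponents sum to at least m, and two such sums minus the
    degree bound each exponent below by k.\<close>
  define k where "k = 2 * m - (a + b)"
  define G where "G = linf (cross (p 1) (p 2)) * linf (cross (p 2) (p 0)) * linf (cross (p 0) (p 1))"
  have cyc: "dot (cross (p 1) (p 2)) (p 0) = D" "dot (cross (p 2) (p 0)) (p 1) = D" "dot (cross (p 0) (p 1)) (p 2) = D"
    unfolding D_def N_def det3_cols
    by (cases "p 0"; cases "p 1"; cases "p 2"; simp add: dot_def cross_def algebra_simps)+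
  have "lin_subst N G = mon (1,1,1) (D ^ 3)"
    using cyc by (simp add: G_def N_def lin_subst_simps lin_subst_cols_linf)
      (simp add: linf_def mult_single power3_eq_cube)
  hence NG: "lin_subst N (G ^ k) = mon (k,k,k) (D ^ (3 * k))"
    by (simp add: lin_subst_simps mon_power power_mult)
  define f' where "f' = lin_subst N f"
  have fi: "f \<in> ideal_pow (point_ideal (p 0)) m" "f \<in> ideal_pow (point_ideal (p 1)) m"
    "f \<in> ideal_pow (point_ideal (p 2)) m"
    using f(1) r3 unfolding J_iff by simp_all
  have "f' \<in> ideal_pow (point_ideal (1,0,0)) m" "f' \<in> ideal_pow (point_ideal (0,1,0)) m"
     "f' \<in> ideal_pow (point_ideal (0,0,1)) m"
    using fi lin_subst_ideal_pow[of N "(1,0,0)" 1 "p 0" f m] lin_subst_ideal_pow[of N "(0,1,0)" 1 "p 1" f m]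
      lin_subst_ideal_pow[of N "(0,0,1)" 1 "p 2" f m]
    by (simp_all add: f'_def N_def mv_cols)
  note w = ideal_pow_axis(1)[OF inf this(1)] ideal_pow_axis(2)[OF inf this(2)] ideal_pow_axis(3)[OF inf this(3)]
  have "k \<le> fst e \<and> k \<le> fst (snd e) \<and> k \<le> snd (snd e)" if "e \<in> keys f'" for e
  proof -
    have "fst e + fst (snd e) + snd (snd e) = a + b"
      using homogeneous_lin_subst[OF f(2), of N] that by (auto simp: homogeneous_def tdeg_def f'_def)
    thus ?thesis using w[OF that] by (auto simp: k_def)
  qed
  then obtain h where "f' = mon (k,k,k) 1 * h" using mon_factor by blast
  also have "mon (k,k,k) 1 = lin_subst N (G ^ k) * mon 0 (1 / D ^ (3 * k))"
    using D by (simp add: NG mult_single)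
  finally have "lin_subst (inv3 N) f' = G ^ k * lin_subst (inv3 N) (mon 0 (1 / D ^ (3 * k)) * h)"
    using D by (simp add: lin_subst_simps(4) lin_subst_inv3 D_def mult.assoc)
  hence fG: "f = G ^ k * lin_subst (inv3 N) (mon 0 (1 / D ^ (3 * k)) * h)"
    using D by (simp add: f'_def lin_subst_inv3 D_def)
  have "is_lead G ((1,0,0) + (1,0,0) + (1,0,0))"
    unfolding G_def using e1_off_secants r3 by (intro revlex.is_lead_mult is_lead_linf) auto
  from revlex.is_lead_power[OF this, of k]
  have "is_lead (G ^ k) (\<Sum>i<k. (3,0,0))" by (simp add: numeral_3_eq_3)
  then obtain e :: "nat \<times> nat \<times> nat" where e: "(a,b,0) = (\<Sum>i<k. (3,0,0)) + e"
    using revlex.is_lead_mult_cancel[OF f(3)[unfolded fG]] by blast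
  \<comment> \<open>The factor G^k contributes x^(3k). Then 4 a + 3 b = a + 3 (a + b) is at least 3
    k + 3 (a + b) = 6 m.\<close>
  have "a = 3 * k + fst e" using arg_cong[OF e, of fst] by (simp add: fst_sum)
  thus ?thesis using False by (simp add: k_def)
qed simp

lemma lead_bound_2:
  assumes r2: "r = 2" and f: "f \<in> J m" "homogeneous f (a + b)" "is_lead f (a,b,0)"
  shows "2 * m \<le> 2 * a + b"
proof (cases "2 * m \<le> a + b")
  case False
  obtain w where w: "det3 (cols (p 0) (p 1) w) \<noteq> 0"
    using ex_dot_nonzero[OF cross_nonzero[of 0 1]] r2 unfolding det3_cols by auto
  define N where "N = cols (p 0) (p 1) w"
  define D where "D = det3 N"
  have D: "D \<noteq> 0" using w by (simp add: D_def N_def)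
  \<comment> \<open>With points at (1,0,0) and (0,1,0), adding y + z >= m and x + z >= m for the
    exponents forces at least k factors z, i.e. k copies of the secant.\<close>
  define k where "k = 2 * m - (a + b)"
  define G where "G = linf (cross (p 0) (p 1))"
  have "lin_subst N G = mon (0,0,1) D"
    by (simp add: G_def N_def lin_subst_cols_linf D_def det3_cols) (simp add: linf_def)
  hence NG: "lin_subst N (G ^ k) = mon (0,0,k) (D ^ k)"
    by (simp add: lin_subst_simps mon_power)
  define f' where "f' = lin_subst N f"
  have fi: "f \<in> ideal_pow (point_ideal (p 0)) m" "f \<in> ideal_pow (point_ideal (p 1)) m"
    using f(1) r2 unfolding J_iff by simp_all
  have "f' \<in> ideal_pow (point_ideal (1,0,0)) m" "f' \<in> ideal_pow (point_ideal (0,1,0)) m"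
    using fi lin_subst_ideal_pow[of N "(1,0,0)" 1 "p 0" f m] lin_subst_ideal_pow[of N "(0,1,0)" 1 "p 1" f m]
    by (simp_all add: f'_def N_def mv_cols)
  note w = ideal_pow_axis(1)[OF inf this(1)] ideal_pow_axis(2)[OF inf this(2)]
  have "0 \<le> fst e \<and> 0 \<le> fst (snd e) \<and> k \<le> snd (snd e)" if "e \<in> keys f'" for e
  proof -
    have "fst e + fst (snd e) + snd (snd e) = a + b"
      using homogeneous_lin_subst[OF f(2), of N] that by (auto simp: homogeneous_def tdeg_def f'_def)
    thus ?thesis using w[OF that] by (auto simp: k_def)
  qed
  then obtain h where "f' = mon (0,0,k) 1 * h" using mon_factor by blast
  also have "mon (0,0,k) 1 = lin_subst N (G ^ k) * mon 0 (1 / D ^ k)"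
    using D by (simp add: NG mult_single)
  finally have "lin_subst (inv3 N) f' = G ^ k * lin_subst (inv3 N) (mon 0 (1 / D ^ k) * h)"
    using D by (simp add: lin_subst_simps(4) lin_subst_inv3 D_def mult.assoc)
  hence fG: "f = G ^ k * lin_subst (inv3 N) (mon 0 (1 / D ^ k) * h)"
    using D by (simp add: f'_def lin_subst_inv3 D_def)
  have "is_lead G (1,0,0)" unfolding G_def using e1_off_secants r2 by (intro is_lead_linf) auto
  from revlex.is_lead_power[OF this, of k]
  have "is_lead (G ^ k) (\<Sum>i<k. (1,0,0))" .
  then obtain e :: "nat \<times> nat \<times> nat" where e: "(a,b,0) = (\<Sum>i<k. (1,0,0)) + e"
    using revlex.is_lead_mult_cancel[OF f(3)[unfolded fG]] by blast
  have "a = k + fst e" using arg_cong[OF e, of fst] by (simp add: fst_sum)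
  thus ?thesis using False by (simp add: k_def)
qed simp

lemma lead_bound:
  assumes f: "f \<in> J m" and l: "is_lead f (a,b,0)"
  shows "2 * r * m \<le> max r 4 * a + min r 4 * b"
proof -
  have *: "is_lead (hc (a + b) f) (a,b,0)"
    using l by (auto simp: revlex.is_lead_def keys_hc tdeg_def)
  consider "4 \<le> r" | "r = 3" | "r = 2" using r by linarith
  thus ?thesis
  proof cases
    case 1
    thus ?thesis using lead_bound_ge4[OF 1 J_hc[OF f] homogeneous_hc *] by simp
  next
    case 2
    thus ?thesis using lead_bound_3[OF 2 J_hc[OF f] homogeneous_hc *] by simp
  next
    case 3
    thus ?thesis using lead_bound_2[OF 3 J_hc[OF f] homogeneous_hc *] by simp
  qed
qed

end

section \<open>Restriction to the line z = 0\<close>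

abbreviation zvar :: "'a::comm_ring_1 pol3" where "zvar \<equiv> mon (0,0,1) 1"

lemma split_xz:
  fixes F :: "'a::comm_ring_1 pol3"
  assumes "\<And>e. e \<in> keys F \<Longrightarrow> 1 \<le> fst e \<or> 1 \<le> snd (snd e)"
  shows "\<exists>A C. F = mon (1,0,0) 1 * A + zvar * C"
proof -
  let ?I = "{F :: 'a pol3. \<exists>A C. F = mon (1,0,0) 1 * A + zvar * C}"
  have I: "is_ideal ?I" unfolding is_ideal_def
  proof (intro conjI ballI allI)
    show "0 \<in> ?I" by (auto intro!: exI[of _ 0])
  next
    fix f g assume "f \<in> ?I" "g \<in> ?I"
    then obtain A C A' C' where "f = mon (1,0,0) 1 * A + zvar * C" "g = mon (1,0,0) 1 * A' + zvar * C'" by blast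
    hence "f + g = mon (1,0,0) 1 * (A + A') + zvar * (C + C')" by (simp only: distrib_left) (simp only: add_ac)
    thus "f + g \<in> ?I" by blast
  next
    fix f g assume "g \<in> ?I"
    then obtain A C where "g = mon (1,0,0) 1 * A + zvar * C" by blast
    hence "f * g = mon (1,0,0) 1 * (f * A) + zvar * (f * C)" by (simp only: distrib_left mult_ac)
    thus "f * g \<in> ?I" by blast
  qed
  have "mon e (lookup F e) \<in> ?I" if e: "e \<in> keys F" for e
  proof (cases "1 \<le> fst e")
    case True
    have "\<exists>h. mon e (lookup F e) = mon (1,0,0) 1 * h"
      by (rule mon_factor) (use True in \<open>auto split: if_splits\<close>)
    then obtain h where "mon e (lookup F e) = mon (1,0,0) 1 * h + zvar * 0" by auto
    thus ?thesis by blast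
  next
    case False
    have "\<exists>h. mon e (lookup F e) = zvar * h"
      by (rule mon_factor) (use False assms[OF e] in \<open>auto split: if_splits\<close>)
    then obtain h where "mon e (lookup F e) = mon (1,0,0) 1 * 0 + zvar * h" by auto
    thus ?thesis by blast
  qed
  hence "(\<Sum>e\<in>keys F. mon e (lookup F e)) \<in> ?I" by (rule ideal_sum[OF I])
  thus ?thesis unfolding poly_mapping_eq_sum[symmetric] by blast
qed

text \<open>After a coordinate change the claim is that a form vanishing at (0,1,0) has no pure
  power of y and hence lies in the ideal of x and z.\<close>

lemma vanishing_on_line:
  fixes F :: "'a::field pol3"
  assumes F: "homogeneous F N" and u: "fst u \<noteq> 0" and y: "y \<noteq> 0"
    and P: "dot u (x,y,0) = 0" "peval F (x,y,0) = 0"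
  shows "\<exists>A C. F = linf u * A + zvar * C"
proof -
  obtain a b c where uu: "u = (a,b,c)" by (cases u)
  have a: "a \<noteq> 0" using u uu by simp
  \<comment> \<open>Chosen so that \<open>linf u\<close> becomes x, z stays z, and (0,1,0) is sent
    to the given point.\<close>
  define M where "M = cols (1/a,0,0) (x,y,0) (-c/a,0,1)"
  have det: "det3 M \<noteq> 0" using a y by (simp add: M_def det3_cols dot_def cross_def)
  have xM: "lin_subst M (linf u) = mon (1,0,0) 1"
    using a P(1) unfolding M_def lin_subst_cols_linf by (simp add: uu dot_def linf_def)
  have zM: "lin_subst M zvar = zvar"
    using lin_subst_cols_linf[of "(1/a,0,0)" "(x,y,0)" "(-c/a,0,1)" "(0,0,1)"] by (simp add: M_def linf_def dot_def)
  define F' where "F' = lin_subst M F"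
  have hF': "homogeneous F' N" unfolding F'_def by (rule homogeneous_lin_subst[OF F])
  have "1 \<le> fst e \<or> 1 \<le> snd (snd e)" if e: "e \<in> keys F'" for e
  proof (rule ccontr)
    assume "\<not> (1 \<le> fst e \<or> 1 \<le> snd (snd e))"
    moreover have "tdeg e = N" using hF' e by (auto simp: homogeneous_def)
    ultimately have eN: "e = (0,N,0)" by (cases e) (auto simp: tdeg_def)
    have "0 = peval F' (0,1,0)" using P(2) by (simp add: F'_def peval_lin_subst M_def mv_cols)
    also have "\<dots> = (\<Sum>e'\<in>keys F'. if e' = e then lookup F' e else 0)"
      unfolding peval_def
    proof (rule sum.cong)
      fix e' assume e': "e' \<in> keys F'"
      have "tdeg e' = N" using hF' e' by (auto simp: homogeneous_def)
      thus "lookup F' e' * fst (0,1,0) ^ fst e' * fst (snd (0,1,0)) ^ fst (snd e') * snd (snd (0,1,0)) ^ snd (snd e') =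
            (if e' = e then lookup F' e else 0)"
        by (cases e') (auto simp: eN tdeg_def power_0_left)
    qed simp
    also have "\<dots> = lookup F' e" using e by simp
    finally show False using e by (simp add: in_keys_iff)
  qed
  then obtain A C where "F' = mon (1,0,0) 1 * A + zvar * C" using split_xz by blast
  hence "F' = lin_subst M (linf u) * A + lin_subst M zvar * C" by (simp only: xM zM)
  hence "lin_subst (inv3 M) F' = linf u * lin_subst (inv3 M) A + zvar * lin_subst (inv3 M) C"
    by (simp add: lin_subst_simps lin_subst_inv3[OF det])
  thus ?thesis by (auto simp: F'_def lin_subst_inv3[OF det])
qed

lemma homogeneous_zvar: "homogeneous zvar 1"
  by (simp add: homogeneous_def tdeg_def)

text \<open>Modulo z, H is coprime to the product of the linear forms, and degree d + n - 1 suffices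
  to generate everything. Subtracting a multiple of H makes F vanish at the root of one linear form;
  dividing by that form lowers both n and the degree by one. The forms may repeat.\<close>

lemma binary_reduction:
  fixes H :: "'a::field pol3"
  assumes H: "homogeneous H d" "1 \<le> d"
    and L: "\<And>i. i < n \<Longrightarrow> fst (u i) \<noteq> 0 \<and> y i \<noteq> 0 \<and> dot (u i) (x i,y i,0) = 0 \<and> peval H (x i,y i,0) \<noteq> 0"
  shows "homogeneous F N \<Longrightarrow> d + n \<le> N + 1 \<Longrightarrow> \<exists>A B C. F = H * A + (\<Prod>i<n. linf (u i)) * B + zvar * C"
  using L
proof (induction n arbitrary: F N)
  case 0
  show ?case by (intro exI[of _ 0] exI[of _ F]) simp
next
  case (Suc n)
  have n: "fst (u n) \<noteq> 0" "y n \<noteq> 0" "dot (u n) (x n,y n,0) = 0" "peval H (x n,y n,0) \<noteq> 0"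
    using Suc.prems(3)[of n] by auto
  \<comment> \<open>Makes \<open>H * A0\<close> agree with F at the root; y^(N-d) serves as a
    multiplier of the right degree that is nonzero there.\<close>
  define k where "k = peval F (x n,y n,0) / (y n ^ (N - d) * peval H (x n,y n,0))"
  define A0 :: "'a pol3" where "A0 = mon (0,N-d,0) k"
  have N: "d \<le> N" "1 \<le> N" using Suc.prems(2) H(2) by auto
  have "homogeneous (H * A0) (d + (N - d))"
    unfolding A0_def by (intro homogeneous_mult H) (simp add: homogeneous_def tdeg_def)
  hence h: "homogeneous (F - H * A0) N" using Suc.prems(1) N by (intro homogeneous_diff) auto
  moreover have "peval (F - H * A0) (x n,y n,0) = 0"
    using n by (simp add: peval_simps A0_def k_def)
  ultimately obtain A C where AC: "F - H * A0 = linf (u n) * A + zvar * C"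
    using vanishing_on_line[OF _ n(1-3)] by blast
  have "F - H * A0 = hc N (linf (u n) * A + zvar * C)"
    using hc_homogeneous[OF h, of N] by (simp add: AC)
  also have "\<dots> = linf (u n) * hc (N - 1) A + zvar * hc (N - 1) C"
    using hc_mult_homogeneous[OF homogeneous_linf[of "u n"], of "N - 1" A] hc_mult_homogeneous[OF homogeneous_zvar, of "N - 1" C] N
    by (simp add: hc_add)
  finally have 1: "F - H * A0 = linf (u n) * hc (N - 1) A + zvar * hc (N - 1) C" .
  obtain A' B' C' where 2: "hc (N - 1) A = H * A' + (\<Prod>i<n. linf (u i)) * B' + zvar * C'"
    using Suc.IH[OF homogeneous_hc, of "N - 1" A] Suc.prems(2,3) N by fastforce
  have "F = H * (A0 + linf (u n) * A') + (\<Prod>i<Suc n. linf (u i)) * B' + zvar * (linf (u n) * C' + hc (N - 1) C)"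
    using 1 unfolding 2 by (simp add: algebra_simps)
  thus ?case by blast
qed

lemma sum_triple: "(\<Sum>i<n. (a,b,c)) = (n * a, n * b, n * c)" for a b c :: nat
  by (induction n) (auto simp: zero_prod_def)

context flagged_conic
begin

definition nxt :: "nat \<Rightarrow> nat" where "nxt i = Suc i mod r"

lemma nxt: "i < r \<Longrightarrow> nxt i < r" "i < r \<Longrightarrow> nxt i \<noteq> i"
  using r by (auto simp: nxt_def mod_Suc)

lemma nxt_surj: "j < r \<Longrightarrow> \<exists>i<r. nxt i = j"
  using r by (intro exI[of _ "if j = 0 then r - 1 else j - 1"]) (auto simp: nxt_def)

text \<open>The polygon of secants. For r = 2 it is, up to sign, the square of the single line
  through both points.\<close>

definition G :: "'a pol3" where "G = (\<Prod>i<r. linf (cross (p i) (p (nxt i))))"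

lemma homogeneous_G: "homogeneous G r"
proof -
  have "homogeneous G (\<Sum>i<r. 1)"
    unfolding G_def by (rule homogeneous_prod) (simp_all only: homogeneous_linf finite_lessThan)
  thus ?thesis by simp
qed

lemma is_lead_G: "is_lead G (r,0,0)"
proof -
  have "is_lead G (\<Sum>i<r. (1,0,0))"
    unfolding G_def using nxt by (intro revlex.is_lead_prod is_lead_linf e1_off_secants) (auto, metis)
  thus ?thesis by (simp only: sum_triple) simp
qed

text \<open>Each point lies on two edges of the polygon: the one entering it and the one leaving
  it.\<close>

lemma G_in_J: "G \<in> J 2"
  unfolding J_iff
proof (intro allI impI)
  fix j assume j: "j < r"
  obtain i where i: "i < r" "nxt i = j" using nxt_surj[OF j] by blast
  have ij: "i \<noteq> j" using nxt i by blast
  let ?l = "\<lambda>i. linf (cross (p i) (p (nxt i)))"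
  have "G = ?l i * (?l j * (\<Prod>k\<in>{..<r} - {i} - {j}. ?l k))"
    unfolding G_def using i(1) j ij by (subst prod.remove[of _ i], simp, simp, subst prod.remove[of _ j]) auto
  also have "\<dots> = (?l i * ?l j) * (\<Prod>k\<in>{..<r} - {i} - {j}. ?l k)" by (simp only: mult.assoc)
  also have "\<dots> \<in> ideal_pow (point_ideal (p j)) (1 + 1)"
    by (intro ideal_mult'[OF is_ideal_ideal_pow] ideal_pow_mult ideal_pow_mem linf_mem_point_ideal) (simp_all add: i)
  finally show "G \<in> ideal_pow (point_ideal (p j)) 2" by (simp add: numeral_2_eq_2)
qed

text \<open>Modulo z write F as Q^2 A + G B and lift A and B by induction. The bound grows by
  \<open>max r 4\<close> per step, so both cofactor degrees N - 4 and N - r stay in range, and 3 is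
  what one step of \<open>binary_reduction\<close> needs: 4 + r <= N + 1.\<close>

lemma restriction_surjective:
  "max r 4 * n + 3 \<le> N \<Longrightarrow> homogeneous F N \<Longrightarrow> \<exists>f C. f \<in> J (2 * n) \<and> homogeneous f N \<and> F = f + zvar * C"
proof (induction n arbitrary: F N)
  case 0
  thus ?case by (intro exI[of _ F] exI[of _ 0]) (simp add: J_0)
next
  case (Suc n)
  have N: "r + 3 \<le> N" "7 \<le> N" "max r 4 * n + 3 \<le> N - r" "max r 4 * n + 3 \<le> N - 4"
    using Suc.prems(1) by (auto simp: max_def split: if_splits)
  have hQ2: "homogeneous (Q * Q) 4" using homogeneous_mult[OF hQ hQ] by simp
  \<comment> \<open>The point where the secant meets z = 0. There Q equals, up to sign, the polar
    form times the two z-coordinates, which is nonzero; so Q^2 is coprime to G modulo z.\<close>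
  define P where "P i = vadd (smult3 (snd (snd (p (nxt i)))) (p i)) (smult3 (- snd (snd (p i))) (p (nxt i)))" for i
  have P: "P i = (fst (P i), fst (snd (P i)), 0)" "fst (snd (P i)) = fst (cross (p i) (p (nxt i)))" for i
    by (cases "p i"; cases "p (nxt i)"; simp add: P_def vadd_def smult3_def cross_def algebra_simps)+
  have Pi: "fst (cross (p i) (p (nxt i))) \<noteq> 0 \<and> fst (snd (P i)) \<noteq> 0 \<and>
     dot (cross (p i) (p (nxt i))) (fst (P i), fst (snd (P i)), 0) = 0 \<and> peval (Q * Q) (fst (P i), fst (snd (P i)), 0) \<noteq> 0"
    if i: "i < r" for i
    unfolding P(1)[symmetric]
  proof (intro conjI)
    show "fst (cross (p i) (p (nxt i))) \<noteq> 0" using e1_off_secants nxt i by metis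
    thus "fst (snd (P i)) \<noteq> 0" by (simp add: P(2))
    show "dot (cross (p i) (p (nxt i))) (P i) = 0" by (simp add: P_def dot_vadd dot_smult3)
    have "peval Q (P i) \<noteq> 0"
      using on[OF i] on[OF nxt(1)[OF i]] off_line[OF i] off_line[OF nxt(1)[OF i]] bil[OF i nxt(1)[OF i]] nxt(2)[OF i]
      by (simp add: P_def peval_combination[OF hQ])
    thus "peval (Q * Q) (P i) \<noteq> 0" by (simp add: peval_simps)
  qed
  obtain A B C where "F = Q * Q * A + G * B + zvar * C"
    using binary_reduction[where n = r and u = "\<lambda>i. cross (p i) (p (nxt i))" and x = "\<lambda>i. fst (P i)" and
        y = "\<lambda>i. fst (snd (P i))", OF hQ2 _ Pi Suc.prems(2)] N(1) unfolding G_def by auto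
  hence "F = hc N (Q * Q * A + G * B + zvar * C)" using hc_homogeneous[OF Suc.prems(2), of N] by simp
  also have "\<dots> = Q * Q * hc (N - 4) A + G * hc (N - r) B + zvar * hc (N - 1) C"
    using hc_mult_homogeneous[OF hQ2, of "N - 4" A] hc_mult_homogeneous[OF homogeneous_G, of "N - r" B]
      hc_mult_homogeneous[OF homogeneous_zvar, of "N - 1" C] N
    by (simp add: hc_add)
  finally have F: "F = Q * Q * hc (N - 4) A + G * hc (N - r) B + zvar * hc (N - 1) C" .
  obtain fA CA where fA: "fA \<in> J (2 * n)" "homogeneous fA (N - 4)" "hc (N - 4) A = fA + zvar * CA"
    using Suc.IH[OF N(4) homogeneous_hc] by blast
  obtain fB CB where fB: "fB \<in> J (2 * n)" "homogeneous fB (N - r)" "hc (N - r) B = fB + zvar * CB"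
    using Suc.IH[OF N(3) homogeneous_hc] by blast
  let ?f = "Q * Q * fA + G * fB"
  have "?f \<in> J (2 * Suc n)"
    using J_mult[OF J_mult[OF Q_in_J Q_in_J] fA(1)] J_mult[OF G_in_J fB(1)] by (simp add: ideal_add[OF is_ideal_J])
  moreover have "homogeneous ?f N"
    using homogeneous_mult[OF hQ2 fA(2)] homogeneous_mult[OF homogeneous_G fB(2)] N by (simp add: homogeneous_add)
  moreover have "F = ?f + zvar * (Q * Q * CA + G * CB + hc (N - 1) C)"
    unfolding F fA(3) fB(3) by (simp add: algebra_simps)
  ultimately show ?case by blast
qed

end

section \<open>Leading exponents of ideals\<close>

definition leads :: "'a::comm_ring_1 pol3 set \<Rightarrow> (nat \<times> nat \<times> nat) set" where
  "leads I = {e. \<exists>f\<in>I. is_lead f e}"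

lemma initial_ideal_leads: "initial_ideal I = ideal_gen ((\<lambda>e. mon e 1) ` leads I)"
proof -
  have "leads I = lead_exp ` {f \<in> I. f \<noteq> 0}"
    unfolding leads_def is_lead_iff by blast
  hence "(\<lambda>e. mon e (1::'a)) ` leads I = {mon (lead_exp f) 1 | f. f \<in> I \<and> f \<noteq> 0}"
    by (simp only: image_image) blast
  thus ?thesis by (simp add: initial_ideal_def)
qed

lemma leads_add:
  fixes I :: "'a::idom pol3 set"
  assumes "is_ideal I" "e \<in> leads I"
  shows "e' + e \<in> leads I"
proof -
  obtain f where f: "f \<in> I" "is_lead f e" using assms by (auto simp: leads_def)
  have "is_lead (mon e' 1 * f) (e' + e)" by (intro revlex.is_lead_mult is_lead_mon f) simp
  thus ?thesis using ideal_mult[OF assms(1) f(1)] by (auto simp: leads_def)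
qed

text \<open>Leading exponents are closed under adding exponents, so polynomials supported on them
  form an ideal; no further monomials can arise in the initial ideal.\<close>

lemma mon_mem_initial_ideal:
  fixes I :: "'a::idom pol3 set"
  assumes "is_ideal I"
  shows "mon e 1 \<in> initial_ideal I \<longleftrightarrow> e \<in> leads I"
proof
  let ?J = "{f :: 'a pol3. keys f \<subseteq> leads I}"
  have "is_ideal ?J" unfolding is_ideal_def
  proof (intro conjI ballI allI)
    fix f g assume "f \<in> ?J" "g \<in> ?J"
    thus "f + g \<in> ?J" using keys_add[of f g] by blast
  next
    fix f g assume g: "g \<in> ?J"
    show "f * g \<in> ?J"
    proof (intro CollectI subsetI)
      fix x assume "x \<in> keys (f * g)"
      then obtain a b where "x = a + b" "b \<in> keys g" using keys_mult[of f g] by blast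
      thus "x \<in> leads I" using g leads_add[OF assms, of b a] by blast
    qed
  qed simp
  moreover have "(\<lambda>e. mon e 1) ` leads I \<subseteq> ?J" by auto
  ultimately have "initial_ideal I \<subseteq> ?J" unfolding initial_ideal_leads by (rule ideal_gen_least)
  thus "mon e 1 \<in> initial_ideal I \<Longrightarrow> e \<in> leads I" by auto
  show "e \<in> leads I \<Longrightarrow> mon e 1 \<in> initial_ideal I"
    unfolding initial_ideal_leads by (rule subsetD[OF ideal_gen_superset]) blast
qed

context flagged_conic
begin

text \<open>With n the half of m rounded up, both G^n and Q^(2n) have multiplicity at least m, and
  their leading monomials are x^(rn) and x^(4n).\<close>

lemma leads_x_axis: "(min r 4 * ((m + 1) div 2), 0, 0) \<in> leads (J m)"
proof -
  define n where "n = (m + 1) div 2"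
  have n: "m \<le> n * 2" by (simp add: n_def)
  have "is_lead (Q * Q) ((2,0,0) + (2,0,0))"
    by (intro revlex.is_lead_mult is_lead_x_power hQ e1_off_conic)
  hence "is_lead (Q * Q) (4,0,0)" by simp
  hence "is_lead ((Q * Q) ^ n) (\<Sum>i<n. (4,0,0))" by (rule revlex.is_lead_power)
  hence 1: "is_lead ((Q * Q) ^ n) (4 * n,0,0)" unfolding sum_triple by (simp add: mult.commute)
  have "is_lead (G ^ n) (\<Sum>i<n. (r,0,0))" by (rule revlex.is_lead_power[OF is_lead_G])
  hence 2: "is_lead (G ^ n) (r * n,0,0)" unfolding sum_triple by (simp add: mult.commute)
  have 3: "G ^ n \<in> J m" using J_antimono[OF n J_power[OF G_in_J]] .
  have "Q * Q \<in> J 2" using J_mult[OF Q_in_J Q_in_J] by (simp add: numeral_2_eq_2)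
  hence 4: "(Q * Q) ^ n \<in> J m" using J_antimono[OF n J_power] by blast
  show ?thesis unfolding leads_def n_def[symmetric] using 1 2 3 4 by (cases "r \<le> 4") (auto simp: min_def)
qed

text \<open>The monomial lifts to an element of the symbolic power that differs from it by multiples
  of z only, and within one degree these are smaller in reverse lexicographic order.\<close>

lemma leads_high_degree:
  assumes "max r 4 * ((m + 1) div 2) + 3 \<le> a + b"
  shows "(a, b, 0) \<in> leads (J m)"
proof -
  define n where "n = (m + 1) div 2"
  have n: "m \<le> 2 * n" by (simp add: n_def)
  define F :: "'a pol3" where "F = mon (a,b,0) 1"
  have "homogeneous F (a + b)" by (simp add: F_def homogeneous_def tdeg_def)
  then obtain f C where f: "f \<in> J (2 * n)" "homogeneous f (a + b)" "F = f + zvar * C"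
    using restriction_surjective[of n "a + b" F] assms unfolding n_def by blast
  have eq: "lookup f e = lookup F e" if "snd (snd e) = 0" for e
  proof -
    have "e \<notin> keys (zvar * C)" using keys_mult[of zvar C] that by fastforce
    thus ?thesis unfolding f(3) by (simp add: lookup_add in_keys_iff)
  qed
  have "is_lead f (a,b,0)" unfolding revlex.is_lead_def
  proof (intro conjI ballI impI)
    show "(a,b,0) \<in> keys f" using eq[of "(a,b,0)"] by (simp add: in_keys_iff F_def)
    fix e assume e: "e \<in> keys f" "e \<noteq> (a,b,0)"
    have d: "tdeg e = a + b" using f(2) e by (auto simp: homogeneous_def)
    have "snd (snd e) \<noteq> 0"
    proof
      assume "snd (snd e) = 0"
      hence "lookup F e \<noteq> 0" using eq[of e] e by (simp add: in_keys_iff)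
      thus False using e(2) by (simp add: F_def lookup_single when_def split: if_splits)
    qed
    thus "revlex_less e (a,b,0)" using d by (simp add: revlex_less_def tdeg_def)
  qed
  thus ?thesis using J_antimono[OF n f(1)] by (auto simp: leads_def)
qed

text \<open>The characteristic feature of reverse lexicographic order: if z^c divides the leading
  monomial of a form, it divides the form. As z vanishes at none of the points, it can then be
  cancelled inside J.\<close>

lemma leads_saturated: "(a,b,c) \<in> leads (J m) \<longleftrightarrow> (a,b,0) \<in> leads (J m)"
proof
  assume "(a,b,0) \<in> leads (J m)"
  from leads_add[OF is_ideal_J this, of "(0,0,c)"] show "(a,b,c) \<in> leads (J m)" by simp
next
  assume "(a,b,c) \<in> leads (J m)"
  then obtain f0 where f0: "f0 \<in> J m" "is_lead f0 (a,b,c)" by (auto simp: leads_def)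
  \<comment> \<open>Divisibility by z^c only follows for terms of the same degree as the leading
    one.\<close>
  define f where "f = hc (a + b + c) f0"
  have f: "f \<in> J m" unfolding f_def by (rule J_hc[OF f0(1)])
  have l: "is_lead f (a,b,c)" using f0(2) unfolding revlex.is_lead_def f_def keys_hc by (simp add: tdeg_def)
  have "0 \<le> fst e \<and> 0 \<le> fst (snd e) \<and> c \<le> snd (snd e)" if e: "e \<in> keys f" for e
  proof (cases "e = (a,b,c)")
    case False
    hence "revlex_less e (a,b,c)" using l e by (simp add: revlex.is_lead_def)
    moreover have "tdeg e = a + b + c" using e by (simp add: f_def keys_hc)
    ultimately show ?thesis by (auto simp: revlex_less_def tdeg_def)
  qed simp
  then obtain h where h: "f = mon (0,0,c) 1 * h" using mon_factor by blast
  have "mon (0,0,c) 1 \<notin> ideal_pow (point_ideal (p i)) (Suc 0)" if "i < r" for i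
  proof
    assume "mon (0,0,c) 1 \<in> ideal_pow (point_ideal (p i)) (Suc 0)"
    hence "peval (mon (0,0,c) 1) (p i) = 0" by (rule peval_zero_of_ideal_pow)
    thus False using off_line[OF that] by (cases "p i") simp
  qed
  hence "h \<in> J m" using f ideal_pow_saturated[OF inf p_nonzero, of _ "mon (0,0,c) 1" h m 0] unfolding h J_iff by auto
  moreover obtain e where "is_lead h e" "(a,b,c) = (0,0,c) + e"
    using revlex.is_lead_mult_cancel[OF l[unfolded h], of "(0,0,c)"] is_lead_mon[of "1::'a" "(0,0,c)"] by auto
  ultimately show "(a,b,0) \<in> leads (J m)" by (cases e) (auto simp: leads_def)
qed

lemma leads_bound: "(a,b,c) \<in> leads (J m) \<Longrightarrow> 2 * r * m \<le> max r 4 * a + min r 4 * b"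
  using lead_bound[of _ m a b] leads_saturated[of a b c m] unfolding leads_def by blast

end

section \<open>Polynomial functions of a matrix\<close>

text \<open>Polynomial functions rather than formal polynomials, so that closure properties are
  one-line rules. The passage to and from formal ones is \<open>PF_imp_eval9\<close> and
  \<open>eval9_PF\<close>.\<close>

inductive_set PF :: "((nat \<Rightarrow> nat \<Rightarrow> 'a::comm_ring_1) \<Rightarrow> 'a) set" where
  const: "(\<lambda>_. c) \<in> PF"
| entry: "i < 3 \<Longrightarrow> j < 3 \<Longrightarrow> (\<lambda>g. g i j) \<in> PF"
| add: "\<phi> \<in> PF \<Longrightarrow> \<psi> \<in> PF \<Longrightarrow> (\<lambda>g. \<phi> g + \<psi> g) \<in> PF"
| mult: "\<phi> \<in> PF \<Longrightarrow> \<psi> \<in> PF \<Longrightarrow> (\<lambda>g. \<phi> g * \<psi> g) \<in> PF"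

lemma PF_minus: "\<phi> \<in> PF \<Longrightarrow> (\<lambda>g. - \<phi> g) \<in> PF"
  using PF.mult[OF PF.const[of "-1"], of \<phi>] by simp

lemma PF_diff: "\<phi> \<in> PF \<Longrightarrow> \<psi> \<in> PF \<Longrightarrow> (\<lambda>g. \<phi> g - \<psi> g) \<in> PF"
  using PF.add[OF _ PF_minus, of \<phi> \<psi>] by simp

lemma PF_sum: "(\<And>i. i \<in> I \<Longrightarrow> \<phi> i \<in> PF) \<Longrightarrow> (\<lambda>g. \<Sum>i\<in>I. \<phi> i g) \<in> PF"
  by (induction I rule: infinite_finite_induct) (auto intro: PF.const PF.add)

lemma PF_prod: "(\<And>i. i \<in> I \<Longrightarrow> \<phi> i \<in> PF) \<Longrightarrow> (\<lambda>g. \<Prod>i\<in>I. \<phi> i g) \<in> PF"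
  by (induction I rule: infinite_finite_induct) (auto intro: PF.const PF.mult)

lemma PF_power: "\<phi> \<in> PF \<Longrightarrow> (\<lambda>g. \<phi> g ^ n) \<in> PF"
  by (induction n) (auto intro: PF.const PF.mult)

lemmas PF_intros = PF.const PF.entry PF.add PF.mult PF_diff PF_minus PF_power

definition mon9 :: "(nat \<Rightarrow> nat \<Rightarrow> 'a::comm_ring_1) \<Rightarrow> (nat \<Rightarrow>\<^sub>0 nat) \<Rightarrow> 'a" where
  "mon9 g e = (\<Prod>k\<in>keys e. g (k div 3) (k mod 3) ^ lookup e k)"

lemma eval9_gev: "eval9 F g = gev (\<lambda>x. x) (mon9 g) F"
  by (simp add: eval9_def gev_def mon9_def)

lemma mon9_superset:
  "finite S \<Longrightarrow> keys e \<subseteq> S \<Longrightarrow> mon9 g e = (\<Prod>k\<in>S. g (k div 3) (k mod 3) ^ lookup e k)"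
  unfolding mon9_def by (rule prod.mono_neutral_left) (auto simp: in_keys_iff)

lemma mon9_add: "mon9 g (a + b) = mon9 g a * mon9 g b"
proof -
  let ?S = "keys a \<union> keys b"
  have "keys (a + b) \<subseteq> ?S" by (rule keys_add)
  thus ?thesis
    using mon9_superset[of ?S "a + b" g] mon9_superset[of ?S a g] mon9_superset[of ?S b g]
    by (simp add: lookup_add power_add prod.distrib)
qed

lemma rhom_eval9: "rhom (\<lambda>F. eval9 F g)"
  unfolding eval9_gev by (rule rhom_gev[OF rhom_id]) (auto simp: mon9_add, simp add: mon9_def)

abbreviation vars9 :: "((nat \<Rightarrow>\<^sub>0 nat) \<Rightarrow>\<^sub>0 'a::zero) \<Rightarrow> bool" where
  "vars9 F \<equiv> \<forall>e\<in>keys F. keys e \<subseteq> {..<9}"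

lemma vars9_add: "vars9 F \<Longrightarrow> vars9 G \<Longrightarrow> vars9 (F + G)" for F G :: "(nat \<Rightarrow>\<^sub>0 nat) \<Rightarrow>\<^sub>0 'a::comm_ring_1"
  using keys_add[of F G] by (meson UnE subsetD)

lemma vars9_mult:
  fixes F G :: "(nat \<Rightarrow>\<^sub>0 nat) \<Rightarrow>\<^sub>0 'a::comm_ring_1"
  assumes "vars9 F" "vars9 G"
  shows "vars9 (F * G)"
proof
  fix e assume "e \<in> keys (F * G)"
  then obtain a b where "e = a + b" "a \<in> keys F" "b \<in> keys G" using keys_mult[of F G] by blast
  thus "keys e \<subseteq> {..<9}" using assms keys_add[of a b] by (meson Un_least order_trans)
qed

lemma PF_imp_eval9: "\<phi> \<in> PF \<Longrightarrow> \<exists>F. vars9 F \<and> (\<forall>g. eval9 F g = \<phi> g)"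
proof (induction rule: PF.induct)
  case (const c)
  show ?case by (rule exI[of _ "mon 0 c"]) (simp add: eval9_gev gev_monom[OF rhom_id] mon9_def)
next
  case (entry i j)
  have "(3 * i + j) div 3 = i" "(3 * i + j) mod 3 = j" "3 * i + j < 9" using entry by auto
  thus ?case
    by (intro exI[of _ "mon (mon (3 * i + j) 1) 1"]) (simp add: eval9_gev gev_monom[OF rhom_id] mon9_def)
next
  case (add \<phi> \<psi>)
  then obtain F G where "vars9 F" "\<forall>g. eval9 F g = \<phi> g" "vars9 G" "\<forall>g. eval9 G g = \<psi> g" by blast
  thus ?case using vars9_add[of F G] by (intro exI[of _ "F + G"]) (simp add: rhom_add[OF rhom_eval9])
next
  case (mult \<phi> \<psi>)
  then obtain F G where "vars9 F" "\<forall>g. eval9 F g = \<phi> g" "vars9 G" "\<forall>g. eval9 G g = \<psi> g" by blast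
  thus ?case using vars9_mult[of F G] by (intro exI[of _ "F * G"]) (simp add: rhom_mult[OF rhom_eval9])
qed

lemma eval9_PF:
  assumes "vars9 F"
  shows "eval9 F \<in> PF"
proof -
  have "(\<lambda>g. \<Sum>e\<in>keys F. lookup F e * (\<Prod>k\<in>keys e. g (k div 3) (k mod 3) ^ lookup e k)) \<in> PF"
  proof (intro PF_sum PF.mult PF.const PF_prod PF_power PF.entry)
    fix e k assume "e \<in> keys F" "k \<in> keys e"
    hence "k < 9" using assms by blast
    thus "k div 3 < 3" "k mod 3 < 3" by auto
  qed
  thus ?thesis by (simp add: eval9_def[abs_def])
qed

lemma PF_line:
  assumes "\<phi> \<in> PF"
  shows "\<exists>q. \<forall>s. \<phi> (\<lambda>i j. g0 i j + s * (g1 i j - g0 i j)) = poly q s"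
  using assms
proof induction
  case (const c)
  show ?case by (rule exI[of _ "[:c:]"]) simp
next
  case (entry i j)
  show ?case by (rule exI[of _ "[:g0 i j, g1 i j - g0 i j:]"]) simp
next
  case (add \<phi> \<psi>)
  thus ?case by (metis poly_add)
next
  case (mult \<phi> \<psi>)
  thus ?case by (metis poly_mult)
qed

text \<open>Two nonempty open sets meet: on the line joining the two witnesses both functions become
  nonzero univariate polynomials, and over an infinite field their product has a nonroot.\<close>

lemma PF_mult_nonzero:
  fixes \<phi> \<psi> :: "(nat \<Rightarrow> nat \<Rightarrow> 'a::field) \<Rightarrow> 'a"
  assumes inf: "infinite (UNIV :: 'a set)" and PF: "\<phi> \<in> PF" "\<psi> \<in> PF" and nz: "\<phi> g0 \<noteq> 0" "\<psi> g1 \<noteq> 0"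
  shows "\<exists>g. \<phi> g * \<psi> g \<noteq> 0"
proof -
  let ?l = "\<lambda>s i j. g0 i j + s * (g1 i j - g0 i j)"
  obtain q q' where q: "\<And>s. \<phi> (?l s) = poly q s" and q': "\<And>s. \<psi> (?l s) = poly q' s"
    using PF_line[OF PF(1), of g0 g1] PF_line[OF PF(2), of g0 g1] by blast
  have "q \<noteq> 0" "q' \<noteq> 0" using q[of 0] q'[of 1] nz by auto
  hence "q * q' \<noteq> 0" by simp
  then obtain s where "poly (q * q') s \<noteq> 0" using infinite_poly_eq_0[OF inf] by blast
  thus ?thesis using q q' by (intro exI[of _ "?l s"]) simp
qed

lemma digits_less: "(\<And>k. k < n \<Longrightarrow> a k < D) \<Longrightarrow> (\<Sum>k<n. a k * D ^ k) < D ^ n" for D :: nat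
proof (induction n)
  case (Suc n)
  have "(\<Sum>k<n. a k * D ^ k) < D ^ n" using Suc by simp
  moreover have "Suc (a n) * D ^ n \<le> D * D ^ n" using Suc.prems[of n] by (intro mult_le_mono1) simp
  ultimately show ?case by simp
qed simp

lemma digits_unique:
  fixes D :: nat
  assumes "\<And>k. k < n \<Longrightarrow> a k < D" "\<And>k. k < n \<Longrightarrow> b k < D"
    and "(\<Sum>k<n. a k * D ^ k) = (\<Sum>k<n. b k * D ^ k)" "k < n"
  shows "a k = b k"
  using assms
proof (induction n)
  case (Suc n)
  have l: "(\<Sum>k<n. a k * D ^ k) < D ^ n" "(\<Sum>k<n. b k * D ^ k) < D ^ n"
    using Suc.prems by (auto intro: digits_less)
  have D: "D ^ n \<noteq> 0" using l(1) by (metis not_less_zero)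
  have "a n = ((\<Sum>k<n. a k * D ^ k) + a n * D ^ n) div D ^ n"
    using l(1) by (simp only: div_mult_self1[OF D] div_less)
  also have "\<dots> = ((\<Sum>k<n. b k * D ^ k) + b n * D ^ n) div D ^ n" using Suc.prems(3) by simp
  also have "\<dots> = b n" using l(2) by (simp only: div_mult_self1[OF D] div_less)
  finally have "a n = b n" .
  thus ?case using Suc by (cases "k = n") auto
qed simp

text \<open>Kronecker substitution: the matrix entry with index k is replaced by t^(D^k).\<close>
lemma eval9_nonzero:
  fixes F :: "(nat \<Rightarrow>\<^sub>0 nat) \<Rightarrow>\<^sub>0 'a::field"
  assumes inf: "infinite (UNIV :: 'a set)" and F: "F \<noteq> 0" "vars9 F"
  shows "\<exists>g. eval9 F g \<noteq> 0"
proof -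
  \<comment> \<open>Larger than every exponent occurring in F, so distinct monomials become distinct
    numbers in base D.\<close>
  define D where "D = Suc (\<Sum>e\<in>keys F. \<Sum>k<9. lookup e k)"
  have D: "lookup e k < D" if "e \<in> keys F" "k < 9" for e k
  proof -
    have "lookup e k \<le> (\<Sum>k<9. lookup e k)" using that by (intro member_le_sum) auto
    also have "\<dots> \<le> (\<Sum>e\<in>keys F. \<Sum>k<9. lookup e k)"
      using that by (intro member_le_sum[of e "keys F" "\<lambda>e. \<Sum>k<9. lookup e k"]) auto
    finally show ?thesis by (simp add: D_def)
  qed
  define W where "W e = (\<Sum>k<9. lookup e k * D ^ k)" for e :: "nat \<Rightarrow>\<^sub>0 nat"
  have inj: "e = e'" if "e \<in> keys F" "e' \<in> keys F" "W e = W e'" for e e'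
  proof (rule poly_mapping_eqI)
    fix k
    show "lookup e k = lookup e' k"
    proof (cases "k < 9")
      case True
      thus ?thesis using digits_unique[of 9 "lookup e" D "lookup e'" k] D that by (auto simp: W_def)
    next
      case False
      hence "k \<notin> keys e" "k \<notin> keys e'" using F(2) that by auto
      thus ?thesis by (simp add: in_keys_iff)
    qed
  qed
  define q where "q = (\<Sum>e\<in>keys F. Polynomial.monom (lookup F e) (W e))"
  obtain e where e: "e \<in> keys F" using F(1) by (metis keys_eq_empty ex_in_conv)
  have "coeff q (W e) = (\<Sum>e'\<in>keys F. if e' = e then lookup F e else 0)"
    unfolding q_def coeff_sum coeff_monom using inj[OF _ e] by (intro sum.cong refl) auto
  hence "coeff q (W e) \<noteq> 0" using e by (simp add: in_keys_iff)
  hence "q \<noteq> 0" by auto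
  then obtain t where t: "poly q t \<noteq> 0" using infinite_poly_eq_0[OF inf] by blast
  define g where "g i j = t ^ (D ^ (3 * i + j))" for i j :: nat
  have "mon9 g e = t ^ W e" if "e \<in> keys F" for e
  proof -
    have "mon9 g e = (\<Prod>k<9. g (k div 3) (k mod 3) ^ lookup e k)"
      using F(2) that by (intro mon9_superset) auto
    also have "\<dots> = (\<Prod>k<9. t ^ (lookup e k * D ^ k))"
      by (simp add: g_def power_mult[symmetric] mult.commute)
    finally show ?thesis by (simp add: W_def power_sum)
  qed
  hence "eval9 F g = poly q t"
    unfolding eval9_gev gev_def q_def poly_sum poly_monom by (intro sum.cong) auto
  thus ?thesis using t by metis
qed

text \<open>The property holds on a nonempty basic Zariski open set; nonemptiness is expressed by a
  matrix where the function is nonzero.\<close>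

definition generic :: "((nat \<Rightarrow> nat \<Rightarrow> 'a::comm_ring_1) \<Rightarrow> bool) \<Rightarrow> bool" where
  "generic P \<longleftrightarrow> (\<exists>\<phi>\<in>PF. (\<exists>g. \<phi> g \<noteq> 0) \<and> (\<forall>g. \<phi> g \<noteq> 0 \<longrightarrow> P g))"

lemma generic_nonzero: "\<phi> \<in> PF \<Longrightarrow> \<phi> g \<noteq> 0 \<Longrightarrow> generic (\<lambda>g. \<phi> g \<noteq> 0)"
  unfolding generic_def by blast

lemma generic_mono: "generic P \<Longrightarrow> (\<And>g. P g \<Longrightarrow> Q g) \<Longrightarrow> generic Q"
  unfolding generic_def by blast

lemma generic_conj:
  fixes P Q :: "(nat \<Rightarrow> nat \<Rightarrow> 'a::field) \<Rightarrow> bool"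
  assumes inf: "infinite (UNIV :: 'a set)" and "generic P" "generic Q"
  shows "generic (\<lambda>g. P g \<and> Q g)"
proof -
  obtain \<phi> \<psi> g0 g1 where *: "\<phi> \<in> PF" "\<psi> \<in> PF" "\<phi> g0 \<noteq> 0" "\<psi> g1 \<noteq> 0"
    "\<And>g. \<phi> g \<noteq> 0 \<Longrightarrow> P g" "\<And>g. \<psi> g \<noteq> 0 \<Longrightarrow> Q g"
    using assms(2,3) unfolding generic_def by blast
  have "(\<lambda>g. \<phi> g * \<psi> g) \<in> PF" using * by (intro PF.mult)
  thus ?thesis unfolding generic_def
    using PF_mult_nonzero[OF inf *(1-4)] *(5,6) by (intro bexI[of _ "\<lambda>g. \<phi> g * \<psi> g"]) auto
qed

lemma generic_True: "generic (\<lambda>_ :: nat \<Rightarrow> nat \<Rightarrow> 'a::field. True)"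
  unfolding generic_def by (rule bexI[OF _ PF.const[of 1]]) simp

lemma generic_ball:
  fixes P :: "'i \<Rightarrow> (nat \<Rightarrow> nat \<Rightarrow> 'a::field) \<Rightarrow> bool"
  assumes inf: "infinite (UNIV :: 'a set)" and "finite A" "\<And>i. i \<in> A \<Longrightarrow> generic (P i)"
  shows "generic (\<lambda>g. \<forall>i\<in>A. P i g)"
  using assms(2,3)
proof (induction A)
  case (insert i A)
  thus ?case using generic_conj[OF inf, of "P i" "\<lambda>g. \<forall>i\<in>A. P i g"] by simp
qed (simp add: generic_True)

lemma generic_ex: "generic P \<Longrightarrow> \<exists>g. P g"
  unfolding generic_def by blast

subsection \<open>Generic leading exponents\<close>

text \<open>Pivot positions: for fixed g each f gives a vector indexed by E, and e is collected if
  some vector has its largest nonzero position at e.\<close>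

definition eleads where
  "eleads S E \<Phi> g = {e\<in>E. \<exists>f\<in>S. \<Phi> f e g \<noteq> 0 \<and> (\<forall>e'\<in>E. revlex_less e e' \<longrightarrow> \<Phi> f e' g = 0)}"

text \<open>Gaussian elimination with polynomial entries; the exceptional matrices are the zeros of a pivot.\<close>
lemma generic_eleads:
  fixes \<Phi> :: "'s \<Rightarrow> nat \<times> nat \<times> nat \<Rightarrow> (nat \<Rightarrow> nat \<Rightarrow> 'a::field) \<Rightarrow> 'a"
  assumes inf: "infinite (UNIV :: 'a set)" and E: "finite E"
    and PF: "\<And>f e. f \<in> S \<Longrightarrow> e \<in> E \<Longrightarrow> \<Phi> f e \<in> PF"
    and lin: "\<And>f f' c c'. f \<in> S \<Longrightarrow> f' \<in> S \<Longrightarrow> \<exists>h\<in>S. \<forall>e\<in>E. \<forall>g. \<Phi> h e g = c * \<Phi> f e g + c' * \<Phi> f' e g"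
  shows "\<exists>T. generic (\<lambda>g. eleads S E \<Phi> g = T)"
  using E PF lin
proof (induction "card E" arbitrary: E \<Phi>)
  case 0
  hence "E = {}" by simp
  hence "eleads S E \<Phi> g = {}" for g by (simp add: eleads_def)
  thus ?case by (intro exI[of _ "{}"] generic_mono[OF generic_True])
next
  case (Suc n)
  hence "E \<noteq> {}" by auto
  then obtain m where m: "m \<in> E" "\<And>e. e \<in> E \<Longrightarrow> e \<noteq> m \<Longrightarrow> revlex_less e m"
    using revlex.ex_max[OF Suc.prems(1)] by blast
  define E' where "E' = E - {m}"
  have E': "n = card E'" "finite E'" "E' \<subseteq> E" "E = insert m E'" "m \<notin> E'"
    using Suc.hyps(2) Suc.prems(1) m by (auto simp: E'_def)
  have nm: "\<not> revlex_less m e" if "e \<in> E" for e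
    using m(2)[OF that] revlex.irrefl revlex.trans by metis
  show ?case
  proof (cases "\<forall>f\<in>S. \<forall>g. \<Phi> f m g = 0")
    case True
    have "eleads S E \<Phi> g = eleads S E' \<Phi> g" for g
      unfolding eleads_def using True E'(4) by auto
    moreover have "\<exists>T. generic (\<lambda>g. eleads S E' \<Phi> g = T)"
    proof (rule Suc.hyps(1)[OF E'(1,2)])
      show "\<Phi> f e \<in> PF" if "f \<in> S" "e \<in> E'" for f e using that Suc.prems(2) E'(3) by blast
      show "\<exists>h\<in>S. \<forall>e\<in>E'. \<forall>g. \<Phi> h e g = c * \<Phi> f e g + c' * \<Phi> f' e g" if "f \<in> S" "f' \<in> S" for f f' c c'
        using Suc.prems(3)[OF that, of c c'] E'(3) by blast
    qed
    ultimately show ?thesis by simp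
  next
    case False
    then obtain f0 g0 where f0: "f0 \<in> S" "\<Phi> f0 m g0 \<noteq> 0" by blast
    \<comment> \<open>Cross-multiplication clears the entry at m without dividing by the pivot,
      which keeps all entries polynomial in g.\<close>
    define \<Psi> where "\<Psi> f e g = \<Phi> f0 m g * \<Phi> f e g - \<Phi> f m g * \<Phi> f0 e g" for f e g
    have "\<exists>T. generic (\<lambda>g. eleads S E' \<Psi> g = T)"
    proof (rule Suc.hyps(1)[OF E'(1,2)])
      show "\<Psi> f e \<in> PF" if "f \<in> S" "e \<in> E'" for f e
        unfolding \<Psi>_def using that E'(3) f0(1) m(1) by (intro PF_diff PF.mult Suc.prems(2)) auto
      show "\<exists>h\<in>S. \<forall>e\<in>E'. \<forall>g. \<Psi> h e g = c * \<Psi> f e g + c' * \<Psi> f' e g" if ff: "f \<in> S" "f' \<in> S" for f f' c c'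
      proof -
        obtain h where h: "h \<in> S" "\<And>e g. e \<in> E \<Longrightarrow> \<Phi> h e g = c * \<Phi> f e g + c' * \<Phi> f' e g"
          using Suc.prems(3)[OF ff, of c c'] by blast
        have "\<Psi> h e g = c * \<Psi> f e g + c' * \<Psi> f' e g" if "e \<in> E'" for e g
        proof -
          have "e \<in> E" using that E'(3) by blast
          thus ?thesis by (simp add: \<Psi>_def h(2)[OF m(1)] h(2)[OF \<open>e \<in> E\<close>] algebra_simps)
        qed
        thus ?thesis using h(1) by blast
      qed
    qed
    then obtain T where T: "generic (\<lambda>g. eleads S E' \<Psi> g = T)" by blast
    have eq: "eleads S E \<Phi> g = insert m (eleads S E' \<Psi> g)" if g: "\<Phi> f0 m g \<noteq> 0" for g
    proof (intro equalityI subsetI)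
      fix e assume "e \<in> eleads S E \<Phi> g"
      then obtain f where e: "e \<in> E" "f \<in> S" "\<Phi> f e g \<noteq> 0" "\<And>e'. e' \<in> E \<Longrightarrow> revlex_less e e' \<Longrightarrow> \<Phi> f e' g = 0"
        by (auto simp: eleads_def)
      show "e \<in> insert m (eleads S E' \<Psi> g)"
      proof (cases "e = m")
        case False
        have "\<Phi> f m g = 0" using e(4)[OF m(1)] m(2)[OF e(1) False] by simp
        hence 1: "\<Psi> f e' g = \<Phi> f0 m g * \<Phi> f e' g" for e' by (simp add: \<Psi>_def)
        have "\<Psi> f e g \<noteq> 0" using e(3) g by (simp add: 1)
        moreover have "\<Psi> f e' g = 0" if "e' \<in> E'" "revlex_less e e'" for e'
          using e(4)[of e'] that E'(3) by (simp add: 1 subsetD)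
        moreover have "e \<in> E'" using e(1) False E'(4) by blast
        ultimately have "e \<in> eleads S E' \<Psi> g"
          unfolding eleads_def using e(2) by blast
        thus ?thesis by simp
      qed simp
    next
      fix e assume "e \<in> insert m (eleads S E' \<Psi> g)"
      thus "e \<in> eleads S E \<Phi> g"
      proof
        assume "e = m"
        thus ?thesis unfolding eleads_def using m(1) f0(1) g nm by blast
      next
        assume "e \<in> eleads S E' \<Psi> g"
        then obtain f where e: "e \<in> E'" "f \<in> S" "\<Psi> f e g \<noteq> 0" "\<And>e'. e' \<in> E' \<Longrightarrow> revlex_less e e' \<Longrightarrow> \<Psi> f e' g = 0"
          by (auto simp: eleads_def)
        \<comment> \<open>At this one g the multipliers are field elements, so the eliminated vector
          is itself a vector of the family.\<close>
        obtain h where h: "h \<in> S" "\<And>e g'. e \<in> E \<Longrightarrow> \<Phi> h e g' = \<Phi> f0 m g * \<Phi> f e g' + (- \<Phi> f m g) * \<Phi> f0 e g'"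
          using Suc.prems(3)[OF e(2) f0(1), of "\<Phi> f0 m g" "- \<Phi> f m g"] by blast
        have 1: "\<Phi> h e' g = \<Psi> f e' g" if "e' \<in> E" for e' using h(2)[OF that] by (simp add: \<Psi>_def)
        have 2: "\<Phi> h m g = 0" using h(2)[OF m(1)] by (simp add: mult.commute)
        have "\<Phi> h e g \<noteq> 0" using 1[of e] e(1,3) E'(3) by (simp add: subsetD)
        moreover have "\<Phi> h e' g = 0" if "e' \<in> E" "revlex_less e e'" for e'
          using 1[OF that(1)] 2 e(4)[of e'] that E'(4) by (cases "e' = m") auto
        moreover have "e \<in> E" using e(1) E'(3) by blast
        ultimately show ?thesis
          unfolding eleads_def using h(1) by blast
      qed
    qed
    have "generic (\<lambda>g. \<Phi> f0 m g \<noteq> 0)" using Suc.prems(2)[OF f0(1) m(1)] f0(2) by (rule generic_nonzero)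
    from generic_conj[OF inf this T] have "generic (\<lambda>g. eleads S E \<Phi> g = insert m T)"
      by (rule generic_mono) (auto simp: eq)
    thus ?thesis by blast
  qed
qed

section \<open>Coefficients depending polynomially on the matrix\<close>

definition PC :: "((nat \<Rightarrow> nat \<Rightarrow> 'a::comm_ring_1) \<Rightarrow> 'a pol3) \<Rightarrow> bool" where
  "PC \<Psi> \<longleftrightarrow> (\<forall>e. (\<lambda>g. lookup (\<Psi> g) e) \<in> PF)"

text \<open>The supports of the factors vary with the matrix. A summation range depending on k alone
  shows that each coefficient of a product is polynomial in the coefficients of the factors.\<close>

lemma lookup_mult_box:
  fixes f h :: "'a::comm_ring_1 pol3"
  defines "B \<equiv> \<lambda>k :: nat \<times> nat \<times> nat. {..fst k} \<times> {..fst (snd k)} \<times> {..snd (snd k)}"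
  shows "lookup (f * h) k = (\<Sum>a\<in>B k. \<Sum>b\<in>B k. if a + b = k then lookup f a * lookup h b else 0)"
proof -
  have fin: "finite (B k)" by (simp add: B_def)
  have out: "a + b \<noteq> k" if "a \<notin> B k \<or> b \<notin> B k" for a b
    using that by (cases a; cases b; cases k) (auto simp: B_def)
  have "(\<Sum>b\<in>keys h. if a + b = k then lookup f a * lookup h b else 0) =
        (\<Sum>b\<in>B k. if a + b = k then lookup f a * lookup h b else 0)" for a
  proof -
    have "(\<Sum>b\<in>keys h. if a + b = k then lookup f a * lookup h b else 0) =
       (\<Sum>b\<in>keys h \<union> B k. if a + b = k then lookup f a * lookup h b else 0)"
      using fin by (intro sum.mono_neutral_left) (auto simp: in_keys_iff)
    also have "\<dots> = (\<Sum>b\<in>B k. if a + b = k then lookup f a * lookup h b else 0)"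
      using fin out[of a] by (intro sum.mono_neutral_right) auto
    finally show ?thesis .
  qed
  hence "lookup (f * h) k = (\<Sum>a\<in>keys f. \<Sum>b\<in>B k. if a + b = k then lookup f a * lookup h b else 0)"
    by (simp add: lookup_mult_keys)
  also have "\<dots> = (\<Sum>a\<in>keys f \<union> B k. \<Sum>b\<in>B k. if a + b = k then lookup f a * lookup h b else 0)"
    using fin by (intro sum.mono_neutral_left) (auto simp: in_keys_iff intro!: sum.neutral)
  also have "\<dots> = (\<Sum>a\<in>B k. \<Sum>b\<in>B k. if a + b = k then lookup f a * lookup h b else 0)"
  proof (intro sum.mono_neutral_right ballI)
    fix a assume "a \<in> (keys f \<union> B k) - B k"
    thus "(\<Sum>b\<in>B k. if a + b = k then lookup f a * lookup h b else 0) = 0"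
      using out[of a] by (intro sum.neutral) auto
  qed (use fin in auto)
  finally show ?thesis .
qed

lemma PC_mult: "PC \<Psi> \<Longrightarrow> PC \<Psi>' \<Longrightarrow> PC (\<lambda>g. \<Psi> g * \<Psi>' g)"
  unfolding PC_def lookup_mult_box
proof (intro allI PF_sum)
  fix e a b :: "nat \<times> nat \<times> nat"
  assume "\<forall>e. (\<lambda>g. lookup (\<Psi> g) e) \<in> PF" "\<forall>e. (\<lambda>g. lookup (\<Psi>' g) e) \<in> PF"
  thus "(\<lambda>g. if a + b = e then lookup (\<Psi> g) a * lookup (\<Psi>' g) b else 0) \<in> PF"
    by (cases "a + b = e") (auto intro: PF_intros simp del: split_paired_All)
qed

lemma PC_add: "PC \<Psi> \<Longrightarrow> PC \<Psi>' \<Longrightarrow> PC (\<lambda>g. \<Psi> g + \<Psi>' g)"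
  unfolding PC_def lookup_add by (auto intro: PF.add)

lemma PC_mon: "\<phi> \<in> PF \<Longrightarrow> PC (\<lambda>g. mon e (\<phi> g))"
  unfolding PC_def lookup_single
proof
  fix e' assume "\<phi> \<in> PF"
  thus "(\<lambda>g. \<phi> g when e = e') \<in> PF" by (cases "e = e'") (auto intro: PF.const)
qed

lemma PC_power: "PC \<Psi> \<Longrightarrow> PC (\<lambda>g. \<Psi> g ^ n)"
proof (induction n)
  case 0
  show ?case using PC_mon[OF PF.const[of 1], of 0] by simp
qed (auto intro: PC_mult)

lemma PC_sum: "(\<And>i. i \<in> I \<Longrightarrow> PC (\<Psi> i)) \<Longrightarrow> PC (\<lambda>g. \<Sum>i\<in>I. \<Psi> i g)"
proof (induction I rule: infinite_finite_induct)
  case empty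
  show ?case using PC_mon[OF PF.const[of 0], of 0] by simp
next
  case (infinite I)
  show ?case using PC_mon[OF PF.const[of 0], of 0] infinite by simp
qed (auto intro: PC_add)

lemma PC_lin_subst: "PC (\<lambda>g. lin_subst g f)"
proof -
  have L: "PC (\<lambda>g. lin_form g i)" if "i < 3" for i
    unfolding lin_form_def using that by (intro PC_add PC_mon PF.entry) auto
  show ?thesis unfolding lin_subst_def
    by (intro PC_sum PC_mult PC_power PC_mon PF.const L) auto
qed

lemma lookup_lin_subst_PF: "(\<lambda>g. lookup (lin_subst g f) e) \<in> PF"
  using PC_lin_subst unfolding PC_def by blast

lemma lin_subst_tdeg_less:
  assumes "\<forall>e\<in>keys f. tdeg e < D"
  shows "\<forall>e\<in>keys (lin_subst g f). tdeg e < D"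
proof (rule ccontr)
  assume "\<not> (\<forall>e\<in>keys (lin_subst g f). tdeg e < D)"
  then obtain e where e: "e \<in> keys (lin_subst g f)" "\<not> tdeg e < D" by blast
  have "keys (hc (tdeg e) f) = {}" using assms e(2) by (auto simp: keys_hc)
  hence "hc (tdeg e) (lin_subst g f) = 0" unfolding hc_lin_subst by (simp add: keys_eq_empty lin_subst_simps)
  moreover have "e \<in> keys (hc (tdeg e) (lin_subst g f))" using e(1) by (simp add: keys_hc)
  ultimately show False by simp
qed

text \<open>Below degree D only finitely many exponents exist, so this is elimination on the
  elements of J of degree below D.\<close>

lemma generic_leads:
  fixes J :: "'a::field pol3 set"
  assumes inf: "infinite (UNIV :: 'a set)" and J: "is_ideal J"
  shows "\<exists>T. generic (\<lambda>g. det3 g \<noteq> 0 \<longrightarrow> {e \<in> leads (lin_subst g ` J). tdeg e < D} = T)"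
proof -
  define E where "E = {e. tdeg e < D}"
  define S where "S = {f \<in> J. keys f \<subseteq> E}"
  define \<Phi> where "\<Phi> f e g = lookup (lin_subst g f) e" for f :: "'a pol3" and e g
  have "E \<subseteq> {..D} \<times> {..D} \<times> {..D}" by (auto simp: E_def tdeg_def)
  hence E: "finite E" by (rule finite_subset) simp
  have "\<exists>T. generic (\<lambda>g. eleads S E \<Phi> g = T)"
  proof (rule generic_eleads[OF inf E])
    show "\<Phi> f e \<in> PF" for f e unfolding \<Phi>_def by (rule lookup_lin_subst_PF)
    fix f f' c c' assume f: "f \<in> S" "f' \<in> S"
    let ?h = "mon 0 c * f + mon 0 c' * f'"
    have sc: "lookup (mon 0 k * F) e = k * lookup F e" for k and F :: "'a pol3" and e
      by (simp add: lookup_mult_keys keys_single lookup_single when_def in_keys_iff)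
    have "?h \<in> S"
    proof -
      have "e \<in> E" if e: "e \<in> keys ?h" for e
      proof (rule ccontr)
        assume "e \<notin> E"
        hence "e \<notin> keys f" "e \<notin> keys f'" using f by (auto simp: S_def)
        thus False using e by (simp add: in_keys_iff lookup_add sc)
      qed
      moreover have "?h \<in> J" using f by (auto simp: S_def intro: ideal_add[OF J] ideal_mult[OF J])
      ultimately show ?thesis by (auto simp: S_def)
    qed
    moreover have "\<Phi> ?h e g = c * \<Phi> f e g + c' * \<Phi> f' e g" for e g
      by (simp add: \<Phi>_def lin_subst_simps lookup_add sc)
    ultimately show "\<exists>h\<in>S. \<forall>e\<in>E. \<forall>g. \<Phi> h e g = c * \<Phi> f e g + c' * \<Phi> f' e g" by blast
  qed
  then obtain T where T: "generic (\<lambda>g. eleads S E \<Phi> g = T)" by blast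
  have "{e \<in> leads (lin_subst g ` J). tdeg e < D} = eleads S E \<Phi> g" if det: "det3 g \<noteq> 0" for g
  proof (intro equalityI subsetI)
    fix e assume "e \<in> {e \<in> leads (lin_subst g ` J). tdeg e < D}"
    then obtain f where f: "f \<in> J" "is_lead (lin_subst g f) e" "tdeg e < D" by (auto simp: leads_def)
    \<comment> \<open>The order compares degrees first, so the leading term bounds them all; undoing
      the substitution preserves this bound.\<close>
    have "\<forall>e'\<in>keys (lin_subst g f). tdeg e' < D"
      using f(2,3) unfolding revlex.is_lead_def revlex_less_def by (metis less_trans)
    from lin_subst_tdeg_less[OF this, of "inv3 g"]
    have "f \<in> S" using f(1) by (auto simp: lin_subst_inv3[OF det] S_def E_def)
    moreover have "\<Phi> f e g \<noteq> 0" using f(2) by (simp add: \<Phi>_def revlex.is_lead_def in_keys_iff)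
    moreover have "\<Phi> f e' g = 0" if "revlex_less e e'" for e'
      using f(2) that revlex.irrefl revlex.trans unfolding \<Phi>_def revlex.is_lead_def by (metis in_keys_iff)
    ultimately show "e \<in> eleads S E \<Phi> g" using f(3) by (auto simp: eleads_def E_def)
  next
    fix e assume "e \<in> eleads S E \<Phi> g"
    then obtain f where f: "e \<in> E" "f \<in> S" "\<Phi> f e g \<noteq> 0" "\<forall>e'\<in>E. revlex_less e e' \<longrightarrow> \<Phi> f e' g = 0"
      by (auto simp: eleads_def)
    have "\<forall>e\<in>keys (lin_subst g f). tdeg e < D"
      using f(2) by (intro lin_subst_tdeg_less) (auto simp: S_def E_def)
    hence "is_lead (lin_subst g f) e"
      using f(3,4) revlex.total unfolding \<Phi>_def revlex.is_lead_def E_def by (metis in_keys_iff mem_Collect_eq)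
    thus "e \<in> {e \<in> leads (lin_subst g ` J). tdeg e < D}"
      using f(1,2) by (auto simp: leads_def S_def E_def)
  qed
  thus ?thesis by (intro exI[of _ T] generic_mono[OF T]) simp
qed

text \<open>Matches the formal polynomial F with a function on matrices. That a nonzero F has a
  nonzero value rests on the infinite field.\<close>

lemma is_gin_iff_generic:
  fixes J :: "'a::field pol3 set"
  assumes inf: "infinite (UNIV :: 'a set)"
  shows "is_gin J M \<longleftrightarrow> generic (\<lambda>g. det3 g \<noteq> 0 \<and> initial_ideal (lin_subst g ` J) = M)"
proof
  assume "is_gin J M"
  then obtain F where F: "F \<noteq> 0" "vars9 F"
    "\<forall>g. eval9 F g \<noteq> 0 \<longrightarrow> det3 g \<noteq> 0 \<and> initial_ideal (lin_subst g ` J) = M"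
    unfolding is_gin_def by blast
  thus "generic (\<lambda>g. det3 g \<noteq> 0 \<and> initial_ideal (lin_subst g ` J) = M)"
    unfolding generic_def using eval9_PF[OF F(2)] eval9_nonzero[OF inf F(1,2)] by blast
next
  assume "generic (\<lambda>g. det3 g \<noteq> 0 \<and> initial_ideal (lin_subst g ` J) = M)"
  then obtain \<phi> g0 where \<phi>: "\<phi> \<in> PF" "\<phi> g0 \<noteq> 0" "\<And>g. \<phi> g \<noteq> 0 \<Longrightarrow> det3 g \<noteq> 0 \<and> initial_ideal (lin_subst g ` J) = M"
    unfolding generic_def by blast
  obtain F where F: "vars9 F" "\<And>g. eval9 F g = \<phi> g" using PF_imp_eval9[OF \<phi>(1)] by blast
  have "F \<noteq> 0" using F(2)[of g0] \<phi>(2) by (auto simp: eval9_def)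
  thus "is_gin J M" unfolding is_gin_def using F \<phi>(3) by (intro exI[of _ F]) auto
qed

lemma gin_eq:
  fixes J :: "'a::field pol3 set"
  assumes inf: "infinite (UNIV :: 'a set)"
    and M: "generic (\<lambda>g. det3 g \<noteq> 0 \<and> initial_ideal (lin_subst g ` J) = M)"
  shows "gin J = M"
  unfolding gin_def
proof (rule the_equality)
  show "is_gin J M" using M is_gin_iff_generic[OF inf] by blast
  fix M' assume "is_gin J M'"
  hence "generic (\<lambda>g. det3 g \<noteq> 0 \<and> initial_ideal (lin_subst g ` J) = M')" using is_gin_iff_generic[OF inf] by blast
  from generic_ex[OF generic_conj[OF inf M this]] show "M' = M" by auto
qed

section \<open>Generic flags\<close>

lemma mv_vadd: "mv g (vadd u v) = vadd (mv g u) (mv g v)"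
  by (cases u; cases v) (simp add: mv_def vadd_def algebra_simps)

lemma bil_lin_subst: "bil (lin_subst g Q) u v = bil Q (mv g u) (mv g v)"
  by (simp add: bil_def peval_lin_subst mv_vadd)

text \<open>Cross products transform by the transposed matrix, up to the determinant, so the
  x-coefficient of a moved secant is the old secant evaluated at the first column of g.\<close>

lemma fst_cross_adj:
  "fst (cross (mv (adj g) u) (mv (adj g) v)) = det3 g * dot (g 0 0, g 1 0, g 2 0) (cross u v)"
  by (cases u; cases v) (simp add: mv_def adj_simps cross_def dot_def det3_def algebra_simps)

lemma generic_det:
  assumes inf: "infinite (UNIV :: 'a::field set)"
  shows "generic (\<lambda>g :: nat \<Rightarrow> nat \<Rightarrow> 'a. det3 g \<noteq> 0)"
proof (rule generic_nonzero)
  show "det3 \<in> PF" unfolding det3_def[abs_def] by (intro PF_intros) auto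
  show "det3 (idm :: nat \<Rightarrow> nat \<Rightarrow> 'a) \<noteq> 0" by (simp add: det3_def idm_def)
qed

lemma generic_dot:
  fixes w :: "'a::field \<times> 'a \<times> 'a"
  assumes "w \<noteq> (0,0,0)"
  shows "generic (\<lambda>g. dot (g 0 0, g 1 0, g 2 0) w \<noteq> 0)"
proof -
  obtain u where u: "dot w u \<noteq> 0" using ex_dot_nonzero[OF assms] by blast
  show ?thesis
  proof (rule generic_nonzero)
    show "(\<lambda>g. dot (g 0 0, g 1 0, g 2 0) w) \<in> PF" unfolding dot_def fst_conv snd_conv by (intro PF_intros) auto
    show "dot (cols u u u 0 0, cols u u u 1 0, cols u u u 2 0) w \<noteq> 0"
      using u by (simp add: cols_def comp3_def dot_def mult.commute)
  qed
qed

lemma generic_off_line: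
  fixes p :: "'a::field \<times> 'a \<times> 'a"
  assumes "p \<noteq> (0,0,0)"
  shows "generic (\<lambda>g. snd (snd (mv (adj g) p)) \<noteq> 0)"
proof -
  obtain v w where vw: "det3 (cols p v w) \<noteq> 0" using ex_basis1[OF assms] by blast
  show ?thesis
  proof (rule generic_nonzero)
    have "(\<lambda>g. (g 1 0 * g 2 1 - g 1 1 * g 2 0) * fst p + (g 2 0 * g 0 1 - g 2 1 * g 0 0) * fst (snd p)
      + (g 0 0 * g 1 1 - g 0 1 * g 1 0) * snd (snd p)) \<in> PF" by (intro PF_intros) auto
    thus "(\<lambda>g. snd (snd (mv (adj g) p))) \<in> PF" by (cases p) (simp add: mv_def adj_simps)
    \<comment> \<open>The third row of the adjugate is the cross product of the first two columns,
      so the z-coordinate of the moved p is the determinant of p, v, w.\<close>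
    have "snd (snd (mv (adj (cols v w v)) p)) = det3 (cols p v w)"
      by (cases p; cases v; cases w)
         (simp add: mv_def adj_simps det3_cols cols_def comp3_def dot_def cross_def algebra_simps)
    thus "snd (snd (mv (adj (cols v w v)) p)) \<noteq> 0" using vw by simp
  qed
qed

context conic
begin

text \<open>Substituting g pulls points back by its inverse. The adjugate does the same up to a
  scalar that point ideals do not see, and has polynomial entries.\<close>

definition moved :: "(nat \<Rightarrow> nat \<Rightarrow> 'a) \<Rightarrow> nat \<Rightarrow> 'a \<times> 'a \<times> 'a" where
  "moved g i = mv (adj g) (p i)"

lemma lin_subst_symbolic_power:
  assumes det: "det3 g \<noteq> 0"
  shows "lin_subst g ` J m = symbolic_power r (moved g) m"
proof -
  have *: "lin_subst g f \<in> symbolic_power r (moved g) m \<longleftrightarrow> f \<in> J m" for f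
    unfolding J_iff symbolic_power_def
    using lin_subst_ideal_pow_iff[OF det mv_adj det, of f _ m] by (simp add: moved_def)
  show ?thesis
  proof (intro equalityI subsetI)
    fix F assume F: "F \<in> symbolic_power r (moved g) m"
    have "F = lin_subst g (lin_subst (inv3 g) F)" by (simp add: lin_subst_inv3[OF det])
    thus "F \<in> lin_subst g ` J m" using F * by (metis imageI)
  qed (use * in auto)
qed

lemma generic_e1_off_conic: "generic (\<lambda>g. lookup (lin_subst g Q) (2,0,0) \<noteq> 0)"
proof -
  \<comment> \<open>The sum of two points of the conic lies off it, since Q takes there the value
    \<open>bil Q (p 0) (p 1)\<close>.\<close>
  let ?v = "vadd (p 0) (p 1)"
  let ?g = "cols ?v ?v ?v"
  have "lookup F (2,0,0) = peval F (1,0,0)" if "homogeneous F 2" for F :: "'a pol3"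
    by (simp add: peval_quadratic[OF that])
  from this[OF homogeneous_lin_subst[OF hQ]]
  have "lookup (lin_subst ?g Q) (2,0,0) = peval (lin_subst ?g Q) (1,0,0)" .
  also have "\<dots> = peval Q ?v" by (simp add: peval_lin_subst mv_cols)
  also have "\<dots> = bil Q (p 0) (p 1)" using on[of 0] on[of 1] r by (simp add: bil_def)
  also have "\<dots> \<noteq> 0" using bil[of 0 1] r by simp
  finally show ?thesis by (rule generic_nonzero[OF lookup_lin_subst_PF])
qed

lemma generic_flagged: "generic (\<lambda>g. det3 g \<noteq> 0 \<and> flagged_conic (lin_subst g Q) r (moved g))"
proof -
  have 1: "generic (\<lambda>g. \<forall>i\<in>{..<r}. snd (snd (moved g i)) \<noteq> 0)"
    unfolding moved_def by (rule generic_ball[OF inf]) (auto intro!: generic_off_line p_nonzero)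
  have 2: "generic (\<lambda>g. \<forall>ij\<in>{(i,j). i < r \<and> j < r \<and> i \<noteq> j}. dot (g 0 0, g 1 0, g 2 0) (cross (p (fst ij)) (p (snd ij))) \<noteq> 0)"
  proof (rule generic_ball[OF inf], goal_cases)
    case 1
    show ?case by (rule finite_subset[of _ "{..<r} \<times> {..<r}"]) auto
  next
    case (2 ij)
    hence "cross (p (fst ij)) (p (snd ij)) \<noteq> (0,0,0)" using cross_nonzero by auto
    thus ?case by (rule generic_dot)
  qed
  show ?thesis
  proof (rule generic_mono[OF generic_conj[OF inf generic_conj[OF inf generic_det[OF inf] generic_e1_off_conic] generic_conj[OF inf 1 2]]])
    fix g :: "nat \<Rightarrow> nat \<Rightarrow> 'a"
    assume g: "(det3 g \<noteq> 0 \<and> lookup (lin_subst g Q) (2,0,0) \<noteq> 0) \<and> (\<forall>i\<in>{..<r}. snd (snd (moved g i)) \<noteq> 0) \<and>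
      (\<forall>ij\<in>{(i,j). i < r \<and> j < r \<and> i \<noteq> j}. dot (g 0 0, g 1 0, g 2 0) (cross (p (fst ij)) (p (snd ij))) \<noteq> 0)"
    have "flagged_conic (lin_subst g Q) r (moved g)"
    proof
      show "infinite (UNIV :: 'a set)" by (rule inf)
      show "homogeneous (lin_subst g Q) 2" by (rule homogeneous_lin_subst[OF hQ])
      show "2 \<le> r" by (rule r)
      show "lookup (lin_subst g Q) (2,0,0) \<noteq> 0" using g by blast
      fix i assume i: "i < r"
      show "peval (lin_subst g Q) (moved g i) = 0"
        by (simp add: peval_lin_subst moved_def mv_adj peval_smult3[OF hQ] on[OF i])
      show "snd (snd (moved g i)) \<noteq> 0" using g i by blast
      fix j assume j: "j < r" "i \<noteq> j"
      show "bil (lin_subst g Q) (moved g i) (moved g j) \<noteq> 0"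
        using g bil[OF i j] by (simp add: bil_lin_subst moved_def mv_adj bil_smult[OF hQ])
      have "dot (g 0 0, g 1 0, g 2 0) (cross (p (fst (i,j))) (p (snd (i,j)))) \<noteq> 0" using g i j by blast
      thus "fst (cross (moved g i) (moved g j)) \<noteq> 0" using g by (simp add: moved_def fst_cross_adj)
    qed
    thus "det3 g \<noteq> 0 \<and> flagged_conic (lin_subst g Q) r (moved g)" using g by blast
  qed
qed

text \<open>Shows that a generic initial ideal exists and that it is the ordinary initial ideal for
  some matrix in general position, so facts about leading exponents there carry over.\<close>

lemma gin_symbolic_power:
  "\<exists>g. flagged_conic (lin_subst g Q) r (moved g) \<and> gin (J m) = initial_ideal (symbolic_power r (moved g) m)"
proof -
  define D where "D = max r 4 * ((m + 1) div 2) + 3"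
  obtain T where T: "generic (\<lambda>g. det3 g \<noteq> 0 \<longrightarrow> {e \<in> leads (lin_subst g ` J m). tdeg e < D} = T)"
    using generic_leads[OF inf is_ideal_J] by blast
  \<comment> \<open>All leading exponents, reconstructed from the finite data T: the z-exponent
    plays no part, and \<open>leads_high_degree\<close> covers everything with a + b >= D.\<close>
  define L :: "(nat \<times> nat \<times> nat) set" where "L = {e. D \<le> fst e + fst (snd e) \<or> (fst e, fst (snd e), 0) \<in> T}"
  define M where "M = ideal_gen ((\<lambda>e. mon e (1::'a)) ` L)"
  have eq: "initial_ideal (lin_subst g ` J m) = M"
    if det: "det3 g \<noteq> 0" and fl: "flagged_conic (lin_subst g Q) r (moved g)"
      and T: "{e \<in> leads (lin_subst g ` J m). tdeg e < D} = T" for g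
  proof -
    interpret fl: flagged_conic "lin_subst g Q" r "moved g" by (rule fl)
    have "(a,b,c) \<in> leads (fl.J m) \<longleftrightarrow> (a,b,c) \<in> L" for a b c
    proof (cases "D \<le> a + b")
      case True
      thus ?thesis using fl.leads_high_degree[of m a b] fl.leads_saturated[of a b c m] by (auto simp: L_def D_def)
    next
      case False
      thus ?thesis using fl.leads_saturated[of a b c m]
        by (auto simp: L_def T[symmetric] lin_subst_symbolic_power[OF det] tdeg_def)
    qed
    hence "leads (fl.J m) = L" by auto
    thus ?thesis by (simp add: lin_subst_symbolic_power[OF det] initial_ideal_leads M_def)
  qed
  have gen: "generic (\<lambda>g. (det3 g \<noteq> 0 \<and> flagged_conic (lin_subst g Q) r (moved g)) \<and>
      (det3 g \<noteq> 0 \<longrightarrow> {e \<in> leads (lin_subst g ` J m). tdeg e < D} = T))"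
    by (rule generic_conj[OF inf generic_flagged T])
  have "gin (J m) = M"
    by (rule gin_eq[OF inf], rule generic_mono[OF gen]) (use eq in blast)
  moreover obtain g where "det3 g \<noteq> 0" "flagged_conic (lin_subst g Q) r (moved g)"
    "{e \<in> leads (lin_subst g ` J m). tdeg e < D} = T"
    using generic_ex[OF gen] by blast
  ultimately show ?thesis using eq[of g] lin_subst_symbolic_power[of g m] by auto
qed

text \<open>shows gin_bound: The multiples k on the axes are what makes the convex hull fill the
  unbounded region.\<close>

lemma
  shows gin_bound: "mon (a,b,0) 1 \<in> gin (J m) \<Longrightarrow> 2 * r * m \<le> max r 4 * a + min r 4 * b"
    and gin_x_axis: "1 \<le> k \<Longrightarrow> mon (k * (min r 4 * ((m + 1) div 2)), 0, 0) 1 \<in> gin (J m)"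
    and gin_y_axis: "1 \<le> k \<Longrightarrow> mon (0, k * (max r 4 * ((m + 1) div 2) + 3), 0) 1 \<in> gin (J m)"
proof -
  obtain g where fl: "flagged_conic (lin_subst g Q) r (moved g)"
    and gin: "gin (J m) = initial_ideal (symbolic_power r (moved g) m)"
    using gin_symbolic_power by blast
  interpret fl: flagged_conic "lin_subst g Q" r "moved g" by (rule fl)
  have iff: "mon e 1 \<in> gin (J m) \<longleftrightarrow> e \<in> leads (fl.J m)" for e
    unfolding gin by (rule mon_mem_initial_ideal[OF fl.is_ideal_J])
  show "mon (a,b,0) 1 \<in> gin (J m) \<Longrightarrow> 2 * r * m \<le> max r 4 * a + min r 4 * b"
    unfolding iff by (rule fl.leads_bound)
  assume k: "1 \<le> k"
  have "((k - 1) * (min r 4 * ((m + 1) div 2)), 0, 0) + (min r 4 * ((m + 1) div 2), 0, 0) \<in> leads (fl.J m)"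
    by (rule leads_add[OF fl.is_ideal_J fl.leads_x_axis])
  thus "mon (k * (min r 4 * ((m + 1) div 2)), 0, 0) 1 \<in> gin (J m)"
    unfolding iff using k by (cases k) (simp_all add: add.commute)
  show "mon (0, k * (max r 4 * ((m + 1) div 2) + 3), 0) 1 \<in> gin (J m)"
    unfolding iff using k by (intro fl.leads_high_degree) (cases k, simp_all)
qed

end

section \<open>The limiting shape\<close>

lemma ray_in_convex_hull:
  fixes v :: "real \<times> real"
  assumes "\<And>k::nat. 1 \<le> k \<Longrightarrow> real k *\<^sub>R v \<in> S" "1 \<le> t"
  shows "t *\<^sub>R v \<in> convex hull S"
proof -
  obtain n where n: "t < real n" using reals_Archimedean2 by blast
  have "1 *\<^sub>R v \<in> convex hull S" "real n *\<^sub>R v \<in> convex hull S"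
    using assms(1)[of 1] assms(1)[of n] assms(2) n by (auto intro: hull_inc)
  define s where "s = (t - 1) / (real n - 1)"
  have s: "0 \<le> s" "s \<le> 1" using assms(2) n by (auto simp: s_def divide_simps)
  have "(1 - s) *\<^sub>R (1 *\<^sub>R v) + s *\<^sub>R (real n *\<^sub>R v) \<in> convex hull S"
    by (rule convexD[OF convex_convex_hull]) (use s \<open>1 *\<^sub>R v \<in> _\<close> \<open>real n *\<^sub>R v \<in> _\<close> in auto)
  also have "(1 - s) *\<^sub>R (1 *\<^sub>R v) + s *\<^sub>R (real n *\<^sub>R v) = (1 + s * (real n - 1)) *\<^sub>R v"
    by (simp add: scaleR_add_left[symmetric] algebra_simps)
  also have "1 + s * (real n - 1) = t" using assms(2) n by (simp add: s_def)
  finally show ?thesis .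
qed

text \<open>With t = X / A + Y / B the point lies on the segment from (t A, 0) to (0, t B), whose
  ends are on the two rays of \<open>ray_in_convex_hull\<close>.\<close>

lemma triangle_complement_in_hull:
  fixes A B X Y :: real
  assumes A: "\<And>k::nat. 1 \<le> k \<Longrightarrow> (real k * A, 0) \<in> S" and B: "\<And>k::nat. 1 \<le> k \<Longrightarrow> (0, real k * B) \<in> S"
    and pos: "0 < A" "0 < B" "0 \<le> X" "0 \<le> Y" and ge: "1 \<le> X / A + Y / B"
  shows "(X, Y) \<in> convex hull S"
proof -
  define t where "t = X / A + Y / B"
  have t: "1 \<le> t" using ge by (simp add: t_def)
  have "t *\<^sub>R (A, 0) \<in> convex hull S" "t *\<^sub>R (0, B) \<in> convex hull S"
    using A B t by (intro ray_in_convex_hull; simp)+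
  moreover have "X / A / t + Y / B / t = t / t"
    unfolding add_divide_distrib[symmetric] t_def ..
  hence "X / A / t + Y / B / t = 1" using t by simp
  ultimately have "(X / A / t) *\<^sub>R (t *\<^sub>R (A, 0)) + (Y / B / t) *\<^sub>R (t *\<^sub>R (0, B)) \<in> convex hull S"
    using pos t by (intro convexD[OF convex_convex_hull]) auto
  thus ?thesis using pos t by simp
qed

lemma region_halfspaces:
  "{(u, v). u \<ge> 0 \<and> v \<ge> 0 \<and> u / \<alpha> + v / \<beta> \<ge> c} =
    {x :: real \<times> real. (1, 0) \<bullet> x \<ge> 0} \<inter> {x. (0, 1) \<bullet> x \<ge> 0} \<inter> {x. (1 / \<alpha>, 1 / \<beta>) \<bullet> x \<ge> c}"
  by auto

lemma convex_region: "convex {(u :: real, v). u \<ge> 0 \<and> v \<ge> 0 \<and> u / \<alpha> + v / \<beta> \<ge> c}"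
  unfolding region_halfspaces by (intro convex_Int convex_halfspace_ge)

lemma closed_region: "closed {(u :: real, v). u \<ge> 0 \<and> v \<ge> 0 \<and> u / \<alpha> + v / \<beta> \<ge> c}"
  unfolding region_halfspaces by (intro closed_Int closed_halfspace_ge)

text \<open>The rescaled sets all lie inside the closed limit region, so only approximation from
  inside needs an argument; the intercepts \<open>A m\<close> and \<open>B m\<close> have the right
  asymptotics for it.\<close>

lemma set_limit_region:
  fixes A B :: "nat \<Rightarrow> real"
  assumes pos: "0 < \<alpha>" "0 < \<beta>" "\<And>m. 1 \<le> m \<Longrightarrow> 0 < A m" "\<And>m. 1 \<le> m \<Longrightarrow> 0 < B m"
    and A: "(\<lambda>m. A m / real m) \<longlonglongrightarrow> \<alpha>" and B: "(\<lambda>m. B m / real m) \<longlonglongrightarrow> \<beta>"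
    and sub: "\<And>m. 1 \<le> m \<Longrightarrow> N m \<subseteq> {(u, v). u \<ge> 0 \<and> v \<ge> 0 \<and> u / \<alpha> + v / \<beta> \<ge> real m}"
    and super: "\<And>m X Y. 1 \<le> m \<Longrightarrow> 0 \<le> X \<Longrightarrow> 0 \<le> Y \<Longrightarrow> 1 \<le> X / A m + Y / B m \<Longrightarrow> (X, Y) \<in> N m"
  shows "set_limit (\<lambda>m. (\<lambda>x. (1 / real m) *\<^sub>R x) ` N m) {(u, v). u \<ge> 0 \<and> v \<ge> 0 \<and> u / \<alpha> + v / \<beta> \<ge> 1}"
    (is "set_limit ?S ?P")
proof -
  have SP: "?S m \<subseteq> ?P" if m: "1 \<le> m" for m
  proof
    fix x assume "x \<in> ?S m"
    then obtain y where y: "y \<in> N m" "x = (1 / real m) *\<^sub>R y" by blast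
    obtain X Y where "y = (X, Y)" by (cases y)
    with y have x: "x = (X / real m, Y / real m)" "(X, Y) \<in> N m" by auto
    have "0 \<le> X" "0 \<le> Y" "real m \<le> X / \<alpha> + Y / \<beta>" using sub[OF m] x(2) by auto
    moreover have "X / real m / \<alpha> + Y / real m / \<beta> = (X / \<alpha> + Y / \<beta>) / real m"
      by (simp add: add_divide_distrib mult.commute)
    ultimately show "x \<in> ?P" using m by (simp add: x(1) le_divide_eq)
  qed
  have lim_P: "x \<in> ?P" if "\<forall>\<^sub>F n in sequentially. u n \<in> ?P" "u \<longlonglongrightarrow> x" for u and x :: "real \<times> real"
    using Lim_in_closed_set[OF closed_region that(1) _ that(2)] by simp
  have ex: "\<exists>u. (\<forall>\<^sub>F m in sequentially. u m \<in> ?S m) \<and> u \<longlonglongrightarrow> x" if x: "x \<in> ?P" for x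
  proof -
    obtain a b where ab: "x = (a, b)" "0 \<le> a" "0 \<le> b" "1 \<le> a / \<alpha> + b / \<beta>" using x by auto
    \<comment> \<open>Stretching x by this factor compensates for whichever intercept is too large
      and places it in the m-th set; the factor tends to 1.\<close>
    define l where "l m = max (A m / real m / \<alpha>) (B m / real m / \<beta>)" for m
    have "l \<longlonglongrightarrow> max (\<alpha> / \<alpha>) (\<beta> / \<beta>)"
      unfolding l_def using pos by (intro tendsto_max tendsto_divide A B tendsto_const) auto
    hence "(\<lambda>m. l m *\<^sub>R x) \<longlonglongrightarrow> 1 *\<^sub>R x" using pos by (intro tendsto_scaleR tendsto_const) simp_all
    moreover have "l m *\<^sub>R x \<in> ?S m" if m: "1 \<le> m" for m
    proof -
      have p: "0 < A m" "0 < B m" "0 < real m" using pos m by auto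
      have "A m \<le> real m * l m * \<alpha>" "B m \<le> real m * l m * \<beta>"
        using p pos by (auto simp: l_def divide_simps max_def split: if_splits)
      hence "a / \<alpha> \<le> real m * l m * a / A m" "b / \<beta> \<le> real m * l m * b / B m"
        using p pos ab mult_right_mono[of "A m" "real m * l m * \<alpha>" a] mult_right_mono[of "B m" "real m * l m * \<beta>" b]
        by (simp_all add: divide_simps mult_ac)
      moreover have "0 \<le> A m / real m / \<alpha>" using p pos(1) by simp
      hence "0 \<le> l m" by (simp add: l_def le_max_iff_disj)
      ultimately have "(real m * l m * a, real m * l m * b) \<in> N m"
        using ab m by (intro super) auto
      thus ?thesis
        by (rule rev_image_eqI) (use p in \<open>simp add: ab(1)\<close>)
    qed
    hence "\<forall>\<^sub>F m in sequentially. l m *\<^sub>R x \<in> ?S m" by (auto simp: eventually_sequentially)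
    ultimately show ?thesis by auto
  qed
  show ?thesis unfolding set_limit_def
  proof (intro conjI allI impI iffI)
    show "\<exists>u. (\<forall>\<^sub>F m in sequentially. u m \<in> ?S m) \<and> u \<longlonglongrightarrow> x" if "x \<in> ?P" for x by (rule ex[OF that])
    show "x \<in> ?P" if lim: "\<exists>u. (\<forall>\<^sub>F m in sequentially. u m \<in> ?S m) \<and> u \<longlonglongrightarrow> x" for x
    proof -
      from lim obtain u where u: "\<forall>\<^sub>F m in sequentially. u m \<in> ?S m" "u \<longlonglongrightarrow> x" by (elim exE conjE)
      have "\<forall>\<^sub>F m in sequentially. u m \<in> ?P"
        using u(1) eventually_ge_at_top[of 1]
      proof eventually_elim
        case (elim m)
        from SP[OF elim(2)] elim(1) show ?case by (rule subsetD)
      qed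
      thus ?thesis using u(2) by (rule lim_P)
    qed
    fix x s u assume su: "strict_mono s \<and> (\<forall>\<^sub>F n in sequentially. u n \<in> ?S (s n)) \<and> u \<longlonglongrightarrow> x"
    have "\<forall>\<^sub>F n in sequentially. u n \<in> ?S (s n)" using su by blast
    hence "\<forall>\<^sub>F n in sequentially. u n \<in> ?P"
      using eventually_ge_at_top[of 1]
    proof eventually_elim
      case (elim n)
      have "1 \<le> s n" using elim(2) seq_suble[of s n] su by auto
      from SP[OF this] elim(1) show ?case by (rule subsetD)
    qed
    moreover have "u \<longlonglongrightarrow> x" using su by blast
    ultimately show "x \<in> ?P" by (rule lim_P)
  qed
qed

lemma half_ceiling_limit: "(\<lambda>m. real ((m + 1) div 2) / real m) \<longlonglongrightarrow> 1 / 2"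
proof (rule tendsto_sandwich[where f = "\<lambda>_. 1 / 2" and h = "\<lambda>m. 1 / 2 + 1 / 2 * (1 / real m)"])
  show "\<forall>\<^sub>F m in sequentially. 1 / 2 \<le> real ((m + 1) div 2) / real m"
    using eventually_ge_at_top[of 1]
  proof eventually_elim
    case (elim m)
    have "real m \<le> real (2 * ((m + 1) div 2))" by linarith
    thus ?case using elim by (simp add: divide_simps)
  qed
  show "\<forall>\<^sub>F m in sequentially. real ((m + 1) div 2) / real m \<le> 1 / 2 + 1 / 2 * (1 / real m)"
    using eventually_ge_at_top[of 1]
  proof eventually_elim
    case (elim m)
    have "real (2 * ((m + 1) div 2)) \<le> real (m + 1)" by (rule of_nat_mono) linarith
    thus ?case using elim by (simp add: divide_simps)
  qed
  have "(\<lambda>m. 1 / 2 + 1 / 2 * (1 / real m)) \<longlonglongrightarrow> 1 / 2 + 1 / 2 * 0"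
    by (intro tendsto_intros lim_1_over_n)
  thus "(\<lambda>m. 1 / 2 + 1 / 2 * (1 / real m)) \<longlonglongrightarrow> 1 / 2" by simp
qed simp

context conic
begin

lemma limiting_shape_J:
  "limiting_shape J {(u, v). u \<ge> 0 \<and> v \<ge> 0 \<and> u / (real (min r 4) / 2) + v / (real (max r 4) / 2) \<ge> 1}"
  unfolding limiting_shape_def
proof (rule set_limit_region)
  let ?A = "\<lambda>m. real (min r 4 * ((m + 1) div 2))" and ?B = "\<lambda>m. real (max r 4 * ((m + 1) div 2) + 3)"
  show "0 < real (min r 4) / 2" "0 < real (max r 4) / 2" using r by auto
  show "0 < ?A m" if "1 \<le> m" for m using that r by auto
  show "0 < ?B m" for m by linarith
  have "(\<lambda>m. real (min r 4) * (real ((m + 1) div 2) / real m)) \<longlonglongrightarrow> real (min r 4) * (1 / 2)"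
    by (intro tendsto_mult tendsto_const half_ceiling_limit)
  thus "(\<lambda>m. ?A m / real m) \<longlonglongrightarrow> real (min r 4) / 2" by simp
  have "(\<lambda>m. real (max r 4) * (real ((m + 1) div 2) / real m) + 3 * (1 / real m)) \<longlonglongrightarrow> real (max r 4) * (1 / 2) + 3 * 0"
    by (intro tendsto_add tendsto_mult tendsto_const half_ceiling_limit lim_1_over_n)
  thus "(\<lambda>m. ?B m / real m) \<longlonglongrightarrow> real (max r 4) / 2" by (simp add: add_divide_distrib)
  fix m :: nat assume m: "1 \<le> m"
  show "newton2 (gin (J m)) \<subseteq> {(u, v). 0 \<le> u \<and> 0 \<le> v \<and> real m \<le> u / (real (min r 4) / 2) + v / (real (max r 4) / 2)}"
    unfolding newton2_def
  proof (rule hull_minimal, clarify)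
    fix a b assume "mon (a,b,0) (1::'a) \<in> gin (J m)"
    from gin_bound[OF this] have "real (2 * r * m) \<le> real (max r 4 * a + min r 4 * b)" by (rule of_nat_mono)
    hence *: "2 * real r * real m \<le> real (max r 4) * real a + real (min r 4) * real b" by simp
    \<comment> \<open>Turns the bound on leading exponents into the equation of the line through
      both corners.\<close>
    have mm: "real (min r 4) * real (max r 4) = 4 * real r" by (simp add: min_def max_def)
    have "real m * (real (min r 4) * real (max r 4)) = 2 * (2 * real r * real m)" unfolding mm by simp
    also have "\<dots> \<le> 2 * (real (max r 4) * real a + real (min r 4) * real b)" using * by simp
    also have "\<dots> = (real a / (real (min r 4) / 2) + real b / (real (max r 4) / 2)) * (real (min r 4) * real (max r 4))"
      using r by (simp add: field_simps)
    finally have "real m \<le> real a / (real (min r 4) / 2) + real b / (real (max r 4) / 2)"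
      using r by (subst (asm) mult_le_cancel_right) auto
    thus "0 \<le> real a \<and> 0 \<le> real b \<and> real m \<le> real a / (real (min r 4) / 2) + real b / (real (max r 4) / 2)" by simp
  qed (rule convex_region)
  fix X Y :: real assume XY: "0 \<le> X" "0 \<le> Y" "1 \<le> X / ?A m + Y / ?B m"
  show "(X, Y) \<in> newton2 (gin (J m))"
    unfolding newton2_def
  proof (rule triangle_complement_in_hull[OF _ _ _ _ XY])
    show "0 < ?A m" using m r by auto
    show "0 < ?B m" by linarith
    fix k :: nat assume k: "1 \<le> k"
    show "(real k * ?A m, 0) \<in> {(real a, real b) | a b. mon (a,b,0) (1::'a) \<in> gin (J m)}"
      using gin_x_axis[OF k, of m] by (intro CollectI exI[of _ "k * (min r 4 * ((m + 1) div 2))"] exI[of _ 0]) simp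
    show "(0, real k * ?B m) \<in> {(real a, real b) | a b. mon (a,b,0) (1::'a) \<in> gin (J m)}"
      using gin_y_axis[OF k, of m]
      by (intro CollectI exI[of _ 0] exI[of _ "k * (max r 4 * ((m + 1) div 2) + 3)"]) (simp add: algebra_simps)
  qed
qed

end

theorem theorem1:
  fixes r :: nat and p :: "nat \<Rightarrow> 'a::field \<times> 'a \<times> 'a"
  assumes "infinite (UNIV :: 'a set)"
    and "r > 1"
    and "distinct_proj_points r p"
    and "on_irreducible_conic r p"
  shows "(r \<ge> 4 \<longrightarrow> limiting_shape (symbolic_power r p)
            {(u, v). u \<ge> 0 \<and> v \<ge> 0 \<and> u / 2 + v / (real r / 2) \<ge> 1})
       \<and> ((r = 2 \<or> r = 3) \<longrightarrow> limiting_shape (symbolic_power r p)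
            {(u, v). u \<ge> 0 \<and> v \<ge> 0 \<and> u / (real r / 2) + v / 2 \<ge> 1})"
proof -
  obtain Q :: "'a pol3" where Q: "homogeneous Q 2" "irreducible Q" "\<And>i. i < r \<Longrightarrow> peval Q (p i) = 0"
    using assms(4) unfolding on_irreducible_conic_def by blast
  interpret conic Q r p
  proof
    fix i j assume ij: "i < r" "j < r" "i \<noteq> j"
    have "cross (p i) (p j) \<noteq> (0,0,0)"
      using cross_eq_0[of "p i" "p j"] assms(3) ij unfolding distinct_proj_points_def by blast
    thus "bil Q (p i) (p j) \<noteq> 0" by (intro bil_nonzero_if_irreducible Q ij)
  qed (use assms Q in auto)
  show ?thesis
  proof (intro conjI impI)
    assume "4 \<le> r"
    hence "min r 4 = 4" "max r 4 = r" by auto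
    thus "limiting_shape J {(u, v). u \<ge> 0 \<and> v \<ge> 0 \<and> u / 2 + v / (real r / 2) \<ge> 1}"
      using limiting_shape_J by simp
  next
    assume "r = 2 \<or> r = 3"
    hence "min r 4 = r" "max r 4 = 4" by auto
    thus "limiting_shape J {(u, v). u \<ge> 0 \<and> v \<ge> 0 \<and> u / (real r / 2) + v / 2 \<ge> 1}"
      using limiting_shape_J by simp
  qed
qed

end
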